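(* Let $G=N\rtimes J$ be a profinite semidirect product, where $N$ is pronilpotent and either $G$ is prosupersolvable or $J$ is pronilpotent. Let $H$ be a closed subgroup of $G$. If $N\cap H$ is normal in $N$ and, for each prime $p$, $H$ contains a conjugate (in $G$) of some Sylow $p$-subgroup of $J$, then $H$ contains a conjugate (in $G$) of $J$.
   Context: A profinite semidirect product $G=N\rtimes J$ is a profinite group $G$ with a closed normal subgroup $N$ and a closed subgroup $J$ such that $G=NJ$ and $N\cap J=1$. A profinite group is pronilpotent (resp. prosupersolvable) if it is an inverse limit of finite nilpotent (resp. finite supersolvable) groups. Sylow $p$-subgroups are in the profinite sense (maximal pro-$p$ subgroups). *)

theory Defs
  imports
    "HOL-Analysis.Analysis"
    "HOL-Algebra.Product_Groups"
    "HOL-Algebra.Elementary_Groups"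
    "HOL-Computational_Algebra.Primes"
begin

text \<open>Classes of finite groups\<close>

definition center :: "('a, 'm) monoid_scheme \<Rightarrow> 'a set" where
  "center G = {z \<in> carrier G. \<forall>g \<in> carrier G. z \<otimes>\<^bsub>G\<^esub> g = g \<otimes>\<^bsub>G\<^esub> z}"

text \<open>\<open>S 0 \<subseteq> \<dots> \<subseteq> S n\<close> is a series from the trivial subgroup to \<open>G\<close>, all of
  whose terms are normal in the whole group \<open>G\<close>.\<close>

definition normal_series :: "('a, 'm) monoid_scheme \<Rightarrow> nat \<Rightarrow> (nat \<Rightarrow> 'a set) \<Rightarrow> bool" where
  "normal_series G n S \<longleftrightarrow>
     S 0 = {\<one>\<^bsub>G\<^esub>} \<and> S n = carrier G \<and>
     (\<forall>i\<le>n. S i \<lhd> G) \<and> (\<forall>i<n. S i \<subseteq> S (Suc i))"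

definition nilpotent_group :: "('a, 'm) monoid_scheme \<Rightarrow> bool" where
  "nilpotent_group G \<longleftrightarrow> group G \<and>
     (\<exists>n S. normal_series G n S \<and>
        (\<forall>i<n. (\<lambda>x. S i #>\<^bsub>G\<^esub> x) ` S (Suc i) \<subseteq> center (G Mod S i)))"

definition supersolvable_group :: "('a, 'm) monoid_scheme \<Rightarrow> bool" where
  "supersolvable_group G \<longleftrightarrow> group G \<and>
     (\<exists>n S. normal_series G n S \<and>
        (\<forall>i<n. cyclic_group (G\<lparr>carrier := S (Suc i)\<rparr> Mod S i)))"

definition p_power_order_group :: "nat \<Rightarrow> ('a, 'm) monoid_scheme \<Rightarrow> bool" where
  "p_power_order_group p G \<longleftrightarrow> group G \<and> (\<exists>n. order G = p ^ n)"

text \<open>Topological groups\<close>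

definition topological_group :: "('a, 'm) monoid_scheme \<Rightarrow> 'a topology \<Rightarrow> bool" where
  "topological_group G T \<longleftrightarrow>
     group G \<and> topspace T = carrier G \<and>
     continuous_map (prod_topology T T) T (\<lambda>(x, y). x \<otimes>\<^bsub>G\<^esub> y) \<and>
     continuous_map T T (\<lambda>x. inv\<^bsub>G\<^esub> x)"

definition closed_subgroup :: "('a, 'm) monoid_scheme \<Rightarrow> 'a topology \<Rightarrow> 'a set \<Rightarrow> bool" where
  "closed_subgroup G T H \<longleftrightarrow> subgroup H G \<and> closedin T H"

text \<open>An inverse system over the directed poset \<open>(I, r)\<close>, where \<open>(i, j) \<in> r\<close> stands for
  \<open>i \<le> j\<close> and \<open>\<phi> i j\<close> maps \<open>\<Gamma> j\<close> to \<open>\<Gamma> i\<close>.\<close>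

definition inverse_system ::
  "'i set \<Rightarrow> 'i rel \<Rightarrow> ('i \<Rightarrow> 'b monoid) \<Rightarrow> ('i \<Rightarrow> 'i \<Rightarrow> 'b \<Rightarrow> 'b) \<Rightarrow> bool" where
  "inverse_system I r \<Gamma> \<phi> \<longleftrightarrow>
     I \<noteq> {} \<and> partial_order_on I r \<and>
     (\<forall>i \<in> I. \<forall>j \<in> I. \<exists>k \<in> I. (i, k) \<in> r \<and> (j, k) \<in> r) \<and>
     (\<forall>i \<in> I. group (\<Gamma> i)) \<and>
     (\<forall>i j. (i, j) \<in> r \<longrightarrow> \<phi> i j \<in> hom (\<Gamma> j) (\<Gamma> i)) \<and>
     (\<forall>i \<in> I. \<forall>x \<in> carrier (\<Gamma> i). \<phi> i i x = x) \<and>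
     (\<forall>i j k. (i, j) \<in> r \<longrightarrow> (j, k) \<in> r \<longrightarrow>
        (\<forall>x \<in> carrier (\<Gamma> k). \<phi> i j (\<phi> j k x) = \<phi> i k x))"

definition inverse_limit ::
  "'i set \<Rightarrow> 'i rel \<Rightarrow> ('i \<Rightarrow> 'b monoid) \<Rightarrow> ('i \<Rightarrow> 'i \<Rightarrow> 'b \<Rightarrow> 'b) \<Rightarrow> ('i \<Rightarrow> 'b) monoid" where
  "inverse_limit I r \<Gamma> \<phi> = (product_group I \<Gamma>)
     \<lparr>carrier := {x \<in> carrier (product_group I \<Gamma>). \<forall>i j. (i, j) \<in> r \<longrightarrow> \<phi> i j (x j) = x i}\<rparr>"

definition inverse_limit_topology ::
  "'i set \<Rightarrow> 'i rel \<Rightarrow> ('i \<Rightarrow> 'b monoid) \<Rightarrow> ('i \<Rightarrow> 'i \<Rightarrow> 'b \<Rightarrow> 'b) \<Rightarrow> ('i \<Rightarrow> 'b) topology" where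
  "inverse_limit_topology I r \<Gamma> \<phi> =
     subtopology (product_topology (\<lambda>i. discrete_topology (carrier (\<Gamma> i))) I)
       (carrier (inverse_limit I r \<Gamma> \<phi>))"

text \<open>\<open>pro C G T\<close>: the topological group \<open>(G, T)\<close> is, up to topological isomorphism, an inverse
  limit of finite (discrete) groups satisfying \<open>C\<close>.

  Types cannot be quantified existentially, so the index set and the finite groups are taken in
  \<open>'a set\<close>. This loses no generality if \<open>C\<close> passes to subgroups and isomorphic groups (as do all
  the classes below): given any representation of \<open>G\<close> as an inverse limit of groups \<open>\<Gamma> i\<close> in \<open>C\<close>,
  let \<open>K i\<close> be the kernel of the projection \<open>G \<rightarrow> \<Gamma> i\<close>; then \<open>G Mod K i\<close> embeds in \<open>\<Gamma> i\<close>, and by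
  compactness \<open>G\<close> is the inverse limit of the groups \<open>G Mod K i\<close>, indexed by the set of all \<open>K i\<close>
  ordered by reverse inclusion.\<close>

definition pro :: "('a set monoid \<Rightarrow> bool) \<Rightarrow> ('a, 'm) monoid_scheme \<Rightarrow> 'a topology \<Rightarrow> bool" where
  "pro C G T \<longleftrightarrow> topological_group G T \<and>
     (\<exists>(I :: 'a set set) r (\<Gamma> :: 'a set \<Rightarrow> 'a set monoid) \<phi> f.
        inverse_system I r \<Gamma> \<phi> \<and>
        (\<forall>i \<in> I. finite (carrier (\<Gamma> i)) \<and> C (\<Gamma> i)) \<and>
        f \<in> iso G (inverse_limit I r \<Gamma> \<phi>) \<and>
        homeomorphic_map T (inverse_limit_topology I r \<Gamma> \<phi>) f)"

definition profinite :: "('a, 'm) monoid_scheme \<Rightarrow> 'a topology \<Rightarrow> bool" where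
  "profinite = pro group"

definition pronilpotent :: "('a, 'm) monoid_scheme \<Rightarrow> 'a topology \<Rightarrow> bool" where
  "pronilpotent = pro nilpotent_group"

definition prosupersolvable :: "('a, 'm) monoid_scheme \<Rightarrow> 'a topology \<Rightarrow> bool" where
  "prosupersolvable = pro supersolvable_group"

definition pro_p :: "nat \<Rightarrow> ('a, 'm) monoid_scheme \<Rightarrow> 'a topology \<Rightarrow> bool" where
  "pro_p p = pro (p_power_order_group p)"

definition pro_p_subgroup ::
  "nat \<Rightarrow> ('a, 'm) monoid_scheme \<Rightarrow> 'a topology \<Rightarrow> 'a set \<Rightarrow> bool" where
  "pro_p_subgroup p G T P \<longleftrightarrow>
     closed_subgroup G T P \<and> pro_p p (G\<lparr>carrier := P\<rparr>) (subtopology T P)"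

definition sylow_subgroup ::
  "nat \<Rightarrow> ('a, 'm) monoid_scheme \<Rightarrow> 'a topology \<Rightarrow> 'a set \<Rightarrow> bool" where
  "sylow_subgroup p G T P \<longleftrightarrow>
     pro_p_subgroup p G T P \<and> (\<forall>Q. pro_p_subgroup p G T Q \<longrightarrow> P \<subseteq> Q \<longrightarrow> Q = P)"

definition profinite_semidirect_product ::
  "('a, 'm) monoid_scheme \<Rightarrow> 'a topology \<Rightarrow> 'a set \<Rightarrow> 'a set \<Rightarrow> bool" where
  "profinite_semidirect_product G T N J \<longleftrightarrow>
     profinite G T \<and>
     N \<lhd> G \<and> closedin T N \<and>
     closed_subgroup G T J \<and>
     N <#>\<^bsub>G\<^esub> J = carrier G \<and> N \<inter> J = {\<one>\<^bsub>G\<^esub>}"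

definition conjugate :: "('a, 'm) monoid_scheme \<Rightarrow> 'a \<Rightarrow> 'a set \<Rightarrow> 'a set" where
  "conjugate G g A = (\<lambda>a. g \<otimes>\<^bsub>G\<^esub> a \<otimes>\<^bsub>G\<^esub> inv\<^bsub>G\<^esub> g) ` A"

end

theory Submission
  imports Defs "HOL-Algebra.Sylow" "HOL-Algebra.Zassenhaus" "HOL-Algebra.SndIsomorphismGrp"
    "HOL-Algebra.Multiplicative_Group"
begin

text \<open>
  For an open normal subgroup \<open>U\<close>, let \<open>S U\<close> be the set of all \<open>n \<in> N\<close> with
  \<open>n J n\<^sup>-\<^sup>1 \<subseteq> H U\<close>. These sets are closed and directed, so once all of them are nonempty they have
  a common element by compactness, and it conjugates \<open>J\<close> into \<open>\<Inter>U. H U = H\<close>. Nonemptiness of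
  \<open>S U\<close> is a statement about a finite quotient.

  To reach that quotient, note that local conjugacy makes the index of \<open>N H\<close> prime to every \<open>p\<close>, so
  \<open>N H = G\<close> (\<open>locally_conjugate_covers\<close>) and \<open>N \<inter> H\<close>, which \<open>N\<close> and \<open>H\<close> normalise, is normal in \<open>G\<close>. In \<open>G / U\<close> the image of \<open>N\<close>
  may meet those of \<open>J\<close> and \<open>H\<close> in the wrong subgroups. Therefore \<open>H\<close> is enlarged to the open
  subgroup \<open>H\<^sub>1 = (U \<inter> N) H\<close>, which meets \<open>N\<close> in the normal subgroup \<open>K = (U \<inter> N) (N \<inter> H)\<close>, and the
  quotient is taken by \<open>W = K (U' \<inter> J)\<close>, where \<open>U'\<close> is an open normal subgroup contained in \<open>H\<^sub>1\<close>.
  Then \<open>W\<close> is normal of finite index, and in \<open>G / W\<close> both \<open>J\<close> and \<open>H\<^sub>1\<close> become complements of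
  \<open>N\<close> (\<open>conjugate_into_mod_open\<close>).

  The finite statement (\<open>locally_conjugate_complements\<close>) concerns two complements \<open>J\<close>, \<open>H\<close> of a
  nilpotent normal subgroup \<open>N\<close>, where \<open>J\<close> or the derived subgroup of \<open>G\<close> is nilpotent; the latter
  holds if \<open>G\<close> is supersolvable. For a prime \<open>q\<close> write \<open>N\<^sub>q\<close> and \<open>N\<^sub>q\<^sub>'\<close> for the
  Hall subgroups of \<open>N\<close>. In both cases there are normal subgroups \<open>L \<subseteq> R\<close> of \<open>G\<close> such that \<open>L\<close> is a
  \<open>q'\<close>-group containing \<open>N\<^sub>q\<^sub>'\<close>, \<open>R / L\<close> is a \<open>q\<close>-group and \<open>G / R\<close> is a \<open>q'\<close>-group. Let \<open>Q\<close>
  be a Sylow \<open>q\<close>-subgroup of \<open>J\<close>, after conjugation contained in \<open>H\<close>. Then \<open>Q L\<close> is the intersection of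
  \<open>R\<close> with \<open>J L\<close> as well as with \<open>H N\<^sub>q\<^sub>'\<close>, so both of these normalise it. Modulo \<open>Q L\<close> they have order
  prime to \<open>q\<close>, and they differ by the normal \<open>q\<close>-subgroup coming from \<open>R\<close>; hence they are conjugate by
  the Schur-Zassenhaus theorem (\<open>conjugate_into_of_q_length_one\<close>). So some \<open>n \<in> N\<^sub>q\<close> conjugates
  \<open>J\<close> into \<open>H N\<^sub>q\<^sub>'\<close>. Elements \<open>n\<close> for different primes commute, and their product conjugates
  \<open>J\<close> into the intersection of the \<open>H N\<^sub>q\<^sub>'\<close>, which is \<open>H\<close>.

  The Sylow subgroups of the profinite group \<open>J\<close> enter through one property only: their images in finite
  quotients have index prime to \<open>p\<close> (\<open>sylow_coprime_index\<close>).
\<close>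

section \<open>Subgroups, conjugates and quotients\<close>

lemma set_mult_iff: "x \<in> A <#>\<^bsub>G\<^esub> B \<longleftrightarrow> (\<exists>a\<in>A. \<exists>b\<in>B. x = a \<otimes>\<^bsub>G\<^esub> b)"
  by (auto simp: set_mult_def)

lemma set_multE:
  assumes "x \<in> A <#>\<^bsub>G\<^esub> B"
  obtains a b where "a \<in> A" "b \<in> B" "x = a \<otimes>\<^bsub>G\<^esub> b"
  using assms by (auto simp: set_mult_iff)

lemma set_multI: "a \<in> A \<Longrightarrow> b \<in> B \<Longrightarrow> a \<otimes>\<^bsub>G\<^esub> b \<in> A <#>\<^bsub>G\<^esub> B"
  by (auto simp: set_mult_iff)

lemma (in group) subset_set_mult_left: "A \<subseteq> carrier G \<Longrightarrow> \<one> \<in> B \<Longrightarrow> A \<subseteq> A <#> B"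
  using set_multI[of _ A \<one> B G] by (metis r_one subsetD subsetI)

lemma (in group) subset_set_mult_right: "B \<subseteq> carrier G \<Longrightarrow> \<one> \<in> A \<Longrightarrow> B \<subseteq> A <#> B"
  using set_multI[of \<one> A _ B G] by (metis l_one subsetD subsetI)

lemma (in group) subgroup_subset_set_mult:
  assumes "subgroup A G" "subgroup B G"
  shows "A \<subseteq> A <#> B" "B \<subseteq> A <#> B"
  using subset_set_mult_left[OF subgroup.subset[OF assms(1)] subgroup.one_closed[OF assms(2)]]
    subset_set_mult_right[OF subgroup.subset[OF assms(2)] subgroup.one_closed[OF assms(1)]] .

lemma (in group) set_mult_absorb:
  assumes "subgroup U G" "subgroup V G" "V \<subseteq> U"
  shows "U <#> V = U"
proof
  show "U <#> V \<subseteq> U"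
  proof
    fix x assume "x \<in> U <#> V"
    then obtain u v where uv: "u \<in> U" "v \<in> V" "x = u \<otimes> v" by (rule set_multE)
    show "x \<in> U" unfolding uv(3) by (rule subgroup.m_closed[OF assms(1) uv(1) subsetD[OF assms(3) uv(2)]])
  qed
  show "U \<subseteq> U <#> V" by (rule subgroup_subset_set_mult(1)[OF assms(1) assms(2)])
qed

lemma (in group) inv_mult_cancel:
  assumes "x \<in> carrier G" "y \<in> carrier G"
  shows "inv x \<otimes> (x \<otimes> y) = y" "x \<otimes> (inv x \<otimes> y) = y"
  using assms by (simp_all add: m_assoc[symmetric])

lemma (in group) conjugation_hom:
  assumes "g \<in> carrier G"
  shows "group_hom G G (\<lambda>a. g \<otimes> a \<otimes> inv g)"
  by (intro group_hom.intro group_hom_axioms.intro is_group homI)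
    (use assms in \<open>simp_all add: m_assoc inv_mult_cancel\<close>)

lemma (in group) conjugate_subgroup:
  assumes "subgroup A G" "g \<in> carrier G"
  shows "subgroup (conjugate G g A) G"
  unfolding conjugate_def by (rule group_hom.subgroup_img_is_subgroup[OF conjugation_hom[OF assms(2)] assms(1)])

lemma (in group) conjugate_card:
  assumes "A \<subseteq> carrier G" "g \<in> carrier G"
  shows "card (conjugate G g A) = card A"
  unfolding conjugate_def using assms
  by (intro card_image inj_onI) (auto simp: subset_iff)

lemma (in group) conjugate_conjugate:
  assumes "A \<subseteq> carrier G" "g \<in> carrier G" "h \<in> carrier G"
  shows "conjugate G g (conjugate G h A) = conjugate G (g \<otimes> h) A"
  unfolding conjugate_def image_image using assms
  by (intro image_cong) (auto simp: m_assoc inv_mult_group subset_iff)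

lemma conjugate_mono: "A \<subseteq> B \<Longrightarrow> conjugate G g A \<subseteq> conjugate G g B"
  by (auto simp: conjugate_def)

lemma (in group) conjugate_subset_carrier:
  assumes "A \<subseteq> carrier G" "g \<in> carrier G"
  shows "conjugate G g A \<subseteq> carrier G"
  using assms unfolding conjugate_def by auto

lemma (in group) conjugate_mem_subset:
  assumes "subgroup A G" "g \<in> A"
  shows "conjugate G g A \<subseteq> A"
  unfolding conjugate_def
  by (intro image_subsetI subgroup.m_closed[OF assms(1)] subgroup.m_inv_closed[OF assms(1)] assms(2))

lemma (in group) conjugate_self:
  assumes "subgroup J G" "j \<in> J"
  shows "conjugate G j J = J"
proof
  show "conjugate G j J \<subseteq> J" by (rule conjugate_mem_subset[OF assms])
  show "J \<subseteq> conjugate G j J"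
  proof
    fix y assume y: "y \<in> J"
    have c: "y \<in> carrier G" "j \<in> carrier G" using y assms(2) subgroup.mem_carrier[OF assms(1)] by auto
    have "y = j \<otimes> (inv j \<otimes> y \<otimes> j) \<otimes> inv j" using c by (simp add: m_assoc inv_mult_cancel)
    moreover have "inv j \<otimes> y \<otimes> j \<in> J"
      by (intro subgroup.m_closed[OF assms(1)] subgroup.m_inv_closed[OF assms(1)] assms(2) y)
    ultimately show "y \<in> conjugate G j J" unfolding conjugate_def by blast
  qed
qed

lemma (in group_hom) image_conjugate:
  assumes "A \<subseteq> carrier G" "g \<in> carrier G"
  shows "h ` conjugate G g A = conjugate H (h g) (h ` A)"
  unfolding conjugate_def image_image using assms
  by (intro image_cong) (auto simp: subset_iff)

lemma (in group_hom) image_mem_iff: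
  assumes "subgroup B G" "kernel G H h \<subseteq> B" "x \<in> carrier G"
  shows "h x \<in> h ` B \<longleftrightarrow> x \<in> B"
proof
  assume "h x \<in> h ` B"
  then obtain b where b: "b \<in> B" "h x = h b" by auto
  have bc: "b \<in> carrier G" using b assms subgroup.mem_carrier by metis
  have "inv b \<otimes> x \<in> kernel G H h" using b bc assms(3) by (simp add: kernel_def)
  then have "inv b \<otimes> x \<in> B" using assms(2) by auto
  then have "b \<otimes> (inv b \<otimes> x) \<in> B" by (rule subgroup.m_closed[OF assms(1) b(1)])
  then show "x \<in> B" using bc assms(3) by (simp add: G.m_assoc[symmetric])
qed auto

lemma group_hom_subgroup:
  assumes "group_hom G K k" "subgroup Q G"
  shows "group_hom (G\<lparr>carrier := Q\<rparr>) K k"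
proof -
  interpret k: group_hom G K k by (rule assms)
  show ?thesis
    by (intro group_hom.intro group_hom_axioms.intro k.H.is_group k.G.subgroup_imp_group[OF assms(2)] homI)
      (use subgroup.mem_carrier[OF assms(2)] in auto)
qed

lemma (in group_hom) factor_through:
  assumes f: "group_hom G F f" and ker: "kernel G H h \<subseteq> kernel G F f"
  obtains \<psi> where "group_hom (H\<lparr>carrier := h ` carrier G\<rparr>) F \<psi>" "\<And>x. x \<in> carrier G \<Longrightarrow> \<psi> (h x) = f x"
proof -
  interpret f: group_hom G F f by (rule f)
  define \<psi> where "\<psi> y = f (inv_into (carrier G) h y)" for y
  have eq: "\<psi> (h x) = f x" if x: "x \<in> carrier G" for x
  proof -
    define x' where "x' = inv_into (carrier G) h (h x)"
    have x': "x' \<in> carrier G" "h x' = h x"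
      unfolding x'_def using x by (auto intro: inv_into_into f_inv_into_f)
    have "h (inv x \<otimes> x') = \<one>\<^bsub>H\<^esub>" using x x' by simp
    then have "inv x \<otimes> x' \<in> kernel G H h" using x x' by (simp add: kernel_def)
    then have "f (inv x \<otimes> x') = \<one>\<^bsub>F\<^esub>" using ker by (auto simp: kernel_def)
    then have "f (x \<otimes> (inv x \<otimes> x')) = f x" using x x' by simp
    then show ?thesis using x x' unfolding \<psi>_def x'_def[symmetric] by (simp add: G.inv_mult_cancel)
  qed
  have "group_hom (H\<lparr>carrier := h ` carrier G\<rparr>) F \<psi>"
  proof (intro group_hom.intro group_hom_axioms.intro homI)
    show "group (H\<lparr>carrier := h ` carrier G\<rparr>)" by (rule H.subgroup_imp_group[OF img_is_subgroup])
    show "group F" by (rule f.H.is_group)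
    show "\<psi> y \<in> carrier F" if "y \<in> carrier (H\<lparr>carrier := h ` carrier G\<rparr>)" for y
      using that eq by auto
    show "\<psi> (y \<otimes>\<^bsub>H\<lparr>carrier := h ` carrier G\<rparr>\<^esub> z) = \<psi> y \<otimes>\<^bsub>F\<^esub> \<psi> z"
      if y: "y \<in> carrier (H\<lparr>carrier := h ` carrier G\<rparr>)" and z: "z \<in> carrier (H\<lparr>carrier := h ` carrier G\<rparr>)" for y z
    proof -
      obtain u where u: "u \<in> carrier G" "y = h u" using y by auto
      obtain v where v: "v \<in> carrier G" "z = h v" using z by auto
      show ?thesis using eq[OF G.m_closed[OF u(1) v(1)]] u v eq by simp
    qed
  qed
  then show ?thesis using that eq by blast
qed

lemma (in normal) quotient_hom: "group_hom G (G Mod H) (\<lambda>x. H #> x)"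
  by (intro group_hom.intro group_hom_axioms.intro is_group factorgroup_is_group r_coset_hom_Mod)

lemma (in normal) quotient_kernel: "kernel G (G Mod H) (\<lambda>x. H #> x) = H"
  using coset_join2[OF _ subgroup_axioms] rcos_self[OF _ subgroup_axioms] by (auto simp: kernel_def)

lemma (in normal) quotient_eq_iff:
  assumes "x \<in> carrier G" "y \<in> carrier G"
  shows "H #> x = H #> y \<longleftrightarrow> inv x \<otimes> y \<in> H"
proof -
  interpret q: group_hom G "G Mod H" "\<lambda>x. H #> x" by (rule quotient_hom)
  have "inv x \<otimes> y \<in> H \<longleftrightarrow> inv x \<otimes> y \<in> kernel G (G Mod H) (\<lambda>x. H #> x)"
    by (simp add: quotient_kernel)
  also have "\<dots> \<longleftrightarrow> inv\<^bsub>G Mod H\<^esub> (H #> x) \<otimes>\<^bsub>G Mod H\<^esub> (H #> y) = \<one>\<^bsub>G Mod H\<^esub>"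
    using assms unfolding kernel_def by (simp del: one_FactGroup mult_FactGroup)
  also have "\<dots> \<longleftrightarrow> H #> x = H #> y"
    using assms q.hom_closed by (metis q.H.inv_closed q.H.inv_inv q.H.inv_equality q.H.l_inv)
  finally show ?thesis by simp
qed

lemma (in normal) quotient_eq_iff_right:
  assumes "x \<in> carrier G" "y \<in> carrier G"
  shows "H #> x = H #> y \<longleftrightarrow> x \<otimes> inv y \<in> H"
proof
  assume "H #> x = H #> y"
  then have "x \<in> H #> y" using rcos_self[OF assms(1) subgroup_axioms] by simp
  then obtain h where "h \<in> H" "x = h \<otimes> y" by (auto simp: r_coset_def)
  moreover then have "x \<otimes> inv y = h" using assms(2) mem_carrier by (simp add: m_assoc)
  ultimately show "x \<otimes> inv y \<in> H" by simp
next
  assume h: "x \<otimes> inv y \<in> H"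
  have "H #> (x \<otimes> inv y) = H" by (rule rcos_const[OF is_group h])
  then have "H #> (x \<otimes> inv y) #> y = H #> y" by simp
  moreover have "H #> (x \<otimes> inv y) #> y = H #> x"
    using assms subset by (simp add: coset_mult_assoc m_assoc)
  ultimately show "H #> x = H #> y" by simp
qed

lemma (in normal) quotient_image_mem_iff:
  assumes "subgroup B G" "H \<subseteq> B" "x \<in> carrier G"
  shows "H #> x \<in> (\<lambda>x. H #> x) ` B \<longleftrightarrow> x \<in> B"
  using group_hom.image_mem_iff[OF quotient_hom, of B x] assms by (simp add: quotient_kernel)

lemma (in normal) quotient_image_set_mult:
  assumes "B \<subseteq> carrier G"
  shows "(\<lambda>x. H #> x) ` (H <#> B) = (\<lambda>x. H #> x) ` B"
proof
  have "H #> (a \<otimes> b) = H #> b" if "a \<in> H" "b \<in> B" for a b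
    using coset_mult_assoc[OF subset, of a b] rcos_const[OF is_group that(1)] that assms by auto
  then show "(\<lambda>x. H #> x) ` (H <#> B) \<subseteq> (\<lambda>x. H #> x) ` B"
    unfolding set_mult_iff by (auto simp: set_mult_iff)
  show "(\<lambda>x. H #> x) ` B \<subseteq> (\<lambda>x. H #> x) ` (H <#> B)"
    by (intro image_mono subset_set_mult_right assms subgroup.one_closed[OF subgroup_axioms])
qed

lemma (in normal) quotient_image_product:
  assumes "A \<subseteq> carrier G" "B \<subseteq> carrier G" "carrier G \<subseteq> A <#> B"
  shows "(\<lambda>x. H #> x) ` A <#>\<^bsub>G Mod H\<^esub> (\<lambda>x. H #> x) ` B = carrier (G Mod H)"
proof -
  have "(\<lambda>x. H #> x) ` A <#>\<^bsub>G Mod H\<^esub> (\<lambda>x. H #> x) ` B = (\<lambda>x. H #> x) ` (A <#> B)"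
    by (rule set_mult_hom[OF r_coset_hom_Mod assms(1,2), symmetric])
  also have "A <#> B = carrier G" using assms(3) setmult_subset_G[OF assms(1,2)] by blast
  finally show ?thesis by (simp add: carrier_FactGroup)
qed

lemma (in normal) conjugate_subset_of_quotient:
  assumes "g \<in> carrier G" "A \<subseteq> carrier G" "subgroup B G" "H \<subseteq> B"
    and "conjugate (G Mod H) (H #> g) ((\<lambda>x. H #> x) ` A) \<subseteq> (\<lambda>x. H #> x) ` B"
  shows "conjugate G g A \<subseteq> B"
proof
  fix x assume x: "x \<in> conjugate G g A"
  have "(\<lambda>x. H #> x) ` conjugate G g A \<subseteq> (\<lambda>x. H #> x) ` B"
    using group_hom.image_conjugate[OF quotient_hom assms(2,1)] assms(5) by simp
  then have "H #> x \<in> (\<lambda>x. H #> x) ` B" using x by blast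
  then show "x \<in> B"
    using quotient_image_mem_iff[OF assms(3,4)] x conjugate_subset_carrier[OF assms(2,1)] by blast
qed

section \<open>Orders of finite subgroups\<close>

lemma card_eq_card_image_mult:
  assumes "finite A" "\<And>y. y \<in> f ` A \<Longrightarrow> card {x \<in> A. f x = y} = s"
  shows "card A = card (f ` A) * s"
proof -
  have "card A = (\<Sum>y\<in>f ` A. card {x \<in> A. f x = y})"
    using sum.image_gen[OF assms(1), of "\<lambda>_. 1::nat" f] by simp
  also have "\<dots> = (\<Sum>y\<in>f ` A. s)"
    using assms(2) by (intro sum.cong) auto
  finally show ?thesis by simp
qed

lemma (in group) subgroup_mult_bij:
  assumes "subgroup A G" "a \<in> A" "B \<subseteq> A"
  shows "card ((\<lambda>x. a \<otimes> x) ` B) = card B"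
  using inj_on_cmult[OF subgroup.mem_carrier[OF assms(1,2)]] assms subgroup.subset[OF assms(1)]
  by (intro card_image) (blast intro: inj_on_subset)

text \<open>The fibres of \<open>h\<close> on \<open>A\<close> are the cosets of \<open>A \<inter> kernel G H h\<close>.\<close>

lemma (in group_hom) card_subgroup_image:
  assumes "subgroup A G" "finite A"
  shows "card A = card (h ` A) * card (A \<inter> kernel G H h)"
proof (rule card_eq_card_image_mult[OF assms(2)])
  fix y assume "y \<in> h ` A"
  then obtain a where a: "a \<in> A" "y = h a" by auto
  note mem = subgroup.mem_carrier[OF assms(1)]
  have "{x \<in> A. h x = y} = (\<lambda>x. a \<otimes> x) ` (A \<inter> kernel G H h)"
  proof (intro equalityI subsetI)
    fix x assume x: "x \<in> {x \<in> A. h x = y}"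
    have "inv a \<otimes> x \<in> A \<inter> kernel G H h"
      using x a assms(1) mem by (auto simp: kernel_def subgroup.m_closed subgroup.m_inv_closed)
    moreover have "x = a \<otimes> (inv a \<otimes> x)"
      using x a mem by (simp add: G.m_assoc[symmetric])
    ultimately show "x \<in> (\<lambda>x. a \<otimes> x) ` (A \<inter> kernel G H h)" by blast
  next
    fix x assume "x \<in> (\<lambda>x. a \<otimes> x) ` (A \<inter> kernel G H h)"
    then show "x \<in> {x \<in> A. h x = y}"
      using a assms(1) mem by (auto simp: kernel_def subgroup.m_closed)
  qed
  then show "card {x \<in> A. h x = y} = card (A \<inter> kernel G H h)"
    using G.subgroup_mult_bij[OF assms(1) a(1)] by simp
qed

lemma (in group) card_subgroup_dvd:
  assumes "subgroup A G" "subgroup B G" "A \<subseteq> B"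
  shows "card A dvd card B"
proof -
  interpret B: group "G\<lparr>carrier := B\<rparr>" by (rule subgroup_imp_group[OF assms(2)])
  have "subgroup A (G\<lparr>carrier := B\<rparr>)"
    by (rule subgroup_incl[OF assms])
  from B.lagrange[OF this] have "card (rcosets\<^bsub>G\<lparr>carrier := B\<rparr>\<^esub> A) * card A = card B"
    by (simp add: order_def)
  then show ?thesis by (rule dvdI[OF trans[OF sym mult.commute]])
qed

lemma (in group) finite_subgroup: "finite (carrier G) \<Longrightarrow> subgroup A G \<Longrightarrow> finite A"
  by (rule finite_subset[OF subgroup.subset])

lemma (in group) card_subgroup_pos: "finite (carrier G) \<Longrightarrow> subgroup A G \<Longrightarrow> card A > 0"
  using finite_subgroup[of A] subgroup.one_closed[of A G] by (auto simp: card_gt_0_iff)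

lemma (in group) subgroup_pow_card:
  assumes "subgroup A G" "x \<in> A"
  shows "x [^] card A = \<one>"
proof -
  interpret A: group "G\<lparr>carrier := A\<rparr>" by (rule subgroup_imp_group[OF assms(1)])
  show ?thesis using A.pow_order_eq_1[of x] assms(2) by (simp add: order_def nat_pow_def)
qed

lemma (in group) card_normal_set_mult:
  assumes "A \<lhd> G" "subgroup B G" "finite (carrier G)"
  shows "card (A <#> B) * card (A \<inter> B) = card A * card B"
proof -
  interpret A: normal A G by (rule assms)
  interpret q: group_hom G "G Mod A" "\<lambda>x. A #> x" by (rule A.quotient_hom)
  have AB: "subgroup (A <#> B) G" by (rule mult_norm_subgroup[OF assms(1,2)])
  note sub = subgroup.subset[OF AB] subgroup.subset[OF assms(2)]
  have f: "finite (A <#> B)" "finite B"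
    using sub assms(3) finite_subset by blast+
  have im: "(\<lambda>x. A #> x) ` (A <#> B) = (\<lambda>x. A #> x) ` B"
    by (rule A.quotient_image_set_mult[OF sub(2)])
  have "(A <#> B) \<inter> A = A"
    using subgroup_subset_set_mult(1)[OF A.subgroup_axioms assms(2)] by blast
  then have "card (A <#> B) = card ((\<lambda>x. A #> x) ` B) * card A"
    using q.card_subgroup_image[OF AB f(1)] im by (simp add: A.quotient_kernel)
  moreover have "card B = card ((\<lambda>x. A #> x) ` B) * card (A \<inter> B)"
    using q.card_subgroup_image[OF assms(2) f(2)] by (simp add: A.quotient_kernel Int_commute)
  ultimately show ?thesis by simp
qed

section \<open>Sylow subgroups of finite groups\<close>

text \<open>\<open>P\<close> acts by right multiplication on the right cosets of \<open>R\<close>. The length of an orbit divides the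
  power \<open>card P\<close> of \<open>p\<close>, and it is not \<open>1\<close> on a coset that moves.\<close>

lemma (in group) prime_dvd_card_moved_cosets:
  assumes "finite (carrier G)" "subgroup P G" "subgroup R G" "prime p" "card P = p ^ k"
  shows "p dvd card {C \<in> rcosets R. \<exists>g\<in>P. C #> g \<noteq> C}" (is "_ dvd card ?E")
proof -
  define r where "r = {(C, D). C \<in> ?E \<and> (\<exists>g\<in>P. D = C #> g)}"
  note Pc = subgroup.mem_carrier[OF assms(2)]
  have sub: "C \<subseteq> carrier G" if "C \<in> rcosets R" for C
    using that rcosets_part_G[OF assms(3)] by blast
  have act: "C #> g #> h = C #> (g \<otimes> h)" if "C \<in> rcosets R" "g \<in> P" "h \<in> P" for C g h
    using coset_mult_assoc[OF sub[OF that(1)]] that Pc by simp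
  have one: "C #> \<one> = C" if "C \<in> rcosets R" for C
    using sub[OF that] by simp
  have closed: "C #> g \<in> rcosets R" if "C \<in> rcosets R" "g \<in> P" for C g
  proof -
    from that(1) obtain x where x: "x \<in> carrier G" "C = R #> x" by (auto simp: RCOSETS_def)
    have "C #> g = R #> (x \<otimes> g)"
      using x that(2) Pc subgroup.subset[OF assms(3)] by (simp add: coset_mult_assoc)
    then show ?thesis using x that(2) Pc by (auto simp: RCOSETS_def)
  qed
  have undo: "C #> g #> inv g = C" if "C \<in> rcosets R" "g \<in> P" for C g
    using act[OF that(1,2) subgroup.m_inv_closed[OF assms(2) that(2)]] one[OF that(1)] Pc[OF that(2)]
    by simp
  have closedE: "C #> g \<in> ?E" if "C \<in> ?E" "g \<in> P" for C g
  proof -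
    from that(1) obtain h where h: "h \<in> P" "C #> h \<noteq> C" by auto
    have C: "C \<in> rcosets R" using that by auto
    have D: "C #> g \<in> rcosets R" using closed[OF C that(2)] .
    have "\<exists>h\<in>P. C #> g #> h \<noteq> C #> g"
    proof (rule ccontr)
      assume "\<not> ?thesis"
      then have all: "\<And>h. h \<in> P \<Longrightarrow> C #> g #> h = C #> g" by auto
      have ig: "inv g \<in> P" using that assms(2) subgroup.m_inv_closed by metis
      have "C #> g = C" using all[OF ig] undo[OF C that(2)] by simp
      with all[OF h(1)] h(2) show False by simp
    qed
    with D show ?thesis by auto
  qed
  have fin: "finite ?E"
    using rcosets_subset_PowG[OF assms(3)] assms(1) by (auto intro: finite_subset)
  have eq: "equiv ?E r"
  proof (rule equivI)
    show "r \<subseteq> ?E \<times> ?E" unfolding r_def using closedE by blast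
    show "refl_on ?E r"
      unfolding r_def refl_on_def using one subgroup.one_closed[OF assms(2)] by force
    show "sym r"
    proof (rule symI)
      fix C D assume "(C, D) \<in> r"
      then obtain g where g: "C \<in> ?E" "g \<in> P" "D = C #> g" unfolding r_def by auto
      have "C = D #> inv g" using undo g by auto
      moreover have "D \<in> ?E" using closedE[OF g(1,2)] g(3) by simp
      ultimately show "(D, C) \<in> r"
        unfolding r_def using subgroup.m_inv_closed[OF assms(2) g(2)] by blast
    qed
    show "trans r"
    proof (rule transI)
      fix C D F assume "(C, D) \<in> r" "(D, F) \<in> r"
      then obtain g h where g: "C \<in> ?E" "g \<in> P" "D = C #> g" "h \<in> P" "F = D #> h"
        unfolding r_def by auto
      then have "F = C #> (g \<otimes> h)" using act by auto
      then show "(C, F) \<in> r" unfolding r_def using g subgroup.m_closed[OF assms(2)] by blast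
    qed
  qed
  show ?thesis
  proof (rule equiv_imp_dvd_card[OF fin eq])
    fix X assume "X \<in> ?E // r"
    then obtain C where C: "C \<in> ?E" "X = r `` {C}" by (auto simp: quotient_def)
    have X: "X = (\<lambda>g. C #> g) ` P" using C by (auto simp: r_def)
    have CR: "C \<in> rcosets R" using C by auto
    define S where "S = {g \<in> P. C #> g = C}"
    have "card P = card X * card S"
      unfolding X
    proof (rule card_eq_card_image_mult)
      show "finite P" using assms(1,2) finite_subset subgroup.subset by metis
      fix y assume "y \<in> (\<lambda>g. C #> g) ` P"
      then obtain g where g: "g \<in> P" "y = C #> g" by auto
      have "{x \<in> P. C #> x = y} = (\<lambda>s. s \<otimes> g) ` S"
      proof (intro equalityI subsetI)
        fix x assume x: "x \<in> {x \<in> P. C #> x = y}"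
        have ig: "inv g \<in> P" using g assms(2) subgroup.m_inv_closed by metis
        have "C #> (x \<otimes> inv g) = C #> x #> inv g" using act[OF CR _ ig, of x] x by simp
        also have "\<dots> = C" using x g undo[OF CR g(1)] by simp
        finally have "x \<otimes> inv g \<in> S"
          unfolding S_def using x ig subgroup.m_closed[OF assms(2)] by simp
        moreover have "x = (x \<otimes> inv g) \<otimes> g" using x g Pc by (simp add: m_assoc)
        ultimately show "x \<in> (\<lambda>s. s \<otimes> g) ` S" by blast
      next
        fix x assume "x \<in> (\<lambda>s. s \<otimes> g) ` S"
        then obtain s where s: "s \<in> P" "C #> s = C" "x = s \<otimes> g" unfolding S_def by auto
        then show "x \<in> {x \<in> P. C #> x = y}"
          using act[OF CR s(1) g(1)] g subgroup.m_closed[OF assms(2)] by simp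
      qed
      moreover have "inj_on (\<lambda>s. s \<otimes> g) S"
        by (rule inj_onI) (use g Pc in \<open>auto simp: S_def\<close>)
      ultimately show "card {x \<in> P. C #> x = y} = card S"
        by (simp add: card_image)
    qed
    then have "card X dvd p ^ k" unfolding assms(5)[symmetric] by simp
    then obtain j where j: "card X = p ^ j" using divides_primepow_nat[OF assms(4)] by blast
    have "card X \<noteq> 1"
    proof
      assume "card X = 1"
      then obtain D where D: "X = {D}" by (auto simp: card_1_singleton_iff)
      then have "\<And>g. g \<in> P \<Longrightarrow> C #> g = D" using X by auto
      moreover have "D = C"
        using calculation subgroup.one_closed[OF assms(2)] one[OF CR] by metis
      ultimately show False using C(1) by auto
    qed
    then have "j \<noteq> 0" using j by auto
    then show "p dvd card X" using j by simp
  qed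
qed

lemma (in group) rcoset_fixed_imp_conj:
  assumes "subgroup R G" "x \<in> carrier G" "g \<in> carrier G" "R #> x #> g = R #> x"
  shows "x \<otimes> g \<otimes> inv x \<in> R"
proof -
  have "x \<otimes> g \<in> R #> (x \<otimes> g)" using assms rcos_self by simp
  also have "\<dots> = R #> x" using assms subgroup.subset by (metis coset_mult_assoc)
  finally obtain h where h: "h \<in> R" "x \<otimes> g = h \<otimes> x" by (auto simp: r_coset_def)
  then have "x \<otimes> g \<otimes> inv x = h" using assms by (metis inv_solve_right m_closed subgroup.mem_carrier)
  then show ?thesis using h by simp
qed

text \<open>The number of cosets of a Sylow subgroup is prime to \<open>p\<close>, so \<open>P\<close> fixes one of them. Fixing the
  coset of \<open>x\<close> means lying in the conjugate of the Sylow subgroup by \<open>inv x\<close>.\<close>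

lemma (in group) sylow_containing:
  assumes "finite (carrier G)" "subgroup P G" "prime p" "card P = p ^ k"
  obtains R a m where "subgroup R G" "P \<subseteq> R" "card R = p ^ a" "order G = p ^ a * m" "\<not> p dvd m"
proof -
  have "order G > 0" using assms(1) order_gt_0_iff_finite by simp
  then have "order G \<noteq> 0" "\<not> is_unit p" using not_prime_unit assms(3) by auto
  then obtain a m where am: "order G = p ^ a * m" "\<not> p dvd m"
    using multiplicity_decompose' by blast
  obtain R where R: "subgroup R G" "card R = p ^ a"
    using sylow_thm[OF assms(3) is_group am(1) assms(1)] by blast
  have "card (rcosets R) * p ^ a = p ^ a * m"
    using lagrange[OF R(1)] R(2) am by simp
  then have m: "card (rcosets R) = m" using assms(3) prime_gt_0_nat by auto
  have "\<exists>C\<in>rcosets R. \<forall>g\<in>P. C #> g = C"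
  proof (rule ccontr)
    assume "\<not> ?thesis"
    then have "{C \<in> rcosets R. \<exists>g\<in>P. C #> g \<noteq> C} = rcosets R" by auto
    then show False
      using prime_dvd_card_moved_cosets[OF assms(1,2) R(1) assms(3,4)] m am(2) by simp
  qed
  then obtain C where C: "C \<in> rcosets R" "\<And>g. g \<in> P \<Longrightarrow> C #> g = C" by blast
  from C(1) obtain x where "x \<in> carrier G" "C = R #> x" unfolding RCOSETS_def by blast
  with C(2) have x: "x \<in> carrier G" "\<And>g. g \<in> P \<Longrightarrow> R #> x #> g = R #> x" by blast+
  have "P \<subseteq> conjugate G (inv x) R"
  proof
    fix g assume g: "g \<in> P"
    have gc: "g \<in> carrier G" using g assms(2) subgroup.mem_carrier by metis
    have "x \<otimes> g \<otimes> inv x \<in> R" using rcoset_fixed_imp_conj[OF R(1) x(1) gc x(2)[OF g]] .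
    moreover have "g = inv x \<otimes> (x \<otimes> g \<otimes> inv x) \<otimes> inv (inv x)"
      using x gc by (simp add: m_assoc inv_mult_cancel)
    ultimately show "g \<in> conjugate G (inv x) R" unfolding conjugate_def by blast
  qed
  moreover have "subgroup (conjugate G (inv x) R) G"
    by (rule conjugate_subgroup[OF R(1) inv_closed[OF x(1)]])
  moreover have "card (conjugate G (inv x) R) = p ^ a"
    using conjugate_card[OF subgroup.subset[OF R(1)] inv_closed[OF x(1)]] R(2) by simp
  ultimately show ?thesis by (intro that[of "conjugate G (inv x) R" a m] am)
qed

lemma (in group) sylow_exists:
  assumes "finite (carrier G)" "prime p"
  obtains R a m where "subgroup R G" "card R = p ^ a" "card (carrier G) = p ^ a * m" "\<not> p dvd m"
proof -
  have "card {\<one>} = p ^ 0" by simp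
  from sylow_containing[OF assms(1) triv_subgroup assms(2) this] obtain R a m
    where R: "subgroup R G" "card R = p ^ a" "order G = p ^ a * m" "\<not> p dvd m" .
  show ?thesis by (rule that[OF R(1,2) R(3)[unfolded order_def] R(4)])
qed

text \<open>No prime divides the index of \<open>K\<close>.\<close>

lemma (in group) subgroup_eq_carrier_of_sylow:
  assumes fin: "finite (carrier G)" and K: "subgroup K G"
    and syl: "\<And>p. prime p \<Longrightarrow> \<exists>P m. subgroup P G \<and> P \<subseteq> K \<and> card (carrier G) = card P * m \<and> \<not> p dvd m"
  shows "K = carrier G"
proof -
  obtain t where t: "card (carrier G) = card K * t"
    using card_subgroup_dvd[OF K subgroup_self subgroup.subset[OF K]] by (auto simp: dvd_def)
  have "t = 1"
  proof (rule ccontr)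
    assume "t \<noteq> 1"
    then obtain p where p: "prime p" "p dvd t" using prime_factor_nat by blast
    from syl[OF p(1)] obtain P m where P: "subgroup P G" "P \<subseteq> K" "card (carrier G) = card P * m" "\<not> p dvd m"
      by blast
    obtain u where u: "card K = card P * u"
      using card_subgroup_dvd[OF P(1) K P(2)] by (auto simp: dvd_def)
    have "u * t = m" using t P(3) u card_subgroup_pos[OF fin P(1)] by (simp add: mult.assoc)
    then show False using p P(4) by auto
  qed
  then show ?thesis using t card_subset_eq[OF fin subgroup.subset[OF K]] by simp
qed

lemma (in group) prime_order_comm:
  assumes "prime (order G)"
  shows "comm_group G"
proof -
  have fin: "finite (carrier G)"
    using prime_gt_0_nat[OF assms] order_gt_0_iff_finite by simp
  have "carrier G \<noteq> {\<one>}" using assms by (auto simp: order_def)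
  then obtain x where x: "x \<in> carrier G" "x \<noteq> \<one>" by auto
  have sg: "subgroup (generate G {x}) G" using x generate_is_subgroup by simp
  have xg: "x \<in> generate G {x}" "\<one> \<in> generate G {x}" by (auto intro: generate.intros)
  have "card (generate G {x}) \<noteq> 1"
    using xg x by (auto simp: card_1_singleton_iff)
  moreover have "card (generate G {x}) dvd order G"
    using card_subgroup_dvd[OF sg subgroup_self] subgroup.subset[OF sg] by (simp add: order_def)
  ultimately have "card (generate G {x}) = card (carrier G)"
    using assms by (auto simp: prime_nat_iff order_def)
  then have gen: "generate G {x} = carrier G"
    using fin subgroup.subset[OF sg] by (simp add: card_subset_eq)
  show ?thesis
  proof (rule group_comm_groupI)
    fix y z assume "y \<in> carrier G" "z \<in> carrier G"
    then have "y \<in> generate G {x}" "z \<in> generate G {x}" using gen by simp_all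
    then obtain i j :: int where "y = x [^] i" "z = x [^] j"
      unfolding generate_pow[OF x(1)] by blast
    then show "y \<otimes> z = z \<otimes> y" using x by (simp add: int_pow_mult[symmetric] add.commute)
  qed
qed

text \<open>Let \<open>M\<close> be a subgroup of index \<open>p\<close>. The number of its cosets moved by \<open>M\<close> is a multiple of \<open>p\<close>, and
  it is less than \<open>p\<close> because \<open>M\<close> itself is fixed. So no coset is moved, \<open>M\<close> is normal, and the
  quotient of order \<open>p\<close> is abelian.\<close>

lemma (in group) p_group_not_perfect:
  assumes "finite (carrier G)" "prime p" "order G = p ^ n" "order G \<noteq> 1"
  shows "derived G (carrier G) \<noteq> carrier G"
proof -
  have n: "n \<noteq> 0" using assms by auto
  then have "order G = p ^ (n - 1) * p" using assms(3) by (metis power_minus_mult neq0_conv)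
  from sylow_thm[OF assms(2) is_group this assms(1)]
  obtain M where M: "subgroup M G" "card M = p ^ (n - 1)" by blast
  have p0: "p > 0" using assms(2) prime_gt_0_nat by blast
  have cM: "card (rcosets M) = p"
    using lagrange[OF M(1)] M(2) \<open>order G = p ^ (n - 1) * p\<close> p0 by auto
  let ?E = "{C \<in> rcosets M. \<exists>g\<in>M. C #> g \<noteq> C}"
  have dvd: "p dvd card ?E"
    by (rule prime_dvd_card_moved_cosets[OF assms(1) M(1) M(1) assms(2) M(2)])
  have fin: "finite (rcosets M)" using cM p0 card_gt_0_iff by fastforce
  have "M \<in> rcosets M" using subgroup.subgroup_in_rcosets[OF M(1) is_group] .
  moreover have "M \<notin> ?E"
    using M(1) by (auto simp: coset_join2 subgroup.mem_carrier)
  ultimately have "?E \<noteq> rcosets M" by metis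
  then have "?E \<subset> rcosets M" by (intro psubsetI Collect_restrict)
  then have "card ?E < p" using psubset_card_mono[OF fin] cM by simp
  then have "card ?E = 0" using dvd nat_dvd_not_less by blast
  then have E: "?E = {}" using fin by simp
  have all: "M #> x #> g = M #> x" if "x \<in> carrier G" "g \<in> M" for x g
  proof -
    have "M #> x \<notin> ?E" using E by blast
    then show ?thesis using rcosetsI[OF subgroup.subset[OF M(1)] that(1)] that(2) by blast
  qed
  have nM: "M \<lhd> G"
    using rcoset_fixed_imp_conj[OF M(1)] all subgroup.mem_carrier[OF M(1)]
    by (intro normal_invI[OF M(1)]) blast
  interpret M: normal M G by (rule nM)
  interpret Q: group "G Mod M" by (rule M.factorgroup_is_group)
  have "order (G Mod M) = p" using cM by (simp add: order_def FactGroup_def)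
  then have "comm_group (G Mod M)" using Q.prime_order_comm assms(2) by simp
  then have "derived G (carrier G) \<subseteq> M" using derived_minimal[OF nM] by blast
  moreover have "M \<noteq> carrier G"
    using M(2) \<open>order G = p ^ (n - 1) * p\<close> assms(2) p0 prime_gt_1_nat[OF assms(2)] by (auto simp: order_def)
  ultimately show ?thesis using M.subset by auto
qed

lemma dvd_prime_power_coprime_eq_1:
  fixes t :: nat
  assumes "prime q" "t dvd q ^ a" "t dvd m" "\<not> q dvd m"
  shows "t = 1"
proof -
  obtain i where i: "t = q ^ i" using divides_primepow_nat[OF assms(1)] assms(2) by blast
  have "i = 0"
  proof (rule ccontr)
    assume "i \<noteq> 0"
    then have "q dvd t" using i by simp
    then show False using assms(3,4) dvd_trans by blast
  qed
  then show ?thesis using i by simp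
qed

text \<open>The image of \<open>Q\<close> in \<open>G Mod R\<close> is a \<open>q\<close>-group in a group of order prime to \<open>q\<close>.\<close>

lemma (in group) p_subgroup_subset_normal:
  assumes fin: "finite (carrier G)" and R: "R \<lhd> G" and q: "prime q"
    and cR: "card (carrier G) = card R * m" "\<not> q dvd m"
    and Q: "subgroup Q G" "card Q = q ^ c"
  shows "Q \<subseteq> R"
proof
  fix x assume x: "x \<in> Q"
  interpret R: normal R G by (rule R)
  interpret q: group_hom G "G Mod R" "\<lambda>x. R #> x" by (rule R.quotient_hom)
  let ?f = "\<lambda>x. R #> x"
  have Rpos: "card R > 0" by (rule card_subgroup_pos[OF fin R.subgroup_axioms])
  have "card (rcosets R) * card R = card R * m"
    using lagrange[OF R.subgroup_axioms] cR by (simp add: order_def)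
  then have om: "card (carrier (G Mod R)) = m" using Rpos by (simp add: FactGroup_def)
  have sub: "subgroup (?f ` Q) (G Mod R)" by (rule q.subgroup_img_is_subgroup[OF Q(1)])
  have "card (?f ` Q) dvd m"
    using q.H.card_subgroup_dvd[OF sub q.H.subgroup_self subgroup.subset[OF sub]] om by simp
  moreover have "card (?f ` Q) dvd q ^ c"
    using q.card_subgroup_image[OF Q(1) finite_subgroup[OF fin Q(1)]] Q(2) by (metis dvd_triv_left)
  ultimately have "card (?f ` Q) = 1"
    using dvd_prime_power_coprime_eq_1[OF q] cR(2) by blast
  then obtain u where u: "?f ` Q = {u}" by (rule card_1_singletonE)
  have "?f x = u" using u x by blast
  moreover have "?f \<one> = u" using u subgroup.one_closed[OF Q(1)] by blast
  ultimately have "?f x = R" using q.hom_one by simp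
  then show "x \<in> R"
    using rcos_self[OF subgroup.mem_carrier[OF Q(1) x] R.subgroup_axioms] by simp
qed

text \<open>The index of \<open>Q\<close> in \<open>S \<inter> R\<close> divides that of \<open>L\<close> in \<open>R\<close>, a power of \<open>q\<close>, and that of \<open>Q\<close> in \<open>S\<close>, a number
  prime to \<open>q\<close>.\<close>

lemma (in group) inter_normal_eq_sylow:
  assumes fin: "finite (carrier G)" and q: "prime q"
    and L: "subgroup L G" and Q: "subgroup Q G" and R: "subgroup R G" and S: "subgroup S G"
    and sub: "L \<subseteq> Q" "Q \<subseteq> R" "Q \<subseteq> S"
    and cR: "card R = card L * q ^ a" and cS: "card S = card Q * m" "\<not> q dvd m"
  shows "S \<inter> R = Q"
proof -
  have SR: "subgroup (S \<inter> R) G" by (rule subgroups_Inter_pair[OF S R])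
  have QSR: "Q \<subseteq> S \<inter> R" using sub by blast
  obtain t where t: "card (S \<inter> R) = card Q * t"
    using card_subgroup_dvd[OF Q SR QSR] by (auto simp: dvd_def)
  obtain u where u: "card Q = card L * u"
    using card_subgroup_dvd[OF L Q sub(1)] by (auto simp: dvd_def)
  have pos: "card L > 0" "card Q > 0" by (rule card_subgroup_pos[OF fin L], rule card_subgroup_pos[OF fin Q])
  have "card L * (u * t) dvd card L * q ^ a"
    using card_subgroup_dvd[OF SR R] unfolding t cR u by (simp add: mult.assoc)
  then have "u * t dvd q ^ a" using pos by simp
  then have "t dvd q ^ a" by (rule dvd_mult_right)
  moreover have "card Q * t dvd card Q * m"
    using card_subgroup_dvd[OF SR S] unfolding t cS by simp
  then have "t dvd m" using pos by simp
  ultimately have "t = 1" by (rule dvd_prime_power_coprime_eq_1[OF q _ _ cS(2)])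
  then have "card Q = card (S \<inter> R)" using t by simp
  then show ?thesis using card_subset_eq[OF finite_subgroup[OF fin SR] QSR] by simp
qed

section \<open>Conjugacy of complements\<close>

text \<open>Every \<open>j \<in> J\<close> has the form \<open>f j \<otimes> h\<close> with \<open>f j \<in> A\<close> and \<open>h \<in> H\<close>, and \<open>f\<close> satisfies the cocycle
  identity \<open>f (j \<otimes> k) = f j \<otimes> (j \<otimes> f k \<otimes> inv j)\<close>. Multiplying over all \<open>k \<in> J\<close> gives
  \<open>b = f j [^] card J \<otimes> (j \<otimes> b \<otimes> inv j)\<close> for the product \<open>b\<close> of all values of \<open>f\<close>. As \<open>card J\<close> is invertible
  modulo \<open>card A\<close>, a power \<open>c\<close> of \<open>b\<close> satisfies \<open>c = f j \<otimes> (j \<otimes> c \<otimes> inv j)\<close>, which says that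
  \<open>inv c\<close> conjugates \<open>j\<close> to \<open>h\<close>.\<close>

lemma (in group) abelian_complement_conjugate:
  assumes fin: "finite (carrier G)" and A: "A \<lhd> G"
    and comm: "\<And>x y. x \<in> A \<Longrightarrow> y \<in> A \<Longrightarrow> x \<otimes> y = y \<otimes> x"
    and J: "subgroup J G" and H: "subgroup H G" and HA: "H \<inter> A = {\<one>}"
    and JHA: "J \<subseteq> A <#> H" and cop: "coprime (card A) (card J)"
  shows "\<exists>a\<in>A. conjugate G a J \<subseteq> H"
proof -
  interpret A: normal A G by (rule A)
  note Ac = A.mem_carrier and Hc = subgroup.mem_carrier[OF H] and Jc = subgroup.mem_carrier[OF J]
  define M where "M = G\<lparr>carrier := A\<rparr>"
  have Mgrp: "group M" unfolding M_def by (rule subgroup_imp_group[OF A.subgroup_axioms])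
  interpret M: comm_group M
    by (rule group.group_comm_groupI[OF Mgrp]) (auto simp: M_def comm)
  have M_simps: "carrier M = A" "\<And>x y. x \<otimes>\<^bsub>M\<^esub> y = x \<otimes> y" "\<And>x (n::nat). x [^]\<^bsub>M\<^esub> n = x [^] n"
    by (auto simp: M_def nat_pow_def)
  have "\<forall>j\<in>J. \<exists>a. a \<in> A \<and> inv a \<otimes> j \<in> H"
  proof
    fix j assume "j \<in> J"
    then have "j \<in> A <#> H" using JHA by blast
    then obtain a h where "a \<in> A" "h \<in> H" "j = a \<otimes> h" by (rule set_multE)
    moreover have "inv a \<otimes> (a \<otimes> h) = h" using calculation Ac Hc by (simp add: inv_mult_cancel)
    ultimately show "\<exists>a. a \<in> A \<and> inv a \<otimes> j \<in> H" by auto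
  qed
  then obtain f where f: "\<And>j. j \<in> J \<Longrightarrow> f j \<in> A" "\<And>j. j \<in> J \<Longrightarrow> inv (f j) \<otimes> j \<in> H"
    by metis
  have fc: "f j \<in> carrier G" if "j \<in> J" for j using f(1)[OF that] Ac by simp
  define \<phi> where "\<phi> j a = j \<otimes> a \<otimes> inv j" for j a
  have \<phi>A: "\<phi> j a \<in> A" if "j \<in> J" "a \<in> A" for j a
    unfolding \<phi>_def using A.inv_op_closed2 that Jc by simp
  have uniq: "a = b" if "a \<in> A" "b \<in> A" "x \<in> carrier G" "inv a \<otimes> x \<in> H" "inv b \<otimes> x \<in> H" for a b x
  proof -
    have "inv a \<otimes> x \<otimes> inv (inv b \<otimes> x) \<in> H"
      by (intro subgroup.m_closed[OF H] subgroup.m_inv_closed[OF H] that)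
    also have "inv a \<otimes> x \<otimes> inv (inv b \<otimes> x) = inv a \<otimes> b"
      using that Ac by (simp add: inv_mult_group m_assoc inv_mult_cancel)
    finally have "inv a \<otimes> b \<in> H \<inter> A" using that by auto
    then have "inv a \<otimes> b = \<one>" using HA by blast
    then have "a \<otimes> (inv a \<otimes> b) = a" using that Ac by simp
    then show "a = b" using that Ac by (simp add: inv_mult_cancel)
  qed
  have cocycle: "f (j \<otimes> k) = f j \<otimes> \<phi> j (f k)" if jk: "j \<in> J" "k \<in> J" for j k
  proof (rule uniq[of _ _ "j \<otimes> k"])
    have jk': "j \<otimes> k \<in> J" by (intro subgroup.m_closed[OF J] jk)
    show "f (j \<otimes> k) \<in> A" "inv (f (j \<otimes> k)) \<otimes> (j \<otimes> k) \<in> H" using f jk' by auto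
    show "f j \<otimes> \<phi> j (f k) \<in> A" using f jk \<phi>A by simp
    show "j \<otimes> k \<in> carrier G" using jk Jc by simp
    have "inv (f j \<otimes> \<phi> j (f k)) \<otimes> (j \<otimes> k) = inv (\<phi> j (f k) \<otimes> f j) \<otimes> (j \<otimes> k)"
      using comm f jk \<phi>A by simp
    also have "\<dots> = (inv (f j) \<otimes> j) \<otimes> (inv (f k) \<otimes> k)"
      using jk Jc fc by (simp add: \<phi>_def inv_mult_group m_assoc inv_mult_cancel)
    also have "\<dots> \<in> H" by (intro subgroup.m_closed[OF H] f(2) jk)
    finally show "inv (f j \<otimes> \<phi> j (f k)) \<otimes> (j \<otimes> k) \<in> H" .
  qed
  have Jfin: "finite J" by (rule finite_subset[OF subgroup.subset[OF J] fin])
  define b where "b = finprod M f J"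
  have bA: "b \<in> A"
    unfolding b_def using M.finprod_closed[of f J] f by (auto simp: M_simps)
  have \<phi>_mult: "\<phi> j (x \<otimes> y) = \<phi> j x \<otimes> \<phi> j y" if "j \<in> J" "x \<in> A" "y \<in> A" for j x y
    unfolding \<phi>_def using that Jc Ac by (simp add: m_assoc inv_mult_cancel)
  have \<phi>_one: "\<phi> j \<one> = \<one>" if "j \<in> J" for j
    unfolding \<phi>_def using that Jc by simp
  have \<phi>_pow: "\<phi> j (x [^] n) = (\<phi> j x) [^] n" if "j \<in> J" "x \<in> A" for j x and n :: nat
  proof (induction n)
    case (Suc n)
    have "x [^] n \<in> A" using M.nat_pow_closed[of x n] that by (simp add: M_simps)
    then show ?case using Suc \<phi>_mult[OF that(1) _ that(2)] by simp
  qed (simp add: \<phi>_one that)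
  have \<phi>_prod: "finprod M (\<lambda>k. \<phi> j (f k)) K = \<phi> j (finprod M f K)"
    if "j \<in> J" "finite K" "K \<subseteq> J" for j K
    using that(2,3)
  proof (induction K rule: finite_induct)
    case empty
    have "finprod M g {} = \<one>" for g :: "'a \<Rightarrow> 'a" unfolding M.finprod_empty by (simp add: M_def)
    then show ?case using \<phi>_one[OF that(1)] by simp
  next
    case (insert k K)
    have cl: "f \<in> K \<rightarrow> carrier M" "(\<lambda>k. \<phi> j (f k)) \<in> K \<rightarrow> carrier M"
      "f k \<in> carrier M" "\<phi> j (f k) \<in> carrier M"
      using insert f \<phi>A that(1) by (auto simp: M_simps)
    have "finprod M f K \<in> A" using M.finprod_closed[OF cl(1)] by (simp add: M_simps)
    then show ?case
      using insert cl \<phi>_mult[OF that(1)] f(1) by (simp add: M_simps)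
  qed
  have key: "b = f j [^] card J \<otimes> \<phi> j b" if j: "j \<in> J" for j
  proof -
    have inj: "inj_on (\<lambda>k. j \<otimes> k) J"
      using inj_on_cmult[OF Jc[OF j]] subgroup.subset[OF J] inj_on_subset by blast
    have im: "(\<lambda>k. j \<otimes> k) ` J = J"
    proof (rule card_subset_eq[OF Jfin])
      show "(\<lambda>k. j \<otimes> k) ` J \<subseteq> J" by (intro image_subsetI subgroup.m_closed[OF J j])
      show "card ((\<lambda>k. j \<otimes> k) ` J) = card J" using inj by (rule card_image)
    qed
    have "f \<in> (\<lambda>k. j \<otimes> k) ` J \<rightarrow> carrier M" unfolding im M_simps using f(1) by blast
    from M.finprod_reindex[OF this inj] have "b = finprod M (\<lambda>k. f (j \<otimes> k)) J"
      unfolding b_def im .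
    also have "\<dots> = finprod M (\<lambda>k. f j \<otimes>\<^bsub>M\<^esub> \<phi> j (f k)) J"
      using cocycle[OF j] f \<phi>A j by (intro M.finprod_cong') (auto simp: M_simps)
    also have "\<dots> = finprod M (\<lambda>k. f j) J \<otimes>\<^bsub>M\<^esub> finprod M (\<lambda>k. \<phi> j (f k)) J"
      using f \<phi>A j by (intro M.finprod_multf) (auto simp: M_simps)
    also have "finprod M (\<lambda>k. f j) J = f j [^]\<^bsub>M\<^esub> card J"
      using f(1)[OF j] by (intro M.finprod_const) (simp add: M_simps)
    also have "finprod M (\<lambda>k. \<phi> j (f k)) J = \<phi> j b"
      unfolding b_def by (rule \<phi>_prod[OF j Jfin]) simp
    finally show ?thesis by (simp add: M_simps)
  qed
  have "card J \<noteq> 0" using Jfin subgroup.one_closed[OF J] by auto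
  from bezout_nat[OF this, of "card A"] obtain m y where m: "card J * m = card A * y + 1"
    using cop by (auto simp: coprime_iff_gcd_eq_1 gcd.commute)
  have pow1: "x [^] (card J * m) = x" if "x \<in> A" for x
  proof -
    have "x [^]\<^bsub>M\<^esub> card A = \<one>\<^bsub>M\<^esub>" using M.pow_order_eq_1[of x] that by (simp add: order_def M_simps)
    then have "x [^] card A = \<one>" by (simp add: M_simps) (simp add: M_def)
    then show ?thesis using that Ac unfolding m by (simp add: nat_pow_mult[symmetric] nat_pow_pow[symmetric])
  qed
  define c where "c = b [^] m"
  have cA: "c \<in> A" unfolding c_def using M.nat_pow_closed[of b m] bA by (simp add: M_simps)
  have "inv c \<otimes> j \<otimes> inv (inv c) \<in> H" if j: "j \<in> J" for j
  proof -
    have pA: "f j [^] card J \<in> A" using M.nat_pow_closed[of "f j" "card J"] f(1)[OF j] by (simp add: M_simps)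
    have "c = (f j [^] card J \<otimes> \<phi> j b) [^] m" unfolding c_def using key[OF j] by simp
    also have "\<dots> = (f j [^] card J) [^] m \<otimes> \<phi> j b [^] m"
      using M.nat_pow_distrib[of "f j [^] card J" "\<phi> j b" m] pA \<phi>A[OF j bA] by (simp add: M_simps)
    also have "(f j [^] card J) [^] m = f j"
      using pow1[OF f(1)[OF j]] fc[OF j] by (simp add: nat_pow_pow)
    also have "\<phi> j b [^] m = \<phi> j c" unfolding c_def using \<phi>_pow[OF j bA] by simp
    finally have c: "c = f j \<otimes> \<phi> j c" .
    have "\<phi> j c = inv (f j) \<otimes> c"
    proof -
      have "inv (f j) \<otimes> c = inv (f j) \<otimes> (f j \<otimes> \<phi> j c)" using c by simp
      then show ?thesis using fc[OF j] Ac[OF \<phi>A[OF j cA]] by (simp add: inv_mult_cancel)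
    qed
    then have eq: "\<phi> j c = c \<otimes> inv (f j)" using comm[OF cA, of "inv (f j)"] f(1)[OF j] by simp
    have "inv c \<otimes> j \<otimes> inv (inv c) = inv c \<otimes> (\<phi> j c \<otimes> j)"
      unfolding \<phi>_def using Ac[OF cA] Jc[OF j] by (simp add: m_assoc)
    also have "\<dots> = inv (f j) \<otimes> j"
      unfolding eq using Ac[OF cA] Jc[OF j] fc[OF j] by (simp add: m_assoc inv_mult_cancel)
    finally show ?thesis using f(2)[OF j] by simp
  qed
  then have "conjugate G (inv c) J \<subseteq> H" unfolding conjugate_def by auto
  moreover have "inv c \<in> A" using cA by simp
  ultimately show ?thesis by blast
qed

text \<open>The conjugacy part of the Schur-Zassenhaus theorem for a normal \<open>q\<close>-subgroup. Take \<open>D \<subseteq> Y\<close> normal in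
  \<open>G\<close> and of least order such that some conjugate of \<open>J\<close> lies in \<open>D H\<close>. If \<open>D\<close> were nontrivial, its
  derived subgroup \<open>D'\<close> would be smaller, and the abelian case in \<open>G Mod D'\<close> would
  conjugate \<open>J\<close> into \<open>D' H\<close>.\<close>

lemma (in group) coprime_complement_conjugate:
  assumes fin: "finite (carrier G)" and Y: "Y \<lhd> G" and q: "prime q" and cY: "card Y = q ^ n"
    and J: "subgroup J G" and H: "subgroup H G" and HY: "H \<inter> Y = {\<one>}"
    and JHY: "J \<subseteq> Y <#> H" and cJ: "\<not> q dvd card J"
  shows "\<exists>g\<in>carrier G. conjugate G g J \<subseteq> H"
proof -
  let ?P = "\<lambda>D. D \<lhd> G \<and> D \<subseteq> Y \<and> (\<exists>g\<in>carrier G. conjugate G g J \<subseteq> D <#> H)"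
  have Jsub: "J \<subseteq> carrier G" and Hsub: "H \<subseteq> carrier G" using subgroup.subset J H by auto
  \<comment> \<open>\<open>Y\<close> itself is a candidate for \<open>D\<close>.\<close>
  have "conjugate G \<one> J = J" unfolding conjugate_def using Jsub by (force simp: subset_iff)
  then have "?P Y" using Y JHY by (intro conjI subset_refl bexI[of _ \<one>]) simp_all
  from ex_has_least_nat[of ?P, OF this, of card] obtain D
    where D: "?P D" and min: "\<And>D'. ?P D' \<Longrightarrow> card D \<le> card D'" by blast
  then obtain g where g: "g \<in> carrier G" "conjugate G g J \<subseteq> D <#> H" by blast
  interpret D: normal D G using D by blast
  have Dfin: "finite D" using D.subset fin finite_subset by blast
  show ?thesis
  proof (cases "D = {\<one>}")
    case True
    have "{\<one>} <#> H = H" using Hsub by (force simp: set_mult_iff)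
    then show ?thesis using g True by auto
  next
    case False
    have "card D dvd q ^ n"
      using card_subgroup_dvd[OF D.subgroup_axioms normal_imp_subgroup[OF Y]] D cY by simp
    then obtain k where k: "card D = q ^ k" using divides_primepow_nat[OF q] by blast
    define D' where "D' = derived G D"
    have D': "D' \<lhd> G" unfolding D'_def by (rule derived_is_normal[OF D.normal_axioms])
    interpret D': normal D' G by (rule D')
    interpret Q: group_hom G "G Mod D'" "\<lambda>x. D' #> x" by (rule D'.quotient_hom)
    have D'D: "D' \<subseteq> D" unfolding D'_def using derived_incl[OF subset_refl D.subgroup_axioms] by simp
    have "D' \<noteq> D"
    proof -
      have gr: "group (G\<lparr>carrier := D\<rparr>)" by (rule subgroup_imp_group[OF D.subgroup_axioms])
      have "card D \<noteq> 1"
      proof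
        assume "card D = 1"
        then obtain x where "D = {x}" by (rule card_1_singletonE)
        moreover have "\<one> \<in> D" by (rule subgroup.one_closed[OF D.subgroup_axioms])
        ultimately show False using False by blast
      qed
      then have "derived (G\<lparr>carrier := D\<rparr>) D \<noteq> D"
        using group.p_group_not_perfect[OF gr _ q, of k] Dfin k by (simp add: order_def)
      then show ?thesis unfolding D'_def using derived_consistent[OF _ D.subgroup_axioms] by simp
    qed
    then have less: "card D' < card D" using D'D Dfin by (simp add: psubset_card_mono psubset_eq)
    define J1 where "J1 = conjugate G g J"
    have J1: "subgroup J1 G" unfolding J1_def by (rule conjugate_subgroup[OF J g(1)])
    note J1sub = subgroup.subset[OF J1]
    let ?f = "\<lambda>x. D' #> x"
    have ker: "kernel G (G Mod D') ?f = D'" by (rule D'.quotient_kernel)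
    have "\<exists>a\<in>?f ` D. conjugate (G Mod D') a (?f ` J1) \<subseteq> ?f ` H"
    proof (rule Q.H.abelian_complement_conjugate)
      show "finite (carrier (G Mod D'))" using fin by (simp add: carrier_FactGroup)
      show "?f ` D \<lhd> G Mod D'"
        by (rule D.surj_hom_normal_subgroup[OF D'.quotient_hom]) (simp add: carrier_FactGroup)
      show "subgroup (?f ` J1) (G Mod D')" "subgroup (?f ` H) (G Mod D')"
        by (intro Q.subgroup_img_is_subgroup J1 H)+
      show "u \<otimes>\<^bsub>G Mod D'\<^esub> v = v \<otimes>\<^bsub>G Mod D'\<^esub> u" if uv: "u \<in> ?f ` D" "v \<in> ?f ` D" for u v
      proof -
        obtain x y where x: "x \<in> D" "u = ?f x" and y: "y \<in> D" "v = ?f y" using uv by blast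
        note c = D.mem_carrier[OF x(1)] D.mem_carrier[OF y(1)]
        have "inv x \<otimes> inv y \<otimes> inv (inv x) \<otimes> inv (inv y) \<in> D'"
          unfolding D'_def derived_def using x y by (intro generate.incl) blast
        then have "inv (y \<otimes> x) \<otimes> (x \<otimes> y) \<in> D'" using c by (simp add: inv_mult_group m_assoc)
        then have "?f (y \<otimes> x) = ?f (x \<otimes> y)"
          by (rule iffD2[OF D'.quotient_eq_iff[OF m_closed[OF c(2,1)] m_closed[OF c]]])
        then show ?thesis unfolding x(2) y(2) Q.hom_mult[OF c, symmetric] Q.hom_mult[OF c(2,1), symmetric] by (rule sym)
      qed
      show "?f ` H \<inter> ?f ` D = {\<one>\<^bsub>G Mod D'\<^esub>}"
      proof
        show "{\<one>\<^bsub>G Mod D'\<^esub>} \<subseteq> ?f ` H \<inter> ?f ` D"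
          using imageI[OF subgroup.one_closed[OF H], of ?f] imageI[OF subgroup.one_closed[OF D.subgroup_axioms], of ?f]
          unfolding Q.hom_one by blast
        show "?f ` H \<inter> ?f ` D \<subseteq> {\<one>\<^bsub>G Mod D'\<^esub>}"
        proof
          fix u assume "u \<in> ?f ` H \<inter> ?f ` D"
          then obtain h where h: "h \<in> H" "u = ?f h" "?f h \<in> ?f ` D" by blast
          then have "h \<in> D"
            using D'.quotient_image_mem_iff[OF D.subgroup_axioms D'D] Hsub by blast
          then have "h = \<one>" using h HY D by blast
          then show "u \<in> {\<one>\<^bsub>G Mod D'\<^esub>}" using h Q.hom_one by simp
        qed
      qed
      show "?f ` J1 \<subseteq> ?f ` D <#>\<^bsub>G Mod D'\<^esub> ?f ` H"
      proof
        fix u assume "u \<in> ?f ` J1"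
        then obtain x where x: "x \<in> D <#> H" "u = ?f x" using g(2) unfolding J1_def by blast
        from x(1) obtain d h where "d \<in> D" "h \<in> H" "x = d \<otimes> h" by (rule set_multE)
        then have "d \<in> D" "h \<in> H" "u = ?f (d \<otimes> h)" using x(2) by simp_all
        moreover have "u = ?f d \<otimes>\<^bsub>G Mod D'\<^esub> ?f h"
          using calculation Q.hom_mult[of d h] D.mem_carrier Hsub by auto
        ultimately show "u \<in> ?f ` D <#>\<^bsub>G Mod D'\<^esub> ?f ` H"
          using set_multI[of "?f d" "?f ` D" "?f h" "?f ` H" "G Mod D'"] by (simp only: imageI)
      qed
      show "coprime (card (?f ` D)) (card (?f ` J1))"
      proof -
        have "card (?f ` D) dvd q ^ k"
          using Q.card_subgroup_image[OF D.subgroup_axioms Dfin] k by (metis dvd_triv_left)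
        then obtain i where i: "card (?f ` D) = q ^ i" using divides_primepow_nat[OF q] by blast
        have "finite J1" using J1sub fin finite_subset by blast
        then have "card (?f ` J1) dvd card J1" using Q.card_subgroup_image[OF J1] by (metis dvd_triv_left)
        also have "card J1 = card J" unfolding J1_def by (rule conjugate_card[OF Jsub g(1)])
        finally have "\<not> q dvd card (?f ` J1)" using cJ dvd_trans by blast
        then show ?thesis unfolding i using q by (simp add: prime_imp_coprime coprime_power_left_iff)
      qed
    qed
    then obtain d where d: "d \<in> D" "conjugate (G Mod D') (?f d) (?f ` J1) \<subseteq> ?f ` H" by blast
    note dc = D.mem_carrier[OF d(1)]
    have D'H: "subgroup (D' <#> H) G" by (rule mult_norm_subgroup[OF D' H])
    have "conjugate G d J1 \<subseteq> D' <#> H"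
    proof (rule D'.conjugate_subset_of_quotient[OF dc J1sub D'H])
      show "D' \<subseteq> D' <#> H"
        using subset_set_mult_left[OF D'.subset] subgroup.one_closed[OF H] by blast
      show "conjugate (G Mod D') (?f d) (?f ` J1) \<subseteq> ?f ` (D' <#> H)"
        using d(2) D'.quotient_image_set_mult[OF Hsub] by simp
    qed
    then have "conjugate G (d \<otimes> g) J \<subseteq> D' <#> H"
      unfolding J1_def using conjugate_conjugate[OF Jsub dc g(1)] by simp
    then have "?P D'" using D' D'D D dc g(1) by blast
    then show ?thesis using min less by fastforce
  qed
qed

text \<open>The orders say that \<open>L Q\<close> is the intersection of \<open>R\<close> both with \<open>L J\<close> and with \<open>H\<close>; hence \<open>L J\<close> and \<open>H\<close>
  lie in the normalizer \<open>B\<close> of \<open>L Q\<close>. In the quotient of \<open>B\<close> by \<open>L Q\<close> the image of \<open>R \<inter> B\<close> is a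
  normal \<open>q\<close>-subgroup which meets the image of \<open>H\<close> trivially, and the image of \<open>L J\<close> has order prime
  to \<open>q\<close>.\<close>

lemma (in group) conjugate_into_of_q_length_one:
  assumes fin: "finite (carrier G)" and q: "prime q"
    and L: "L \<lhd> G" and R: "R \<lhd> G" and LR: "L \<subseteq> R"
    and J: "subgroup J G" and H: "subgroup H G" and Q: "subgroup Q G"
    and LH: "L \<subseteq> H" and QJ: "Q \<subseteq> J" and QH: "Q \<subseteq> H"
    and cR: "card R = card L * q ^ a" and cG: "card (carrier G) = card R * m0" "\<not> q dvd m0"
    and cH: "card (carrier G) = card H * q ^ b"
    and cQ: "card Q = q ^ c" and cJ: "card J = card Q * m1" "\<not> q dvd m1"
    and cHQ: "card H = card (L <#> Q) * m2" "\<not> q dvd m2"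
  shows "\<exists>g\<in>carrier G. conjugate G g J \<subseteq> H"
proof -
  interpret L: normal L G by (rule L)
  interpret R: normal R G by (rule R)
  define Q' where "Q' = L <#> Q"
  define J' where "J' = L <#> J"
  have Q': "subgroup Q' G" and J': "subgroup J' G"
    unfolding Q'_def J'_def by (intro mult_norm_subgroup L Q J)+
  have LQ': "L \<subseteq> Q'"
    unfolding Q'_def by (rule subgroup_subset_set_mult(1)[OF L.subgroup_axioms Q])
  have JJ': "J \<subseteq> J'"
    unfolding J'_def by (rule subgroup_subset_set_mult(2)[OF L.subgroup_axioms J])
  have Q'J': "Q' \<subseteq> J'" unfolding Q'_def J'_def by (rule mono_set_mult[OF subset_refl QJ])
  have QR: "Q \<subseteq> R" by (rule p_subgroup_subset_normal[OF fin R q cG Q cQ])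
  have closed: "L <#> Q \<subseteq> K" if "subgroup K G" "L \<subseteq> K" "Q \<subseteq> K" for K
  proof
    fix x assume "x \<in> L <#> Q"
    then obtain l y where ly: "l \<in> L" "y \<in> Q" "x = l \<otimes> y" by (rule set_multE)
    have "l \<in> K" "y \<in> K" using ly that by blast+
    then show "x \<in> K" unfolding ly(3) by (rule subgroup.m_closed[OF that(1)])
  qed
  have Q'R: "Q' \<subseteq> R" unfolding Q'_def by (rule closed[OF R.subgroup_axioms LR QR])
  have Q'H: "Q' \<subseteq> H" unfolding Q'_def by (rule closed[OF H LH QH])
  have pos: "card L > 0" "card Q > 0" "card Q' > 0" "card R > 0" "card H > 0" "card (L \<inter> Q) > 0"
    "card (L \<inter> J) > 0"
    using card_subgroup_pos[OF fin] L.subgroup_axioms Q Q' R.subgroup_axioms H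
      subgroups_Inter_pair[OF L.subgroup_axioms Q] subgroups_Inter_pair[OF L.subgroup_axioms J] by simp_all
  \<comment> \<open>The index \<open>t\<close> of \<open>L Q\<close> in \<open>L J\<close> divides the index \<open>m1\<close> of \<open>Q\<close> in \<open>J\<close>.\<close>
  obtain t where t: "card J' = card Q' * t"
    using card_subgroup_dvd[OF Q' J' Q'J'] by (auto simp: dvd_def)
  have qt: "\<not> q dvd t"
  proof
    assume "q dvd t"
    have "L \<inter> Q \<subseteq> L \<inter> J" using QJ by blast
    then obtain s where s: "card (L \<inter> J) = card (L \<inter> Q) * s"
      using card_subgroup_dvd[OF subgroups_Inter_pair[OF L.subgroup_axioms Q] subgroups_Inter_pair[OF L.subgroup_axioms J]]
      by (auto simp: dvd_def)
    have e1: "card J' * card (L \<inter> J) = card L * card J"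
      unfolding J'_def by (rule card_normal_set_mult[OF L J fin])
    have e2: "card Q' * card (L \<inter> Q) = card L * card Q"
      unfolding Q'_def by (rule card_normal_set_mult[OF L Q fin])
    have "card Q' * card (L \<inter> Q) * (t * s) = card Q' * card (L \<inter> Q) * m1"
      using e1 unfolding t s cJ(1) by (simp add: mult_ac flip: e2)
    then have "t * s = m1" using pos by simp
    then show False using \<open>q dvd t\<close> cJ(2) by auto
  qed
  have J'R: "J' \<inter> R = Q'"
    by (rule inter_normal_eq_sylow[OF fin q L.subgroup_axioms Q' R.subgroup_axioms J' LQ' Q'R Q'J' cR t qt])
  have HR: "H \<inter> R = Q'"
    by (rule inter_normal_eq_sylow[OF fin q L.subgroup_axioms Q' R.subgroup_axioms H LQ' Q'R Q'H cR cHQ[folded Q'_def]])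
  define B where "B = normalizer G Q'"
  have Q'sub: "Q' \<subseteq> carrier G" by (rule subgroup.subset[OF Q'])
  have B: "subgroup B G" unfolding B_def by (rule normalizer_imp_subgroup[OF Q'sub])
  define GB where "GB = G\<lparr>carrier := B\<rparr>"
  have GB_simps: "carrier GB = B" "\<And>x y. x \<otimes>\<^bsub>GB\<^esub> y = x \<otimes> y" by (auto simp: GB_def)
  interpret GB: group GB unfolding GB_def by (rule subgroup_imp_group[OF B])
  have conjGB: "conjugate GB g A = conjugate G g A" if "g \<in> B" for g A
    unfolding conjugate_def GB_def using m_inv_consistent[OF B that] by simp
  have Q'B: "Q' \<lhd> GB" unfolding GB_def B_def by (rule subgroup_in_normalizer[OF Q'])
  have SB: "subgroup K GB" if K: "subgroup K G" "K \<inter> R = Q'" for K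
  proof -
    have "R \<inter> K \<lhd> G\<lparr>carrier := K\<rparr>" by (rule normal_Int_subgroup[OF K(1) R])
    then have "Q' \<lhd> G\<lparr>carrier := K\<rparr>" using K(2) by (simp add: Int_commute)
    then show ?thesis unfolding GB_def B_def by (rule normal_imp_subgroup_normalizer[OF K(1)])
  qed
  have J'B: "subgroup J' GB" and HB: "subgroup H GB" using SB J' H J'R HR by blast+
  have HsubB: "H \<subseteq> B" and J'subB: "J' \<subseteq> B" using subgroup.subset HB J'B GB_simps by blast+
  interpret q: normal Q' GB by (rule Q'B)
  let ?f = "\<lambda>x. Q' #>\<^bsub>GB\<^esub> x"
  interpret f: group_hom GB "GB Mod Q'" ?f by (rule q.quotient_hom)
  define Y where "Y = R \<inter> B"
  have Y: "Y \<lhd> GB" unfolding Y_def GB_def by (rule normal_Int_subgroup[OF B R])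
  interpret Y: normal Y GB by (rule Y)
  have Q'Y: "Q' \<subseteq> Y" unfolding Y_def using Q'R q.subset GB_simps by blast
  have finB: "finite (carrier GB)" unfolding GB_simps by (rule finite_subgroup[OF fin B])
  have fin': "finite Y" "finite J'" using finite_subset[OF Y.subset finB] finite_subgroup[OF fin J'] by auto
  have JYH: "J' \<subseteq> Y <#>\<^bsub>GB\<^esub> H"
  proof
    \<comment> \<open>The index of \<open>R H\<close> divides the coprime numbers \<open>m0\<close> and \<open>q ^ b\<close>.\<close>
    have RH: "R <#> H = carrier G"
    proof -
      have RHs: "subgroup (R <#> H) G" by (rule mult_norm_subgroup[OF R H])
      obtain s where s: "card (carrier G) = card (R <#> H) * s"
        using card_subgroup_dvd[OF RHs subgroup_self subgroup.subset[OF RHs]] by (auto simp: dvd_def)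
      obtain r1 where r1: "card (R <#> H) = card R * r1"
        using card_subgroup_dvd[OF R.subgroup_axioms RHs] subgroup_subset_set_mult(1)[OF R.subgroup_axioms H]
        by (auto simp: dvd_def)
      obtain r2 where r2: "card (R <#> H) = card H * r2"
        using card_subgroup_dvd[OF H RHs] subgroup_subset_set_mult(2)[OF R.subgroup_axioms H]
        by (auto simp: dvd_def)
      have "r1 * s = m0" using s r1 cG(1) pos by (simp add: mult.assoc)
      moreover have "r2 * s = q ^ b" using s r2 cH pos by (simp add: mult.assoc)
      ultimately have "s = 1"
        using dvd_prime_power_coprime_eq_1[OF q, of s b m0] cG(2) by (metis dvd_triv_right)
      then show ?thesis
        using s card_subset_eq[OF fin subgroup.subset[OF RHs]] by simp
    qed
    fix x assume x: "x \<in> J'"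
    have xG: "x \<in> carrier G" by (rule subgroup.mem_carrier[OF J' x])
    then have "x \<in> R <#> H" using RH by simp
    then obtain r h where rh: "r \<in> R" "h \<in> H" "x = r \<otimes> h" by (rule set_multE)
    have hc: "h \<in> carrier G" by (rule subgroup.mem_carrier[OF H rh(2)])
    have "r = x \<otimes> inv h" using rh R.mem_carrier[OF rh(1)] hc by (simp add: m_assoc)
    also have "\<dots> \<in> B" using x rh(2) J'subB HsubB
      by (intro subgroup.m_closed[OF B] subgroup.m_inv_closed[OF B]) auto
    finally have "r \<in> Y" unfolding Y_def using rh(1) by blast
    then show "x \<in> Y <#>\<^bsub>GB\<^esub> H" unfolding set_mult_iff GB_simps using rh by blast
  qed
  have "\<exists>u\<in>carrier (GB Mod Q'). conjugate (GB Mod Q') u (?f ` J') \<subseteq> ?f ` H"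
  proof -
    have finQ: "finite (carrier (GB Mod Q'))" using finB by (simp add: carrier_FactGroup)
    have Yn: "?f ` Y \<lhd> GB Mod Q'"
      by (rule Y.surj_hom_normal_subgroup[OF q.quotient_hom]) (simp add: carrier_FactGroup)
    obtain k where k: "card (?f ` Y) = q ^ k"
    proof -
      have "Y \<inter> Q' = Q'" using Q'Y by blast
      then have "card Y = card (?f ` Y) * card Q'"
        using f.card_subgroup_image[OF Y.subgroup_axioms fin'(1)] by (simp add: q.quotient_kernel)
      moreover have "subgroup Y G" unfolding Y_def by (rule subgroups_Inter_pair[OF R.subgroup_axioms B])
      then have "card Y dvd card L * q ^ a"
        using card_subgroup_dvd[OF _ R.subgroup_axioms, of Y] cR by (simp add: Y_def)
      moreover obtain u where "card Q' = card L * u"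
        using card_subgroup_dvd[OF L.subgroup_axioms Q' LQ'] by (auto simp: dvd_def)
      ultimately have "card L * (u * card (?f ` Y)) dvd card L * q ^ a" by (simp add: mult_ac)
      then have "u * card (?f ` Y) dvd q ^ a" using pos by simp
      then have "card (?f ` Y) dvd q ^ a" by (rule dvd_mult_right)
      then show ?thesis using divides_primepow_nat[OF q] that by blast
    qed
    have subs: "subgroup (?f ` J') (GB Mod Q')" "subgroup (?f ` H) (GB Mod Q')"
      by (intro f.subgroup_img_is_subgroup J'B HB)+
    have triv: "?f ` H \<inter> ?f ` Y = {\<one>\<^bsub>GB Mod Q'\<^esub>}"
    proof
      show "{\<one>\<^bsub>GB Mod Q'\<^esub>} \<subseteq> ?f ` H \<inter> ?f ` Y"
        using imageI[OF subgroup.one_closed[OF HB], of ?f] imageI[OF subgroup.one_closed[OF Y.subgroup_axioms], of ?f]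
        unfolding f.hom_one by blast
      show "?f ` H \<inter> ?f ` Y \<subseteq> {\<one>\<^bsub>GB Mod Q'\<^esub>}"
      proof
        fix u assume "u \<in> ?f ` H \<inter> ?f ` Y"
        then obtain h where h: "h \<in> H" "u = ?f h" "?f h \<in> ?f ` Y" by blast
        have hB: "h \<in> carrier GB" using h(1) HsubB GB_simps by blast
        have "h \<in> Y" using q.quotient_image_mem_iff[OF Y.subgroup_axioms Q'Y hB] h(3) by simp
        then have "h \<in> Q'" using h(1) HR unfolding Y_def by blast
        then have "?f h = Q'" by (rule q.rcos_const[OF GB.is_group])
        then show "u \<in> {\<one>\<^bsub>GB Mod Q'\<^esub>}" using h(2) by simp
      qed
    qed
    have sub: "?f ` J' \<subseteq> ?f ` Y <#>\<^bsub>GB Mod Q'\<^esub> ?f ` H"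
    proof
      fix u assume "u \<in> ?f ` J'"
      then obtain x where x: "x \<in> Y <#>\<^bsub>GB\<^esub> H" "u = ?f x" using JYH by blast
      from x(1) obtain y h where yh: "y \<in> Y" "h \<in> H" "x = y \<otimes>\<^bsub>GB\<^esub> h" by (rule set_multE)
      have "u = ?f y \<otimes>\<^bsub>GB Mod Q'\<^esub> ?f h"
        unfolding x(2) yh(3) by (rule f.hom_mult[OF Y.mem_carrier[OF yh(1)] subgroup.mem_carrier[OF HB yh(2)]])
      then show "u \<in> ?f ` Y <#>\<^bsub>GB Mod Q'\<^esub> ?f ` H"
        using set_multI[OF imageI[OF yh(1), of ?f] imageI[OF yh(2), of ?f], of "GB Mod Q'"] by (simp only:)
    qed
    have cop: "\<not> q dvd card (?f ` J')"
    proof -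
      have "J' \<inter> Q' = Q'" using Q'J' by blast
      then have "card J' = card (?f ` J') * card Q'"
        using f.card_subgroup_image[OF J'B fin'(2)] by (simp add: q.quotient_kernel)
      then have "card (?f ` J') = t" using t pos by simp
      then show ?thesis using qt by simp
    qed
    show ?thesis
      by (rule f.H.coprime_complement_conjugate[OF finQ Yn q k subs triv sub cop])
  qed
  then obtain g where g: "g \<in> B" "conjugate (GB Mod Q') (?f g) (?f ` J') \<subseteq> ?f ` H"
    by (auto simp: carrier_FactGroup GB_simps)
  have "conjugate GB g J' \<subseteq> H"
    by (rule q.conjugate_subset_of_quotient[OF _ subgroup.subset[OF J'B] HB Q'H g(2)])
      (simp add: g(1) GB_simps)
  then have "conjugate G g J \<subseteq> H"
    using conjGB[OF g(1)] conjugate_mono[OF JJ', of G g] by auto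
  then show ?thesis using subgroup.mem_carrier[OF B g(1)] by blast
qed

section \<open>Nilpotent groups\<close>

text \<open>Nilpotency by commutators. In this form the condition restricts to subgroups and passes to images
  without forming quotients of quotients.\<close>

definition central_series where
  "central_series G n S \<longleftrightarrow> normal_series G n S \<and>
     (\<forall>i<n. \<forall>x\<in>S (Suc i). \<forall>g\<in>carrier G. x \<otimes>\<^bsub>G\<^esub> g \<otimes>\<^bsub>G\<^esub> inv\<^bsub>G\<^esub> (g \<otimes>\<^bsub>G\<^esub> x) \<in> S i)"

lemma (in group) nilpotent_iff_central_series:
  "nilpotent_group G \<longleftrightarrow> (\<exists>n S. central_series G n S)"
proof -
  have "(\<forall>i<n. (\<lambda>x. S i #> x) ` S (Suc i) \<subseteq> center (G Mod S i)) \<longleftrightarrow>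
      (\<forall>i<n. \<forall>x\<in>S (Suc i). \<forall>g\<in>carrier G. x \<otimes> g \<otimes> inv (g \<otimes> x) \<in> S i)"
    if NS: "normal_series G n S" for n S
  proof -
    have "(\<lambda>x. S i #> x) ` S (Suc i) \<subseteq> center (G Mod S i) \<longleftrightarrow>
        (\<forall>x\<in>S (Suc i). \<forall>g\<in>carrier G. x \<otimes> g \<otimes> inv (g \<otimes> x) \<in> S i)" if i: "i < n" for i
    proof -
      interpret S: normal "S i" G using NS i by (simp add: normal_series_def)
      interpret S': normal "S (Suc i)" G using NS i by (simp add: normal_series_def)
      interpret q: group_hom G "G Mod S i" "\<lambda>x. S i #> x" by (rule S.quotient_hom)
      have "S i #> x \<in> center (G Mod S i) \<longleftrightarrow> (\<forall>g\<in>carrier G. x \<otimes> g \<otimes> inv (g \<otimes> x) \<in> S i)"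
        if x: "x \<in> S (Suc i)" for x
      proof -
        have xc: "x \<in> carrier G" by (rule S'.mem_carrier[OF x])
        have "S i #> x \<in> center (G Mod S i) \<longleftrightarrow> (\<forall>g\<in>carrier G. (S i #> x) \<otimes>\<^bsub>G Mod S i\<^esub> (S i #> g) = (S i #> g) \<otimes>\<^bsub>G Mod S i\<^esub> (S i #> x))"
          using q.hom_closed[OF xc] unfolding center_def carrier_FactGroup by auto
        also have "\<dots> \<longleftrightarrow> (\<forall>g\<in>carrier G. x \<otimes> g \<otimes> inv (g \<otimes> x) \<in> S i)"
        proof (intro ball_cong refl)
          fix g assume g: "g \<in> carrier G"
          show "(S i #> x) \<otimes>\<^bsub>G Mod S i\<^esub> (S i #> g) = (S i #> g) \<otimes>\<^bsub>G Mod S i\<^esub> (S i #> x) \<longleftrightarrow> x \<otimes> g \<otimes> inv (g \<otimes> x) \<in> S i"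
            using S.quotient_eq_iff_right[OF m_closed[OF xc g] m_closed[OF g xc]] q.hom_mult[OF xc g] q.hom_mult[OF g xc]
            by (simp only:)
        qed
        finally show ?thesis .
      qed
      then show ?thesis by blast
    qed
    then show ?thesis by blast
  qed
  then have "normal_series G n S \<and> (\<forall>i<n. (\<lambda>x. S i #> x) ` S (Suc i) \<subseteq> center (G Mod S i)) \<longleftrightarrow>
      central_series G n S" for n S
    unfolding central_series_def by (intro conj_cong refl)
  then show ?thesis unfolding nilpotent_group_def by (simp only: is_group simp_thms)
qed

lemma (in group) nilpotent_subgroup:
  assumes "nilpotent_group G" "subgroup K G"
  shows "nilpotent_group (G\<lparr>carrier := K\<rparr>)"
proof -
  interpret K: group "G\<lparr>carrier := K\<rparr>" by (rule subgroup_imp_group[OF assms(2)])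
  note Ksub = subgroup.subset[OF assms(2)]
  obtain n S where S: "central_series G n S" using assms(1) nilpotent_iff_central_series by blast
  then have N: "S 0 = {\<one>}" "S n = carrier G" "\<And>i. i \<le> n \<Longrightarrow> S i \<lhd> G" "\<And>i. i < n \<Longrightarrow> S i \<subseteq> S (Suc i)"
    and c: "\<And>i x g. i < n \<Longrightarrow> x \<in> S (Suc i) \<Longrightarrow> g \<in> carrier G \<Longrightarrow> x \<otimes> g \<otimes> inv (g \<otimes> x) \<in> S i"
    unfolding central_series_def normal_series_def by blast+
  have "central_series (G\<lparr>carrier := K\<rparr>) n (\<lambda>i. S i \<inter> K)"
    unfolding central_series_def normal_series_def
  proof (intro conjI allI impI ballI)
    show "S 0 \<inter> K = {\<one>\<^bsub>G\<lparr>carrier := K\<rparr>\<^esub>}" using N(1) subgroup.one_closed[OF assms(2)] by auto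
    show "S n \<inter> K = carrier (G\<lparr>carrier := K\<rparr>)" using N(2) Ksub by auto
    show "S i \<inter> K \<lhd> G\<lparr>carrier := K\<rparr>" if "i \<le> n" for i
      by (rule normal_Int_subgroup[OF assms(2) N(3)[OF that]])
    show "S i \<inter> K \<subseteq> S (Suc i) \<inter> K" if "i < n" for i using N(4)[OF that] by blast
    fix i x g assume i: "i < n" and x: "x \<in> S (Suc i) \<inter> K" and g: "g \<in> carrier (G\<lparr>carrier := K\<rparr>)"
    have gx: "g \<in> K" "x \<in> K" using g x by auto
    have "g \<otimes> x \<in> K" by (rule subgroup.m_closed[OF assms(2) gx])
    then have inv: "inv\<^bsub>G\<lparr>carrier := K\<rparr>\<^esub> (g \<otimes> x) = inv (g \<otimes> x)" by (rule m_inv_consistent[OF assms(2)])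
    have "x \<otimes> g \<otimes> inv (g \<otimes> x) \<in> S i" using c[OF i] x gx Ksub by blast
    moreover have "x \<otimes> g \<otimes> inv (g \<otimes> x) \<in> K"
      by (intro subgroup.m_closed[OF assms(2)] subgroup.m_inv_closed[OF assms(2)] gx)
    ultimately show "x \<otimes>\<^bsub>G\<lparr>carrier := K\<rparr>\<^esub> g \<otimes>\<^bsub>G\<lparr>carrier := K\<rparr>\<^esub> inv\<^bsub>G\<lparr>carrier := K\<rparr>\<^esub> (g \<otimes>\<^bsub>G\<lparr>carrier := K\<rparr>\<^esub> x) \<in> S i \<inter> K"
      using inv by simp
  qed
  then show ?thesis using K.nilpotent_iff_central_series by blast
qed

lemma (in group_hom) nilpotent_image:
  assumes "nilpotent_group G" "h ` carrier G = carrier H"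
  shows "nilpotent_group H"
proof -
  obtain n S where S: "central_series G n S" using assms(1) G.nilpotent_iff_central_series by blast
  then have N: "S 0 = {\<one>}" "S n = carrier G" "\<And>i. i \<le> n \<Longrightarrow> S i \<lhd> G" "\<And>i. i < n \<Longrightarrow> S i \<subseteq> S (Suc i)"
    and c: "\<And>i x g. i < n \<Longrightarrow> x \<in> S (Suc i) \<Longrightarrow> g \<in> carrier G \<Longrightarrow> x \<otimes> g \<otimes> inv (g \<otimes> x) \<in> S i"
    unfolding central_series_def normal_series_def by blast+
  have "central_series H n (\<lambda>i. h ` S i)"
    unfolding central_series_def normal_series_def
  proof (intro conjI allI impI ballI)
    show "h ` S 0 = {\<one>\<^bsub>H\<^esub>}" using N(1) by simp
    show "h ` S n = carrier H" using N(2) assms(2) by simp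
    show "h ` S i \<lhd> H" if "i \<le> n" for i
      by (rule normal.surj_hom_normal_subgroup[OF N(3)[OF that] group_hom_axioms assms(2)])
    show "h ` S i \<subseteq> h ` S (Suc i)" if "i < n" for i by (rule image_mono[OF N(4)[OF that]])
    fix i x g assume i: "i < n" and x: "x \<in> h ` S (Suc i)" and g: "g \<in> carrier H"
    obtain y where y: "y \<in> S (Suc i)" "x = h y" using x by blast
    obtain k where k: "k \<in> carrier G" "g = h k" using g assms(2) by blast
    have "S (Suc i) \<lhd> G" using N(3) i by simp
    from subgroup.mem_carrier[OF normal_imp_subgroup[OF this] y(1)] have yc: "y \<in> carrier G" .
    have "h (y \<otimes> k \<otimes> inv (k \<otimes> y)) \<in> h ` S i" by (rule imageI[OF c[OF i y(1) k(1)]])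
    then show "x \<otimes>\<^bsub>H\<^esub> g \<otimes>\<^bsub>H\<^esub> inv\<^bsub>H\<^esub> (g \<otimes>\<^bsub>H\<^esub> x) \<in> h ` S i" using yc y k by simp
  qed
  then show ?thesis using H.nilpotent_iff_central_series by blast
qed

lemma (in group_hom) nilpotent_subgroup_image:
  assumes "subgroup A G" "nilpotent_group (G\<lparr>carrier := A\<rparr>)"
  shows "nilpotent_group (H\<lparr>carrier := h ` A\<rparr>)"
  by (rule group_hom.nilpotent_image[OF induced_group_hom[OF assms(1)] assms(2)]) simp

lemma (in group) coprime_pow_eq_one:
  assumes "z \<in> carrier G" "z [^] (m::nat) = \<one>" "z [^] (n::nat) = \<one>" "coprime m n"
  shows "z = \<one>"
proof -
  have "ord z dvd m" "ord z dvd n" using assms pow_eq_id by auto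
  then have "ord z = 1" using assms(4) coprime_common_divisor_nat by blast
  then show ?thesis using ord_eq_1[OF assms(1)] by simp
qed

lemma (in group) commute_inv:
  assumes "z \<in> carrier G" "g \<in> carrier G" "z \<otimes> g = g \<otimes> z"
  shows "inv z \<otimes> g = g \<otimes> inv z"
proof -
  have "inv z \<otimes> g = inv z \<otimes> (g \<otimes> z) \<otimes> inv z" using assms(1,2) by (simp add: m_assoc)
  also have "\<dots> = inv z \<otimes> (z \<otimes> g) \<otimes> inv z" using assms(3) by simp
  also have "\<dots> = g \<otimes> inv z" using assms(1,2) by (simp add: m_assoc[symmetric])
  finally show ?thesis .
qed

text \<open>By induction, \<open>x [^] k \<otimes> y = z [^] k \<otimes> (y \<otimes> x [^] k)\<close>.\<close>

lemma (in group) central_commutator_pow: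
  assumes x: "x \<in> carrier G" and y: "y \<in> carrier G" and z: "z \<in> carrier G"
    and zx: "z \<otimes> x = x \<otimes> z" and zy: "z \<otimes> y = y \<otimes> z" and eq: "x \<otimes> y = z \<otimes> (y \<otimes> x)"
    and xm: "x [^] (m::nat) = \<one>"
  shows "z [^] m = \<one>"
proof -
  have "x [^] k \<otimes> y = z [^] k \<otimes> (y \<otimes> x [^] k)" for k :: nat
  proof (induction k)
    case 0
    then show ?case using y by simp
  next
    case (Suc k)
    have comm: "z [^] k \<otimes> x = x \<otimes> z [^] k" by (rule group_commutes_pow[OF zx z x])
    have xx: "x [^] k \<otimes> x = x \<otimes> x [^] k" by (rule group_commutes_pow[OF refl x x])
    have "x [^] Suc k \<otimes> y = (x \<otimes> x [^] k) \<otimes> y" by (simp add: xx)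
    also have "\<dots> = x \<otimes> (x [^] k \<otimes> y)" using x y by (simp add: m_assoc)
    also have "\<dots> = (x \<otimes> z [^] k) \<otimes> (y \<otimes> x [^] k)" using Suc x y z by (simp add: m_assoc)
    also have "\<dots> = z [^] k \<otimes> ((x \<otimes> y) \<otimes> x [^] k)" using comm[symmetric] x y z by (simp add: m_assoc)
    also have "\<dots> = (z [^] k \<otimes> z) \<otimes> (y \<otimes> (x \<otimes> x [^] k))"
      unfolding eq using x y z by (simp add: m_assoc)
    also have "\<dots> = z [^] Suc k \<otimes> (y \<otimes> x [^] Suc k)" by (simp add: xx)
    finally show ?case .
  qed
  from this[of m] have "y = z [^] m \<otimes> y" using xm y z by simp
  then have "y \<otimes> inv y = z [^] m \<otimes> y \<otimes> inv y" by simp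
  then show ?thesis using y z by (simp add: m_assoc)
qed

text \<open>If the commutator of \<open>x\<close> and \<open>y\<close> lies in the term \<open>S (Suc i)\<close> of a central series, it is central
  modulo \<open>S i\<close>, so its powers with exponents \<open>m\<close> and \<open>n\<close> are trivial modulo \<open>S i\<close> and it
  lies in \<open>S i\<close>. This descends to \<open>S 0\<close>.\<close>

lemma (in group) nilpotent_coprime_commute:
  assumes nil: "nilpotent_group G" and x: "x \<in> carrier G" and y: "y \<in> carrier G"
    and xm: "x [^] (m::nat) = \<one>" and yn: "y [^] (n::nat) = \<one>" and cop: "coprime m n"
  shows "x \<otimes> y = y \<otimes> x"
proof -
  obtain N S where S: "central_series G N S" using nil nilpotent_iff_central_series by blast
  then have S0: "S 0 = {\<one>}" and SN: "S N = carrier G" and Sn: "\<And>i. i \<le> N \<Longrightarrow> S i \<lhd> G"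
    and c: "\<And>i x g. i < N \<Longrightarrow> x \<in> S (Suc i) \<Longrightarrow> g \<in> carrier G \<Longrightarrow> x \<otimes> g \<otimes> inv (g \<otimes> x) \<in> S i"
    unfolding central_series_def normal_series_def by blast+
  define z where "z = x \<otimes> y \<otimes> inv (y \<otimes> x)"
  have zc: "z \<in> carrier G" unfolding z_def using x y by simp
  have zyx: "z \<otimes> (y \<otimes> x) = x \<otimes> y" unfolding z_def using x y by (simp add: m_assoc)
  have "z \<in> S i" if "i \<le> N" for i
    using that
  proof (induction rule: inc_induct)
    case base
    then show ?case using zc SN by simp
  next
    case (step i)
    interpret S: normal "S i" G using Sn step by simp
    interpret q: group_hom G "G Mod S i" "\<lambda>x. S i #> x" by (rule S.quotient_hom)
    let ?f = "\<lambda>x. S i #> x"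
    note cl = q.hom_closed[OF x] q.hom_closed[OF y] q.hom_closed[OF zc]
    have comm: "?f z \<otimes>\<^bsub>G Mod S i\<^esub> ?f g = ?f g \<otimes>\<^bsub>G Mod S i\<^esub> ?f z" if g: "g \<in> carrier G" for g
    proof -
      have "?f (z \<otimes> g) = ?f (g \<otimes> z)"
        using S.quotient_eq_iff_right[OF m_closed[OF zc g] m_closed[OF g zc]] c[of i z g] step g by simp
      then show ?thesis using q.hom_mult[OF zc g] q.hom_mult[OF g zc] by (simp only:)
    qed
    have e: "?f x \<otimes>\<^bsub>G Mod S i\<^esub> ?f y = ?f z \<otimes>\<^bsub>G Mod S i\<^esub> (?f y \<otimes>\<^bsub>G Mod S i\<^esub> ?f x)"
      using q.hom_mult[OF x y] q.hom_mult[OF y x] q.hom_mult[OF zc m_closed[OF y x]] zyx by (simp only:)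
    \<comment> \<open>The roles of \<open>x\<close> and \<open>y\<close> are exchanged when the commutator is inverted.\<close>
    have e': "?f y \<otimes>\<^bsub>G Mod S i\<^esub> ?f x = inv\<^bsub>G Mod S i\<^esub> ?f z \<otimes>\<^bsub>G Mod S i\<^esub> (?f x \<otimes>\<^bsub>G Mod S i\<^esub> ?f y)"
      unfolding e using cl by (simp only: q.H.inv_mult_cancel q.H.m_closed)
    have icomm: "inv\<^bsub>G Mod S i\<^esub> ?f z \<otimes>\<^bsub>G Mod S i\<^esub> ?f g = ?f g \<otimes>\<^bsub>G Mod S i\<^esub> inv\<^bsub>G Mod S i\<^esub> ?f z"
      if g: "g \<in> carrier G" for g
      by (rule q.H.commute_inv[OF cl(3) q.hom_closed[OF g] comm[OF g]])
    have p: "?f x [^]\<^bsub>G Mod S i\<^esub> m = \<one>\<^bsub>G Mod S i\<^esub>" "?f y [^]\<^bsub>G Mod S i\<^esub> n = \<one>\<^bsub>G Mod S i\<^esub>"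
      using q.hom_nat_pow[OF x, of m] q.hom_nat_pow[OF y, of n] xm yn q.hom_one by (simp_all only:)
    have "?f z [^]\<^bsub>G Mod S i\<^esub> m = \<one>\<^bsub>G Mod S i\<^esub>"
      by (rule q.H.central_commutator_pow[OF cl comm[OF x] comm[OF y] e p(1)])
    moreover have "inv\<^bsub>G Mod S i\<^esub> ?f z [^]\<^bsub>G Mod S i\<^esub> n = \<one>\<^bsub>G Mod S i\<^esub>"
      by (rule q.H.central_commutator_pow[OF cl(2,1) q.H.inv_closed[OF cl(3)] icomm[OF y] icomm[OF x] e' p(2)])
    then have "?f z [^]\<^bsub>G Mod S i\<^esub> n = \<one>\<^bsub>G Mod S i\<^esub>"
      using q.H.nat_pow_inv[OF cl(3), of n] q.H.nat_pow_closed[OF cl(3)] q.H.inv_eq_1_iff by (simp only:)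
    ultimately have "?f z = \<one>\<^bsub>G Mod S i\<^esub>" by (rule q.H.coprime_pow_eq_one[OF cl(3) _ _ cop])
    then show ?case using rcos_self[OF zc S.subgroup_axioms] by simp
  qed
  from this[of 0] have "z = \<one>" using S0 by simp
  then show ?thesis using zyx x y by simp
qed

text \<open>The normalizer of a Sylow \<open>p\<close>-subgroup \<open>P\<close> contains \<open>P\<close> and every Sylow subgroup for another prime, as
  the latter even centralises \<open>P\<close>. So it is the whole group.\<close>

lemma (in group) nilpotent_sylow_normal:
  assumes fin: "finite (carrier G)" and nil: "nilpotent_group G" and p: "prime p"
  obtains P a m where "P \<lhd> G" "card P = p ^ a" "card (carrier G) = p ^ a * m" "\<not> p dvd m"
proof -
  obtain P a m where P: "subgroup P G" "card P = p ^ a" "card (carrier G) = p ^ a * m" "\<not> p dvd m"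
    by (rule sylow_exists[OF fin p])
  have Psub: "P \<subseteq> carrier G" by (rule subgroup.subset[OF P(1)])
  define K where "K = normalizer G P"
  have K: "subgroup K G" unfolding K_def by (rule normalizer_imp_subgroup[OF Psub])
  have PK: "P \<lhd> G\<lparr>carrier := K\<rparr>" unfolding K_def by (rule subgroup_in_normalizer[OF P(1)])
  have "K = carrier G"
  proof (rule subgroup_eq_carrier_of_sylow[OF fin K])
    fix r :: nat assume r: "prime r"
    show "\<exists>R m. subgroup R G \<and> R \<subseteq> K \<and> card (carrier G) = card R * m \<and> \<not> r dvd m"
    proof (cases "r = p")
      case True
      have "P \<subseteq> K" using subgroup.subset[OF normal_imp_subgroup[OF PK]] by simp
      then show ?thesis using P True by (intro exI[of _ P] exI[of _ m]) simp
    next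
      case False
      obtain R b m' where R: "subgroup R G" "card R = r ^ b" "card (carrier G) = r ^ b * m'" "\<not> r dvd m'"
        by (rule sylow_exists[OF fin r])
      have "R \<subseteq> K"
      proof
        fix y assume y: "y \<in> R"
        have yc: "y \<in> carrier G" by (rule subgroup.mem_carrier[OF R(1) y])
        have cop: "coprime (r ^ b) (p ^ a)"
          using primes_coprime[OF r p False] by simp
        have comm: "y \<otimes> x = x \<otimes> y" if x: "x \<in> P" for x
          using subgroup_pow_card[OF R(1) y] subgroup_pow_card[OF P(1) x] R(2) P(2)
          by (intro nilpotent_coprime_commute[OF nil yc subgroup.mem_carrier[OF P(1) x] _ _ cop]) simp_all
        have "y \<otimes> x \<otimes> inv y = x" if x: "x \<in> P" for x
          using comm[OF x] yc subgroup.mem_carrier[OF P(1) x] by (simp add: m_assoc)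
        then have "y <# P #> inv y = P" by (simp add: l_coset_def r_coset_def)
        then show "y \<in> K" unfolding K_def normalizer_def stabilizer_def using yc Psub by simp
      qed
      then show ?thesis using R by (intro exI[of _ R] exI[of _ m']) simp
    qed
  qed
  then have "P \<lhd> G" using PK by simp
  then show ?thesis by (rule that[OF _ P(2-4)])
qed

section \<open>Hall subgroups of nilpotent groups\<close>

definition pi_number :: "nat set \<Rightarrow> nat \<Rightarrow> bool" where
  "pi_number \<pi> n \<longleftrightarrow> (\<forall>p. prime p \<longrightarrow> p dvd n \<longrightarrow> p \<in> \<pi>)"

lemma pi_number_dvd: "pi_number \<pi> n \<Longrightarrow> m dvd n \<Longrightarrow> pi_number \<pi> m"
  unfolding pi_number_def using dvd_trans by blast

lemma pi_number_mult: "pi_number \<pi> m \<Longrightarrow> pi_number \<pi> n \<Longrightarrow> pi_number \<pi> (m * n)"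
  unfolding pi_number_def using prime_dvd_mult_iff by blast

lemma pi_number_coprime:
  assumes "pi_number \<pi> m" "pi_number \<sigma> n" "\<pi> \<inter> \<sigma> = {}"
  shows "coprime m n"
proof (rule ccontr)
  assume "\<not> coprime m n"
  then have "gcd m n \<noteq> 1" by (simp add: coprime_iff_gcd_eq_1)
  then obtain p where "prime p" "p dvd gcd m n" using prime_factor_nat by blast
  then show False using assms unfolding pi_number_def by auto
qed

lemma pi_number_singleton_power:
  assumes "pi_number {q} n" "n > 0" "prime q"
  obtains a where "n = q ^ a"
proof -
  have "n \<noteq> 0" "\<not> is_unit q" using assms not_prime_unit by auto
  then obtain a m where am: "n = q ^ a * m" "\<not> q dvd m" using multiplicity_decompose' by blast
  have "m = 1"
  proof (rule ccontr)
    assume "m \<noteq> 1"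
    then obtain p where p: "prime p" "p dvd m" using prime_factor_nat by blast
    then have "p = q" using assms(1) am(1) unfolding pi_number_def by auto
    then show False using p am(2) by simp
  qed
  then show ?thesis using that am by simp
qed

lemma not_dvd_pi_number: "prime q \<Longrightarrow> pi_number (- {q}) n \<Longrightarrow> \<not> q dvd n"
  unfolding pi_number_def by auto

text \<open>In a nilpotent group \<open>N\<close> these elements form the Hall \<open>\<pi>\<close>-subgroup.\<close>

definition pi_part :: "('a, 'm) monoid_scheme \<Rightarrow> 'a set \<Rightarrow> nat set \<Rightarrow> 'a set" where
  "pi_part G N \<pi> = {x \<in> N. pi_number \<pi> (group.ord G x)}"

text \<open>Let \<open>X\<close> be a normal \<open>\<pi>\<close>-subgroup of largest order. For \<open>p \<in> \<pi>\<close> the normal Sylow \<open>p\<close>-subgroup \<open>P\<close>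
  is contained in \<open>X\<close>, because \<open>P X\<close> is again a normal \<open>\<pi>\<close>-subgroup. So the index of \<open>X\<close> is prime to
  \<open>\<pi>\<close>, and every \<open>\<pi>\<close>-element is trivial modulo \<open>X\<close>.\<close>

lemma (in group) nilpotent_hall:
  assumes fin: "finite (carrier G)" and nil: "nilpotent_group G"
  shows "pi_part G (carrier G) \<pi> \<lhd> G \<and> pi_number \<pi> (card (pi_part G (carrier G) \<pi>)) \<and>
    (\<exists>m. card (carrier G) = card (pi_part G (carrier G) \<pi>) * m \<and> pi_number (- \<pi>) m)"
proof -
  let ?P = "\<lambda>X. X \<lhd> G \<and> pi_number \<pi> (card X)"
  have P1: "?P {\<one>}" using one_is_normal by (auto simp: pi_number_def)
  have bd: "\<forall>X. ?P X \<longrightarrow> card X < Suc (card (carrier G))"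
    using card_mono[OF fin subgroup.subset[OF normal_imp_subgroup]] by (simp add: less_Suc_eq_le)
  have "\<exists>X. ?P X \<and> (\<forall>Y. ?P Y \<longrightarrow> card Y \<le> card X)"
    by (rule ex_has_greatest_nat[of ?P "{\<one>}" card, OF P1 bd])
  then obtain X where X: "?P X" and max: "\<forall>Y. ?P Y \<longrightarrow> card Y \<le> card X" by (elim exE conjE) simp
  interpret X: normal X G using X by simp
  obtain t where t: "card (carrier G) = card X * t"
    using card_subgroup_dvd[OF X.subgroup_axioms subgroup_self X.subset] by (auto simp: dvd_def)
  have Xpos: "card X > 0" by (rule card_subgroup_pos[OF fin X.subgroup_axioms])
  have t': "pi_number (- \<pi>) t"
    unfolding pi_number_def
  proof (intro allI impI)
    fix p :: nat assume p: "prime p" "p dvd t"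
    show "p \<in> - \<pi>"
    proof
      assume "p \<in> \<pi>"
      obtain P a m where P: "P \<lhd> G" "card P = p ^ a" "card (carrier G) = p ^ a * m" "\<not> p dvd m"
        by (rule nilpotent_sylow_normal[OF fin nil p(1)])
      have Ps: "subgroup P G" by (rule normal_imp_subgroup[OF P(1)])
      have PX: "P <#> X \<lhd> G" by (rule normal_subgroup_set_mult_closed[OF P(1) X.normal_axioms])
      have d: "card (P <#> X) dvd p ^ a * card X"
        using card_normal_set_mult[OF P(1) X.subgroup_axioms fin] P(2) by (metis dvd_triv_left)
      have "pi_number \<pi> (p ^ a)"
        unfolding pi_number_def
      proof (intro allI impI)
        fix r :: nat assume r: "prime r" "r dvd p ^ a"
        then have "r = p" using prime_dvd_power[OF r] p(1) primes_dvd_imp_eq by blast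
        then show "r \<in> \<pi>" using \<open>p \<in> \<pi>\<close> by simp
      qed
      then have "pi_number \<pi> (p ^ a * card X)" using X by (intro pi_number_mult) simp_all
      then have "pi_number \<pi> (card (P <#> X))" by (rule pi_number_dvd[OF _ d])
      then have le: "card (P <#> X) \<le> card X" using max PX by simp
      have "X \<subseteq> P <#> X" by (rule subgroup_subset_set_mult(2)[OF Ps X.subgroup_axioms])
      then have "X = P <#> X"
        using card_seteq[OF finite_subgroup[OF fin normal_imp_subgroup[OF PX]]] le by simp
      moreover have "P \<subseteq> P <#> X"
        by (rule subgroup_subset_set_mult(1)[OF Ps X.subgroup_axioms])
      ultimately have "P \<subseteq> X" by blast
      then obtain u where "card X = p ^ a * u"
        using card_subgroup_dvd[OF Ps X.subgroup_axioms] P(2) by (auto simp: dvd_def)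
      then have "u * t = m" using t P(3) prime_gt_0_nat[OF p(1)] by (simp add: mult.assoc)
      then show False using p P(4) by auto
    qed
  qed
  have "X = pi_part G (carrier G) \<pi>"
  proof
    show "X \<subseteq> pi_part G (carrier G) \<pi>"
    proof
      fix x assume x: "x \<in> X"
      have "ord x dvd card X"
        using subgroup_pow_card[OF X.subgroup_axioms x] pow_eq_id[OF X.mem_carrier[OF x]] by simp
      then show "x \<in> pi_part G (carrier G) \<pi>"
        unfolding pi_part_def using pi_number_dvd[of \<pi> "card X" "ord x"] X X.mem_carrier[OF x] by simp
    qed
    show "pi_part G (carrier G) \<pi> \<subseteq> X"
    proof
      fix x assume "x \<in> pi_part G (carrier G) \<pi>"
      then have x: "x \<in> carrier G" "pi_number \<pi> (ord x)" by (auto simp: pi_part_def)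
      interpret q: group_hom G "G Mod X" "\<lambda>x. X #> x" by (rule X.quotient_hom)
      have "card (rcosets X) * card X = card X * t"
        using lagrange[OF X.subgroup_axioms] t by (simp add: order_def)
      then have ot: "order (G Mod X) = t" using Xpos by (simp add: FactGroup_def order_def)
      have "(X #> x) [^]\<^bsub>G Mod X\<^esub> ord x = \<one>\<^bsub>G Mod X\<^esub>"
        using q.hom_nat_pow[OF x(1), of "ord x"] q.hom_one pow_ord_eq_1[OF x(1)] by (simp only:)
      moreover have "(X #> x) [^]\<^bsub>G Mod X\<^esub> t = \<one>\<^bsub>G Mod X\<^esub>"
        using q.H.pow_order_eq_1[OF q.hom_closed[OF x(1)]] ot by simp
      moreover have "coprime (ord x) t" by (rule pi_number_coprime[OF x(2) t']) simp
      ultimately have "X #> x = \<one>\<^bsub>G Mod X\<^esub>" by (rule q.H.coprime_pow_eq_one[OF q.hom_closed[OF x(1)]])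
      then show "x \<in> X" using rcos_self[OF x(1) X.subgroup_axioms] by simp
    qed
  qed
  then show ?thesis using X t t' by blast
qed

lemma (in group) ord_conj:
  assumes "g \<in> carrier G" "x \<in> carrier G"
  shows "ord (g \<otimes> x \<otimes> inv g) dvd ord x"
proof -
  interpret c: group_hom G G "\<lambda>a. g \<otimes> a \<otimes> inv g" by (rule conjugation_hom[OF assms(1)])
  have "(g \<otimes> x \<otimes> inv g) [^] ord x = \<one>"
    using c.hom_nat_pow[OF assms(2), of "ord x"] c.hom_one pow_ord_eq_1[OF assms(2)] by (simp only:)
  then show ?thesis using pow_eq_id[OF c.hom_closed[OF assms(2)]] by simp
qed

lemma (in group) ord_subgroup:
  assumes "subgroup N G" "x \<in> N"
  shows "group.ord (G\<lparr>carrier := N\<rparr>) x = ord x"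
proof -
  interpret N: group "G\<lparr>carrier := N\<rparr>" by (rule subgroup_imp_group[OF assms(1)])
  have xN: "x \<in> carrier (G\<lparr>carrier := N\<rparr>)" using assms(2) by simp
  have "N.ord x dvd k \<longleftrightarrow> ord x dvd k" for k
    using N.pow_eq_id[OF xN, of k] pow_eq_id[OF subgroup.mem_carrier[OF assms], of k]
    by (simp add: nat_pow_def)
  from this[of "ord x"] this[of "N.ord x"] show ?thesis by (simp add: dvd_antisym)
qed

text \<open>Conjugation by \<open>G\<close> preserves orders of elements, so the Hall subgroups of \<open>N\<close> are normal in \<open>G\<close>.\<close>

lemma (in group) nilpotent_normal_hall:
  assumes fin: "finite (carrier G)" and N: "N \<lhd> G" and nil: "nilpotent_group (G\<lparr>carrier := N\<rparr>)"
  shows "pi_part G N \<pi> \<lhd> G" "pi_number \<pi> (card (pi_part G N \<pi>))"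
    "\<exists>m. card N = card (pi_part G N \<pi>) * m \<and> pi_number (- \<pi>) m"
proof -
  interpret N: normal N G by (rule N)
  interpret GN: group "G\<lparr>carrier := N\<rparr>" by (rule subgroup_imp_group[OF N.subgroup_axioms])
  have eq: "pi_part (G\<lparr>carrier := N\<rparr>) (carrier (G\<lparr>carrier := N\<rparr>)) \<pi> = pi_part G N \<pi>"
    unfolding pi_part_def using ord_subgroup[OF N.subgroup_axioms] by auto
  have finN: "finite (carrier (G\<lparr>carrier := N\<rparr>))" using finite_subgroup[OF fin N.subgroup_axioms] by simp
  note h = GN.nilpotent_hall[OF finN nil, of \<pi>, unfolded eq]
  show "pi_number \<pi> (card (pi_part G N \<pi>))"
    "\<exists>m. card N = card (pi_part G N \<pi>) * m \<and> pi_number (- \<pi>) m" using h by auto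
  have s: "subgroup (pi_part G N \<pi>) G"
    by (rule incl_subgroup[OF N.subgroup_axioms normal_imp_subgroup]) (use h in blast)
  show "pi_part G N \<pi> \<lhd> G"
  proof (rule normal_invI[OF s])
    fix g x assume g: "g \<in> carrier G" and x: "x \<in> pi_part G N \<pi>"
    have xN: "x \<in> N" using x by (simp add: pi_part_def)
    have "pi_number \<pi> (ord (g \<otimes> x \<otimes> inv g))"
      using ord_conj[OF g N.mem_carrier[OF xN]] x pi_number_dvd by (auto simp: pi_part_def)
    then show "g \<otimes> x \<otimes> inv g \<in> pi_part G N \<pi>"
      using N.inv_op_closed2[OF g xN] by (simp add: pi_part_def)
  qed
qed

lemma (in group) nilpotent_hall_commute:
  assumes N: "subgroup N G" and nil: "nilpotent_group (G\<lparr>carrier := N\<rparr>)"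
    and x: "x \<in> pi_part G N \<pi>" and y: "y \<in> pi_part G N \<sigma>" and disj: "\<pi> \<inter> \<sigma> = {}"
  shows "x \<otimes> y = y \<otimes> x"
proof -
  interpret GN: group "G\<lparr>carrier := N\<rparr>" by (rule subgroup_imp_group[OF N])
  have xN: "x \<in> N" "y \<in> N" using x y by (auto simp: pi_part_def)
  have cop: "coprime (ord x) (ord y)"
    by (rule pi_number_coprime[OF _ _ disj]) (use x y in \<open>auto simp: pi_part_def\<close>)
  have "x [^]\<^bsub>G\<lparr>carrier := N\<rparr>\<^esub> ord x = \<one>" "y [^]\<^bsub>G\<lparr>carrier := N\<rparr>\<^esub> ord y = \<one>"
    using pow_ord_eq_1[OF subgroup.mem_carrier[OF N xN(1)]] pow_ord_eq_1[OF subgroup.mem_carrier[OF N xN(2)]]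
    by (simp_all add: nat_pow_def)
  then show ?thesis
    using GN.nilpotent_coprime_commute[OF nil, of x y "ord x" "ord y"] xN cop by simp
qed

text \<open>The index of the product in \<open>N\<close> is both a \<open>\<pi>\<close>-number and a \<open>(- \<pi>)\<close>-number.\<close>

lemma (in group) nilpotent_hall_decompose:
  assumes fin: "finite (carrier G)" and N: "N \<lhd> G" and nil: "nilpotent_group (G\<lparr>carrier := N\<rparr>)"
  shows "pi_part G N \<pi> <#> pi_part G N (- \<pi>) = N"
proof -
  interpret N: normal N G by (rule N)
  note A = nilpotent_normal_hall[OF fin N nil, of \<pi>] and B = nilpotent_normal_hall[OF fin N nil, of "- \<pi>"]
  let ?A = "pi_part G N \<pi>" and ?B = "pi_part G N (- \<pi>)"
  have Bs: "subgroup ?B G" by (rule normal_imp_subgroup[OF B(1)])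
  have AB: "subgroup (?A <#> ?B) G" by (rule mult_norm_subgroup[OF A(1) Bs])
  have ABN: "?A <#> ?B \<subseteq> N"
  proof
    fix x assume "x \<in> ?A <#> ?B"
    then obtain a b where ab: "a \<in> ?A" "b \<in> ?B" "x = a \<otimes> b" by (rule set_multE)
    then have "a \<in> N" "b \<in> N" by (auto simp: pi_part_def)
    then show "x \<in> N" unfolding ab(3) by (rule subgroup.m_closed[OF N.subgroup_axioms])
  qed
  obtain s where s: "card N = card (?A <#> ?B) * s"
    using card_subgroup_dvd[OF AB N.subgroup_axioms ABN] by (auto simp: dvd_def)
  have As: "subgroup ?A G" by (rule normal_imp_subgroup[OF A(1)])
  obtain u where u: "card (?A <#> ?B) = card ?A * u"
    using card_subgroup_dvd[OF As AB] subgroup_subset_set_mult(1)[OF As Bs]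
    by (auto simp: dvd_def)
  obtain v where v: "card (?A <#> ?B) = card ?B * v"
    using card_subgroup_dvd[OF Bs AB] subgroup_subset_set_mult(2)[OF As Bs]
    by (auto simp: dvd_def)
  obtain m where m: "card N = card ?A * m" "pi_number (- \<pi>) m" using A(3) by blast
  obtain m' where m': "card N = card ?B * m'" "pi_number \<pi> m'" using B(3) by auto
  have "u * s = m" using s u m(1) card_subgroup_pos[OF fin As] by (simp add: mult.assoc)
  then have 1: "pi_number (- \<pi>) s" using pi_number_dvd[OF m(2), of s] by auto
  have "v * s = m'" using s v m'(1) card_subgroup_pos[OF fin Bs] by (simp add: mult.assoc)
  then have 2: "pi_number \<pi> s" using pi_number_dvd[OF m'(2), of s] by auto
  have "coprime s s" by (rule pi_number_coprime[OF 2 1]) simp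
  then have "s = 1" by simp
  then show ?thesis
    using s card_subset_eq[OF finite_subgroup[OF fin N.subgroup_axioms] ABN] by simp
qed

section \<open>Locally conjugate complements in finite groups\<close>

text \<open>\<open>J\<close> normalises both \<open>K\<close> and \<open>X\<close>, and \<open>N\<close> centralises \<open>X\<close> modulo \<open>K\<close>.\<close>

lemma (in group) normal_set_mult_of_complement:
  assumes K: "K \<lhd> G" and N: "N \<lhd> G" and J: "subgroup J G" and NJ: "N <#> J = carrier G"
    and X: "X \<lhd> G\<lparr>carrier := J\<rparr>"
    and comm: "\<And>n y. n \<in> N \<Longrightarrow> y \<in> X \<Longrightarrow> n \<otimes> y \<otimes> inv n \<otimes> inv y \<in> K"
  shows "K <#> X \<lhd> G"
proof -
  interpret K: normal K G by (rule K)
  interpret N: normal N G by (rule N)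
  have Xs: "subgroup X G" by (rule incl_subgroup[OF J normal_imp_subgroup[OF X]])
  have W: "subgroup (K <#> X) G" by (rule mult_norm_subgroup[OF K Xs])
  show ?thesis
  proof (rule normal_invI[OF W])
    fix g x assume g: "g \<in> carrier G" and x: "x \<in> K <#> X"
    from x obtain k y where ky: "k \<in> K" "y \<in> X" "x = k \<otimes> y" by (rule set_multE)
    from g have "g \<in> N <#> J" unfolding NJ .
    then obtain n j where nj: "n \<in> N" "j \<in> J" "g = n \<otimes> j" by (rule set_multE)
    note c = K.mem_carrier[OF ky(1)] subgroup.mem_carrier[OF Xs ky(2)] N.mem_carrier[OF nj(1)]
      subgroup.mem_carrier[OF J nj(2)]
    define y' where "y' = j \<otimes> y \<otimes> inv j"
    have y': "y' \<in> X"
      using normal.inv_op_closed2[OF X, of j y] ky(2) nj(2) m_inv_consistent[OF J nj(2)] unfolding y'_def by simp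
    have w: "(n \<otimes> y' \<otimes> inv n \<otimes> inv y') \<otimes> y' \<in> K <#> X" by (rule set_multI[OF comm[OF nj(1) y'] y'])
    have "g \<otimes> k \<otimes> inv g \<in> K <#> X"
      using K.inv_op_closed2[OF g ky(1)] subgroup_subset_set_mult(1)[OF K.subgroup_axioms Xs] by blast
    then have "(g \<otimes> k \<otimes> inv g) \<otimes> ((n \<otimes> y' \<otimes> inv n \<otimes> inv y') \<otimes> y') \<in> K <#> X"
      by (rule subgroup.m_closed[OF W _ w])
    moreover have "(g \<otimes> k \<otimes> inv g) \<otimes> ((n \<otimes> y' \<otimes> inv n \<otimes> inv y') \<otimes> y') = g \<otimes> x \<otimes> inv g"
      unfolding ky(3) nj(3) y'_def using c by (simp add: m_assoc inv_mult_group inv_mult_cancel)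
    ultimately show "g \<otimes> x \<otimes> inv g \<in> K <#> X" by simp
  qed
qed

lemma (in group) normal_of_derived_subset:
  assumes R: "subgroup R G" and D: "derived G (carrier G) \<subseteq> R"
  shows "R \<lhd> G"
proof (rule normal_invI[OF R])
  fix g x assume g: "g \<in> carrier G" and x: "x \<in> R"
  have xc: "x \<in> carrier G" by (rule subgroup.mem_carrier[OF R x])
  have "g \<otimes> x \<otimes> inv g \<otimes> inv x \<in> derived G (carrier G)"
    unfolding derived_def using g xc by (intro generate.incl) blast
  then have "(g \<otimes> x \<otimes> inv g \<otimes> inv x) \<otimes> x \<in> R"
    by (intro subgroup.m_closed[OF R subsetD[OF D] x])
  then show "g \<otimes> x \<otimes> inv g \<in> R" using g xc by (simp add: m_assoc)
qed

text \<open>By the second isomorphism theorem the orders of \<open>R M\<close> and \<open>L M\<close> have a quotient dividing that of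
  the orders of \<open>R\<close> and \<open>L\<close>.\<close>

lemma (in group) prime_power_index_set_mult:
  assumes fin: "finite (carrier G)" and q: "prime q"
    and L: "L \<lhd> G" and R: "R \<lhd> G" and LR: "L \<subseteq> R" and M: "subgroup M G"
    and cR: "card R = card L * q ^ a"
  obtains b where "card (R <#> M) = card (L <#> M) * q ^ b"
proof -
  note Ls = normal_imp_subgroup[OF L] and Rs = normal_imp_subgroup[OF R]
  have LM: "subgroup (L <#> M) G" and RM: "subgroup (R <#> M) G"
    by (intro mult_norm_subgroup L R M)+
  have LiM: "subgroup (L \<inter> M) G" and RiM: "subgroup (R \<inter> M) G"
    by (intro subgroups_Inter_pair Ls Rs M)+
  obtain t where t: "card (R <#> M) = card (L <#> M) * t"
    using card_subgroup_dvd[OF LM RM mono_set_mult[OF LR subset_refl]] by (auto simp: dvd_def)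
  obtain s where s: "card (R \<inter> M) = card (L \<inter> M) * s"
    using card_subgroup_dvd[OF LiM RiM] LR by (auto simp: dvd_def)
  have e1: "card (R <#> M) * card (R \<inter> M) = card R * card M" by (rule card_normal_set_mult[OF R M fin])
  have e2: "card (L <#> M) * card (L \<inter> M) = card L * card M" by (rule card_normal_set_mult[OF L M fin])
  have "(card (L <#> M) * card (L \<inter> M)) * (t * s) = (card (L <#> M) * card (L \<inter> M)) * q ^ a"
    using e1 unfolding t s cR e2 by (simp add: mult_ac flip: e2)
  then have "t * s = q ^ a"
    using card_subgroup_pos[OF fin LM] card_subgroup_pos[OF fin LiM] by simp
  then have "t dvd q ^ a" by (metis dvd_triv_left)
  then obtain b where "t = q ^ b" using divides_primepow_nat[OF q] by blast
  then show ?thesis using t by (intro that[of b]) simp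
qed

text \<open>Take \<open>L = pi_part G N (- {q})\<close> and \<open>R = N X\<close>, where \<open>X\<close> is the Sylow \<open>q\<close>-subgroup of \<open>J\<close>; it is normal in
  \<open>J\<close> because \<open>J\<close> is nilpotent.\<close>

lemma (in group) q_length_one_of_nilpotent_complement:
  assumes fin: "finite (carrier G)" and q: "prime q"
    and N: "N \<lhd> G" and nilN: "nilpotent_group (G\<lparr>carrier := N\<rparr>)"
    and J: "subgroup J G" and NJ: "N <#> J = carrier G" and triv: "N \<inter> J = {\<one>}"
    and nilJ: "nilpotent_group (G\<lparr>carrier := J\<rparr>)"
  obtains L R a m where "L \<lhd> G" "R \<lhd> G" "L \<subseteq> R" "pi_part G N (- {q}) \<subseteq> L"
    "pi_number (- {q}) (card L)" "card R = card L * q ^ a" "card (carrier G) = card R * m" "\<not> q dvd m"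
proof -
  interpret GJ: group "G\<lparr>carrier := J\<rparr>" by (rule subgroup_imp_group[OF J])
  define L where "L = pi_part G N (- {q})"
  note hN = nilpotent_normal_hall[OF fin N nilN, of "- {q}", folded L_def]
  obtain m1 where m1: "card N = card L * m1" "pi_number {q} m1" using hN(3) by auto
  have Ns: "subgroup N G" by (rule normal_imp_subgroup[OF N])
  have "m1 > 0" using card_subgroup_pos[OF fin Ns] m1(1) by (cases m1) auto
  then obtain a1 where a1: "m1 = q ^ a1" using pi_number_singleton_power[OF m1(2) _ q] by blast
  define X where "X = pi_part G J {q}"
  have eq: "pi_part (G\<lparr>carrier := J\<rparr>) (carrier (G\<lparr>carrier := J\<rparr>)) {q} = X"
    unfolding pi_part_def X_def using ord_subgroup[OF J] by auto
  have finJ: "finite (carrier (G\<lparr>carrier := J\<rparr>))" using finite_subgroup[OF fin J] by simp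
  note hJ = GJ.nilpotent_hall[OF finJ nilJ, of "{q}", unfolded eq]
  from hJ obtain m2 where X: "X \<lhd> G\<lparr>carrier := J\<rparr>" "pi_number {q} (card X)"
    and m2: "card J = card X * m2" "pi_number (- {q}) m2" by auto
  have Xs: "subgroup X G" by (rule incl_subgroup[OF J normal_imp_subgroup[OF X(1)]])
  obtain a2 where a2: "card X = q ^ a2"
    using pi_number_singleton_power[OF X(2) card_subgroup_pos[OF fin Xs] q] by blast
  have R: "N <#> X \<lhd> G"
  proof (rule normal_set_mult_of_complement[OF N N J NJ X(1)])
    fix n y assume n: "n \<in> N" and y: "y \<in> X"
    note c = subgroup.mem_carrier[OF Ns n] subgroup.mem_carrier[OF Xs y]
    have "n \<otimes> (y \<otimes> inv n \<otimes> inv y) \<in> N"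
      by (intro subgroup.m_closed[OF Ns n] normal.inv_op_closed2[OF N c(2)] subgroup.m_inv_closed[OF Ns n])
    then show "n \<otimes> y \<otimes> inv n \<otimes> inv y \<in> N" using c by (simp add: m_assoc)
  qed
  have "X \<subseteq> J" unfolding X_def pi_part_def by blast
  then have NX: "N \<inter> X = {\<one>}" using triv subgroup.one_closed[OF Ns] subgroup.one_closed[OF Xs] by blast
  have cR: "card (N <#> X) = card N * card X"
    using card_normal_set_mult[OF N Xs fin] unfolding NX by simp
  have cG: "card (carrier G) = card N * card J"
    using card_normal_set_mult[OF N J fin] unfolding NJ triv by simp
  have LN: "L \<subseteq> N" unfolding L_def pi_part_def by blast
  show ?thesis
  proof (rule that[of L "N <#> X" "a1 + a2" m2])
    show "L \<subseteq> N <#> X"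
      using LN subgroup_subset_set_mult(1)[OF Ns Xs] by (rule subset_trans)
    show "card (N <#> X) = card L * q ^ (a1 + a2)" unfolding cR m1(1) a1 a2 by (simp add: power_add)
    show "card (carrier G) = card (N <#> X) * m2" unfolding cG cR m2(1) by simp
    show "\<not> q dvd m2" by (rule not_dvd_pi_number[OF q m2(2)])
  qed (use hN R in \<open>auto simp: L_def\<close>)
qed

text \<open>Let \<open>F\<close> be the derived subgroup, \<open>L\<^sub>0\<close> its part prime to \<open>q\<close>, and \<open>S\<close> a Sylow \<open>q\<close>-subgroup of \<open>G\<close>.
  The product \<open>F S\<close> is normal because it contains \<open>F\<close>, and \<open>L\<^sub>0 \<subseteq> F S\<close> has the required
  indices. Multiplying both by the part of \<open>N\<close> prime to \<open>q\<close> makes the smaller one contain that part.\<close>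

lemma (in group) q_length_one_of_nilpotent_derived:
  assumes fin: "finite (carrier G)" and q: "prime q"
    and N: "N \<lhd> G" and nilN: "nilpotent_group (G\<lparr>carrier := N\<rparr>)"
    and nilD: "nilpotent_group (G\<lparr>carrier := derived G (carrier G)\<rparr>)"
  obtains L R a m where "L \<lhd> G" "R \<lhd> G" "L \<subseteq> R" "pi_part G N (- {q}) \<subseteq> L"
    "pi_number (- {q}) (card L)" "card R = card L * q ^ a" "card (carrier G) = card R * m" "\<not> q dvd m"
proof -
  define F where "F = derived G (carrier G)"
  have F: "F \<lhd> G" unfolding F_def by (rule derived_self_is_normal)
  have Fs: "subgroup F G" by (rule normal_imp_subgroup[OF F])
  define L0 where "L0 = pi_part G F (- {q})"
  note hF = nilpotent_normal_hall[OF fin F nilD[folded F_def], of "- {q}", folded L0_def]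
  define M where "M = pi_part G N (- {q})"
  note hN = nilpotent_normal_hall[OF fin N nilN, of "- {q}", folded M_def]
  have Ms: "subgroup M G" by (rule normal_imp_subgroup[OF hN(1)])
  have L0s: "subgroup L0 G" by (rule normal_imp_subgroup[OF hF(1)])
  obtain m1 where m1: "card F = card L0 * m1" "pi_number {q} m1" using hF(3) by auto
  have "m1 > 0" using card_subgroup_pos[OF fin Fs] m1(1) by (cases m1) auto
  then obtain a1 where a1: "m1 = q ^ a1" using pi_number_singleton_power[OF m1(2) _ q] by blast
  obtain S b m2 where S: "subgroup S G" "card S = q ^ b" "card (carrier G) = q ^ b * m2" "\<not> q dvd m2"
    by (rule sylow_exists[OF fin q])
  define R0 where "R0 = F <#> S"
  have R0s: "subgroup R0 G" unfolding R0_def by (rule mult_norm_subgroup[OF F S(1)])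
  have FR0: "F \<subseteq> R0" unfolding R0_def
    by (rule subgroup_subset_set_mult(1)[OF Fs S(1)])
  have R0: "R0 \<lhd> G" by (rule normal_of_derived_subset[OF R0s FR0[unfolded F_def]])
  have L0R0: "L0 \<subseteq> R0" using FR0 unfolding L0_def pi_part_def by blast
  obtain t where t: "card R0 = card L0 * t"
    using card_subgroup_dvd[OF L0s R0s L0R0] by (auto simp: dvd_def)
  have "card R0 * card (F \<inter> S) = card L0 * q ^ a1 * q ^ b"
    using card_normal_set_mult[OF F S(1) fin] unfolding R0_def[symmetric] m1(1) a1 S(2) .
  then have "t * card (F \<inter> S) = q ^ (a1 + b)"
    unfolding t using card_subgroup_pos[OF fin L0s] by (simp add: power_add mult.assoc)
  then have "t dvd q ^ (a1 + b)" by (metis dvd_triv_left)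
  then obtain a0 where a0: "t = q ^ a0" using divides_primepow_nat[OF q] by blast
  obtain a where a: "card (R0 <#> M) = card (L0 <#> M) * q ^ a"
    by (rule prime_power_index_set_mult[OF fin q hF(1) R0 L0R0 Ms t[unfolded a0]])
  have R: "R0 <#> M \<lhd> G" and L: "L0 <#> M \<lhd> G"
    by (intro normal_subgroup_set_mult_closed R0 hN(1) hF(1))+
  have Rs: "subgroup (R0 <#> M) G" by (rule normal_imp_subgroup[OF R])
  have SR: "S \<subseteq> R0 <#> M"
  proof -
    have "S \<subseteq> R0" unfolding R0_def
      by (rule subgroup_subset_set_mult(2)[OF Fs S(1)])
    also have "R0 \<subseteq> R0 <#> M"
      by (rule subgroup_subset_set_mult(1)[OF R0s Ms])
    finally show ?thesis .
  qed
  obtain m where m: "card (carrier G) = card (R0 <#> M) * m"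
    using card_subgroup_dvd[OF Rs subgroup_self subgroup.subset[OF Rs]] by (auto simp: dvd_def)
  obtain u where u: "card (R0 <#> M) = q ^ b * u"
    using card_subgroup_dvd[OF S(1) Rs SR] S(2) by (auto simp: dvd_def)
  have um: "u * m = m2" using m u S(3) prime_gt_0_nat[OF q] by (simp add: mult.assoc)
  show ?thesis
  proof (rule that[OF L R _ _ _ a m])
    show "L0 <#> M \<subseteq> R0 <#> M" by (rule mono_set_mult[OF L0R0 subset_refl])
    show "pi_part G N (- {q}) \<subseteq> L0 <#> M" unfolding M_def[symmetric]
      by (rule subgroup_subset_set_mult(2)[OF L0s Ms])
    have "card (L0 <#> M) dvd card L0 * card M"
      using card_normal_set_mult[OF hF(1) Ms fin] by (metis dvd_triv_left)
    then show "pi_number (- {q}) (card (L0 <#> M))"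
      by (rule pi_number_dvd[OF pi_number_mult[OF hF(2) hN(2)]])
    show "\<not> q dvd m" using um S(4) by auto
  qed
qed

text \<open>\<open>K = pi_part G N (- {q}) H\<close> has \<open>q\<close>-power index in \<open>G\<close>, hence it contains every normal subgroup of
  order prime to \<open>q\<close>, in particular \<open>L\<close>. So \<open>J\<close> is conjugate into \<open>K\<close>. Since \<open>G = N J\<close>, the conjugating
  element may be taken in \<open>N\<close>, and its component of order prime to \<open>q\<close> may be dropped because it lies
  in \<open>K\<close>.\<close>

lemma (in group) complement_conjugate_mod_q_complement:
  assumes fin: "finite (carrier G)" and q: "prime q"
    and N: "N \<lhd> G" and nilN: "nilpotent_group (G\<lparr>carrier := N\<rparr>)"
    and J: "subgroup J G" and H: "subgroup H G"
    and NJ: "N <#> J = carrier G" "N \<inter> J = {\<one>}"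
    and NH: "N <#> H = carrier G" "N \<inter> H = {\<one>}"
    and Q: "subgroup Q G" "Q \<subseteq> J" "card Q = q ^ c" "card J = card Q * m1" "\<not> q dvd m1"
    and g: "g \<in> carrier G" "conjugate G g Q \<subseteq> H"
    and nil: "nilpotent_group (G\<lparr>carrier := J\<rparr>) \<or> nilpotent_group (G\<lparr>carrier := derived G (carrier G)\<rparr>)"
  shows "\<exists>n\<in>pi_part G N {q}. conjugate G n J \<subseteq> pi_part G N (- {q}) <#> H"
proof -
  note Ns = normal_imp_subgroup[OF N]
  note Jsub = subgroup.subset[OF J]
  have "\<exists>L R a m. L \<lhd> G \<and> R \<lhd> G \<and> L \<subseteq> R \<and> pi_part G N (- {q}) \<subseteq> L \<and>
    pi_number (- {q}) (card L) \<and> card R = card L * q ^ a \<and> card (carrier G) = card R * m \<and> \<not> q dvd m"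
    using nil
  proof
    assume n: "nilpotent_group (G\<lparr>carrier := J\<rparr>)"
    show ?thesis by (rule q_length_one_of_nilpotent_complement[OF fin q N nilN J NJ n]) (intro exI conjI)
  next
    assume n: "nilpotent_group (G\<lparr>carrier := derived G (carrier G)\<rparr>)"
    show ?thesis by (rule q_length_one_of_nilpotent_derived[OF fin q N nilN n]) (intro exI conjI)
  qed
  then obtain L R a m where L: "L \<lhd> G" and R: "R \<lhd> G" and LR: "L \<subseteq> R" and NL: "pi_part G N (- {q}) \<subseteq> L"
    and piL: "pi_number (- {q}) (card L)" and cR: "card R = card L * q ^ a"
    and cG: "card (carrier G) = card R * m" "\<not> q dvd m" by (elim exE conjE)
  note Ls = normal_imp_subgroup[OF L]
  define M where "M = pi_part G N (- {q})"
  note hN = nilpotent_normal_hall[OF fin N nilN, of "- {q}", folded M_def]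
  have Ms: "subgroup M G" by (rule normal_imp_subgroup[OF hN(1)])
  have MN: "M \<subseteq> N" unfolding M_def pi_part_def by blast
  obtain t where t: "card N = card M * t" "pi_number {q} t" using hN(3) by auto
  have "t > 0" using card_subgroup_pos[OF fin Ns] t(1) by (cases t) auto
  then obtain b where b: "t = q ^ b" using pi_number_singleton_power[OF t(2) _ q] by blast
  define K where "K = M <#> H"
  have K: "subgroup K G" unfolding K_def by (rule mult_norm_subgroup[OF hN(1) H])
  have MK: "M \<subseteq> K" unfolding K_def by (rule subgroup_subset_set_mult(1)[OF Ms H])
  have HK: "H \<subseteq> K" unfolding K_def by (rule subgroup_subset_set_mult(2)[OF Ms H])
  have MA: "M \<inter> A = {\<one>}" if "subgroup A G" "A \<subseteq> H" for A
    using MN NH(2) that(2) subgroup.one_closed[OF Ms] subgroup.one_closed[OF that(1)] by blast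
  have cK: "card K = card M * card H"
    using card_normal_set_mult[OF hN(1) H fin] unfolding K_def MA[OF H subset_refl] by simp
  have cGH: "card (carrier G) = card N * card H"
    using card_normal_set_mult[OF N H fin] unfolding NH by simp
  have cGJ: "card (carrier G) = card N * card J"
    using card_normal_set_mult[OF N J fin] unfolding NJ by simp
  have cHJ: "card H = card J" using cGH cGJ card_subgroup_pos[OF fin Ns] by simp
  have cGK: "card (carrier G) = card K * q ^ b" unfolding cGH cK t(1) b by (simp add: mult_ac)
  \<comment> \<open>The index of \<open>K\<close> in \<open>L K\<close> divides both \<open>card L\<close> and a power of \<open>q\<close>.\<close>
  have LK: "L \<subseteq> K"
  proof -
    have LKs: "subgroup (L <#> K) G" by (rule mult_norm_subgroup[OF L K])
    have KLK: "K \<subseteq> L <#> K" by (rule subgroup_subset_set_mult(2)[OF Ls K])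
    obtain s where s: "card (L <#> K) = card K * s"
      using card_subgroup_dvd[OF K LKs KLK] by (auto simp: dvd_def)
    have Kpos: "card K > 0" by (rule card_subgroup_pos[OF fin K])
    have "card K * s * card (L \<inter> K) = card L * card K"
      using card_normal_set_mult[OF L K fin] unfolding s .
    then have "s * card (L \<inter> K) = card L" using Kpos by (simp add: mult_ac)
    then have "s dvd card L" by (metis dvd_triv_left)
    moreover have "card K * s dvd card K * q ^ b"
      using card_subgroup_dvd[OF LKs subgroup_self subgroup.subset[OF LKs]] unfolding s cGK .
    then have "s dvd q ^ b" using Kpos by simp
    ultimately have "s = 1"
      using dvd_prime_power_coprime_eq_1[OF q _ _ not_dvd_pi_number[OF q piL]] by blast
    then have "K = L <#> K" using s card_subset_eq[OF finite_subgroup[OF fin LKs] KLK] by simp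
    then show ?thesis using subgroup_subset_set_mult(1)[OF Ls K] by simp
  qed
  define J1 where "J1 = conjugate G g J"
  define Q1 where "Q1 = conjugate G g Q"
  have J1: "subgroup J1 G" and Q1: "subgroup Q1 G"
    unfolding J1_def Q1_def by (intro conjugate_subgroup J Q(1) g(1))+
  have QJ1: "Q1 \<subseteq> J1" unfolding Q1_def J1_def by (rule conjugate_mono[OF Q(2)])
  have cQ1: "card Q1 = card Q" unfolding Q1_def by (rule conjugate_card[OF subgroup.subset[OF Q(1)] g(1)])
  have cJ1: "card J1 = card J" unfolding J1_def by (rule conjugate_card[OF Jsub g(1)])
  have Q1K: "Q1 \<subseteq> K" using g(2) HK unfolding Q1_def by blast
  have LQ: "subgroup (L <#> Q1) G" by (rule mult_norm_subgroup[OF L Q1])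
  have MQ: "subgroup (M <#> Q1) G" by (rule mult_norm_subgroup[OF hN(1) Q1])
  have "L <#> Q1 \<subseteq> K"
  proof
    fix x assume "x \<in> L <#> Q1"
    then obtain l y where ly: "l \<in> L" "y \<in> Q1" "x = l \<otimes> y" by (rule set_multE)
    show "x \<in> K" unfolding ly(3) by (rule subgroup.m_closed[OF K subsetD[OF LK ly(1)] subsetD[OF Q1K ly(2)]])
  qed
  then obtain m2 where m2: "card K = card (L <#> Q1) * m2"
    using card_subgroup_dvd[OF LQ K] by (auto simp: dvd_def)
  obtain u where u: "card (L <#> Q1) = card (M <#> Q1) * u"
    using card_subgroup_dvd[OF MQ LQ mono_set_mult[OF NL[folded M_def] subset_refl]] by (auto simp: dvd_def)
  \<comment> \<open>\<open>M Q1\<close> already has index \<open>m1\<close> in \<open>K\<close>, since \<open>card H = card J\<close>; the index of \<open>L Q1\<close> divides it.\<close>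
  have cMQ: "card (M <#> Q1) = card M * card Q"
    using card_normal_set_mult[OF hN(1) Q1 fin] unfolding MA[OF Q1 g(2)[folded Q1_def]] cQ1 by simp
  have "card M * card Q * (u * m2) = card M * card Q * m1"
    using m2 unfolding u cMQ cK cHJ Q(4) by (auto simp: mult_ac)
  then have "u * m2 = m1" using card_subgroup_pos[OF fin Ms] card_subgroup_pos[OF fin Q(1)] by simp
  then have qm2: "\<not> q dvd m2" using Q(5) by auto
  have "\<exists>x\<in>carrier G. conjugate G x J1 \<subseteq> K"
    using conjugate_into_of_q_length_one[OF fin q L R LR J1 K Q1 LK QJ1 Q1K cR cG cGK _ _ Q(5) m2 qm2]
      cQ1 cJ1 Q(3,4) by simp
  then obtain x where x: "x \<in> carrier G" "conjugate G x J1 \<subseteq> K" by blast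
  have xg: "conjugate G (x \<otimes> g) J \<subseteq> K"
    using x(2) conjugate_conjugate[OF Jsub x(1) g(1)] unfolding J1_def by simp
  have "x \<otimes> g \<in> N <#> J" using x(1) g(1) NJ by simp
  then obtain n j where nj: "n \<in> N" "j \<in> J" "x \<otimes> g = n \<otimes> j" by (rule set_multE)
  have nc: "n \<in> carrier G" and jc: "j \<in> carrier G"
    using subgroup.mem_carrier[OF Ns nj(1)] subgroup.mem_carrier[OF J nj(2)] by auto
  have "conjugate G (x \<otimes> g) J = conjugate G n J"
    unfolding nj(3) using conjugate_conjugate[OF Jsub nc jc] conjugate_self[OF J nj(2)] by simp
  then have nK: "conjugate G n J \<subseteq> K" using xg by simp
  have "n \<in> pi_part G N (- {q}) <#> pi_part G N (- (- {q}))"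
    using nilpotent_hall_decompose[OF fin N nilN, of "- {q}"] nj(1) by simp
  then obtain y z where yz: "y \<in> M" "z \<in> pi_part G N (- (- {q}))" "n = y \<otimes> z" unfolding M_def by (rule set_multE)
  have zq: "z \<in> pi_part G N {q}" using yz(2) by simp
  then have zc: "z \<in> carrier G" using subgroup.mem_carrier[OF Ns] by (simp add: pi_part_def)
  have yc: "y \<in> carrier G" by (rule subgroup.mem_carrier[OF Ms yz(1)])
  have "inv y \<in> K" using yz(1) MK subgroup.m_inv_closed[OF K] by blast
  then have "conjugate G (inv y) K \<subseteq> K" by (rule conjugate_mem_subset[OF K])
  moreover have "conjugate G (inv y) (conjugate G n J) \<subseteq> conjugate G (inv y) K" by (rule conjugate_mono[OF nK])
  moreover have "conjugate G (inv y) (conjugate G n J) = conjugate G z J"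
    using conjugate_conjugate[OF Jsub inv_closed[OF yc] nc] yc zc unfolding yz(3) by (simp add: inv_mult_cancel)
  ultimately have "conjugate G z J \<subseteq> K" by simp
  then show ?thesis using zq unfolding K_def M_def by blast
qed

text \<open>By induction on a finite set \<open>\<pi>\<close> of primes, an element \<open>n\<close> of the \<open>\<pi>\<close>-part of \<open>N\<close> conjugates \<open>J\<close> into
  \<open>pi_part G N (- \<pi>) H\<close>. For a further prime \<open>q\<close>, let \<open>a\<close> in the \<open>q\<close>-part conjugate \<open>J\<close> into
  \<open>pi_part G N (- {q}) H\<close>. The product of the commuting elements \<open>n\<close> and \<open>a\<close> conjugates \<open>J\<close> into both of
  these subgroups, because \<open>n\<close> lies in the second and \<open>a\<close> in the first. As \<open>N \<inter> H\<close> is trivial, they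
  intersect in \<open>pi_part G N (- insert q \<pi>) H\<close>. If \<open>\<pi>\<close> consists of the prime divisors of \<open>card N\<close>,
  then \<open>pi_part G N (- \<pi>)\<close> is trivial.\<close>

theorem (in group) locally_conjugate_complements:
  assumes fin: "finite (carrier G)"
    and N: "N \<lhd> G" and nilN: "nilpotent_group (G\<lparr>carrier := N\<rparr>)"
    and J: "subgroup J G" and H: "subgroup H G"
    and NJ: "N <#> J = carrier G" "N \<inter> J = {\<one>}"
    and NH: "N <#> H = carrier G" "N \<inter> H = {\<one>}"
    and nil: "nilpotent_group (G\<lparr>carrier := J\<rparr>) \<or> nilpotent_group (G\<lparr>carrier := derived G (carrier G)\<rparr>)"
    and syl: "\<And>p. prime p \<Longrightarrow> \<exists>Q c m g. subgroup Q G \<and> Q \<subseteq> J \<and> card Q = p ^ c \<and> card J = card Q * m \<and>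
      \<not> p dvd m \<and> g \<in> carrier G \<and> conjugate G g Q \<subseteq> H"
  shows "\<exists>g\<in>carrier G. conjugate G g J \<subseteq> H"
proof -
  interpret N: normal N G by (rule N)
  note Ns = N.subgroup_axioms and Jsub = subgroup.subset[OF J] and Hsub = subgroup.subset[OF H]
  note hall = nilpotent_normal_hall(1)[OF fin N nilN]
  note halls = normal_imp_subgroup[OF hall]
  have mono: "pi_part G N \<pi> \<subseteq> pi_part G N \<sigma>" if "\<pi> \<subseteq> \<sigma>" for \<pi> \<sigma>
    using that unfolding pi_part_def pi_number_def by blast
  have KH: "subgroup (pi_part G N \<pi> <#> H) G" for \<pi> by (rule mult_norm_subgroup[OF hall H])
  have pH: "pi_part G N \<pi> \<subseteq> pi_part G N \<pi> <#> H" for \<pi>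
    by (rule subgroup_subset_set_mult(1)[OF halls H])
  have step: "\<exists>n\<in>pi_part G N \<pi>. conjugate G n J \<subseteq> pi_part G N (- \<pi>) <#> H"
    if "finite \<pi>" "\<And>p. p \<in> \<pi> \<Longrightarrow> prime p" for \<pi>
    using that
  proof (induction \<pi> rule: finite_induct)
    case empty
    have "pi_part G N (- {}) = N" unfolding pi_part_def pi_number_def by simp
    then have "conjugate G \<one> J \<subseteq> pi_part G N (- {}) <#> H"
      using NH(1) conjugate_subset_carrier[OF Jsub one_closed] by simp
    then show ?case using subgroup.one_closed[OF halls] by blast
  next
    case (insert q \<pi>)
    have q: "prime q" using insert by simp
    obtain n where n: "n \<in> pi_part G N \<pi>" "conjugate G n J \<subseteq> pi_part G N (- \<pi>) <#> H" using insert by auto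
    obtain a where a: "a \<in> pi_part G N {q}" "conjugate G a J \<subseteq> pi_part G N (- {q}) <#> H"
    proof -
      from syl[OF q] obtain Q c m g where Q: "subgroup Q G" "Q \<subseteq> J" "card Q = q ^ c" "card J = card Q * m"
        "\<not> q dvd m" "g \<in> carrier G" "conjugate G g Q \<subseteq> H" by (elim exE conjE)
      show ?thesis
        using complement_conjugate_mod_q_complement[OF fin q N nilN J H NJ NH Q nil] that by (elim bexE)
    qed
    have nc: "n \<in> carrier G" and ac: "a \<in> carrier G"
      using subgroup.mem_carrier[OF halls n(1)] subgroup.mem_carrier[OF halls a(1)] by auto
    have comm: "n \<otimes> a = a \<otimes> n"
      by (rule nilpotent_hall_commute[OF Ns nilN n(1) a(1)]) (use insert in auto)
    have in1: "conjugate G (n \<otimes> a) J \<subseteq> pi_part G N (- {q}) <#> H"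
    proof -
      have "\<pi> \<subseteq> - {q}" using insert by auto
      then have nK: "n \<in> pi_part G N (- {q}) <#> H" using mono n(1) pH by blast
      have "conjugate G (n \<otimes> a) J = conjugate G n (conjugate G a J)"
        by (rule conjugate_conjugate[OF Jsub nc ac, symmetric])
      also have "\<dots> \<subseteq> conjugate G n (pi_part G N (- {q}) <#> H)" by (rule conjugate_mono[OF a(2)])
      also have "\<dots> \<subseteq> pi_part G N (- {q}) <#> H" by (rule conjugate_mem_subset[OF KH nK])
      finally show ?thesis .
    qed
    have in2: "conjugate G (n \<otimes> a) J \<subseteq> pi_part G N (- \<pi>) <#> H"
    proof -
      have "{q} \<subseteq> - \<pi>" using insert by auto
      then have aK: "a \<in> pi_part G N (- \<pi>) <#> H" using mono a(1) pH by blast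
      have "conjugate G (n \<otimes> a) J = conjugate G a (conjugate G n J)"
        unfolding comm by (rule conjugate_conjugate[OF Jsub ac nc, symmetric])
      also have "\<dots> \<subseteq> conjugate G a (pi_part G N (- \<pi>) <#> H)" by (rule conjugate_mono[OF n(2)])
      also have "\<dots> \<subseteq> pi_part G N (- \<pi>) <#> H" by (rule conjugate_mem_subset[OF KH aK])
      finally show ?thesis .
    qed
    have "conjugate G (n \<otimes> a) J \<subseteq> pi_part G N (- insert q \<pi>) <#> H"
    proof
      fix x assume x: "x \<in> conjugate G (n \<otimes> a) J"
      from subsetD[OF in1 x] obtain b h where b: "b \<in> pi_part G N (- {q})" "h \<in> H" "x = b \<otimes> h" by (rule set_multE)
      from subsetD[OF in2 x] obtain b' h' where b': "b' \<in> pi_part G N (- \<pi>)" "h' \<in> H" "x = b' \<otimes> h'" by (rule set_multE)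
      have bN: "b \<in> N" "b' \<in> N" using b(1) b'(1) by (auto simp: pi_part_def)
      note c = N.mem_carrier[OF bN(1)] N.mem_carrier[OF bN(2)] subsetD[OF Hsub b(2)] subsetD[OF Hsub b'(2)]
      have "inv b' \<otimes> b = inv b' \<otimes> (b \<otimes> h) \<otimes> inv h" using c by (simp add: m_assoc)
      also have "\<dots> = h' \<otimes> inv h" unfolding b(3)[symmetric] b'(3) using c by (simp add: inv_mult_cancel)
      finally have e: "inv b' \<otimes> b = h' \<otimes> inv h" .
      have "h' \<otimes> inv h \<in> H" by (intro subgroup.m_closed[OF H] subgroup.m_inv_closed[OF H] b(2) b'(2))
      moreover have "inv b' \<otimes> b \<in> N" by (intro subgroup.m_closed[OF Ns] subgroup.m_inv_closed[OF Ns] bN)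
      ultimately have "inv b' \<otimes> b \<in> N \<inter> H" using e by simp
      then have "inv b' \<otimes> b = \<one>" using NH(2) by simp
      then have "b' \<otimes> (inv b' \<otimes> b) = b'" using c by simp
      then have "b = b'" using c by (simp add: inv_mult_cancel)
      then have "b \<in> pi_part G N (- insert q \<pi>)"
        using b(1) b'(1) unfolding pi_part_def pi_number_def by auto
      then show "x \<in> pi_part G N (- insert q \<pi>) <#> H" unfolding b(3) by (rule set_multI[OF _ b(2)])
    qed
    moreover have "n \<otimes> a \<in> pi_part G N (insert q \<pi>)"
      using subsetD[OF mono n(1), of "insert q \<pi>"] subsetD[OF mono a(1), of "insert q \<pi>"]
      by (intro subgroup.m_closed[OF halls]) auto
    ultimately show ?case by blast
  qed
  define \<pi> where "\<pi> = {p. prime p \<and> p dvd card N}"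
  have cN: "card N > 0" by (rule card_subgroup_pos[OF fin Ns])
  have "finite \<pi>"
    by (rule finite_subset[of _ "{..card N}"]) (use cN dvd_imp_le in \<open>auto simp: \<pi>_def\<close>)
  then obtain n where n: "n \<in> pi_part G N \<pi>" "conjugate G n J \<subseteq> pi_part G N (- \<pi>) <#> H"
    using step[of \<pi>] unfolding \<pi>_def by blast
  have "pi_part G N (- \<pi>) \<subseteq> {\<one>}"
  proof
    fix x assume "x \<in> pi_part G N (- \<pi>)"
    then have x: "x \<in> N" "pi_number (- \<pi>) (ord x)" by (auto simp: pi_part_def)
    have xc: "x \<in> carrier G" by (rule N.mem_carrier[OF x(1)])
    have d: "ord x dvd card N" using subgroup_pow_card[OF Ns x(1)] pow_eq_id[OF xc] by simp
    have "ord x = 1"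
    proof (rule ccontr)
      assume "ord x \<noteq> 1"
      then obtain p where p: "prime p" "p dvd ord x" using prime_factor_nat by blast
      then have "p \<in> \<pi>" using dvd_trans[OF p(2) d] by (simp add: \<pi>_def)
      then show False using x(2) p unfolding pi_number_def by auto
    qed
    then show "x \<in> {\<one>}" using ord_eq_1[OF xc] by simp
  qed
  then have "pi_part G N (- \<pi>) <#> H \<subseteq> {\<one>} <#> H" by (rule mono_set_mult[OF _ subset_refl])
  also have "\<dots> \<subseteq> H" using Hsub by (auto simp: set_mult_iff subset_iff)
  finally show ?thesis using n subgroup.mem_carrier[OF halls n(1)] by blast
qed

section \<open>The derived subgroup of a supersolvable group\<close>

text \<open>Conjugation by an element of \<open>G\<close> acts on \<open>A\<close> as a power map, and power maps commute with each
  other.\<close>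

lemma (in group) derived_centralizes_cyclic_normal:
  assumes A: "A \<lhd> G" and s: "s \<in> A" and gen: "A \<subseteq> range (\<lambda>k::int. s [^] k)"
    and c: "c \<in> derived G (carrier G)" and y: "y \<in> A"
  shows "c \<otimes> y = y \<otimes> c"
proof -
  interpret A: normal A G by (rule A)
  note Ac = A.mem_carrier
  have conj: "\<exists>a::int. \<forall>y\<in>A. g \<otimes> y \<otimes> inv g = y [^] a" if g: "g \<in> carrier G" for g
  proof -
    interpret h: group_hom G G "\<lambda>a. g \<otimes> a \<otimes> inv g" by (rule conjugation_hom[OF g])
    have "g \<otimes> s \<otimes> inv g \<in> A" by (rule A.inv_op_closed2[OF g s])
    then obtain a :: int where a: "g \<otimes> s \<otimes> inv g = s [^] a" using gen by blast
    have "g \<otimes> y \<otimes> inv g = y [^] a" if "y \<in> A" for y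
    proof -
      obtain k :: int where k: "y = s [^] k" using \<open>y \<in> A\<close> gen by blast
      have "g \<otimes> y \<otimes> inv g = (g \<otimes> s \<otimes> inv g) [^] k" unfolding k by (rule h.hom_int_pow[OF Ac[OF s]])
      also have "\<dots> = y [^] a" unfolding a k using Ac[OF s] by (simp add: int_pow_pow mult.commute)
      finally show ?thesis .
    qed
    then show ?thesis by blast
  qed
  define C where "C = {g \<in> carrier G. \<forall>y\<in>A. g \<otimes> y = y \<otimes> g}"
  have "subgroup C G"
  proof (rule subgroupI)
    show "C \<subseteq> carrier G" unfolding C_def by blast
    have "\<one> \<in> C" unfolding C_def using Ac by simp
    then show "C \<noteq> {}" by blast
    show "inv a \<in> C" if "a \<in> C" for a
      using that commute_inv Ac unfolding C_def by simp
    show "a \<otimes> b \<in> C" if ab: "a \<in> C" "b \<in> C" for a b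
    proof -
      have "a \<otimes> b \<otimes> y = y \<otimes> (a \<otimes> b)" if y: "y \<in> A" for y
      proof -
        have e: "a \<in> carrier G" "b \<in> carrier G" "y \<in> carrier G" "a \<otimes> y = y \<otimes> a" "b \<otimes> y = y \<otimes> b"
          using ab y Ac unfolding C_def by auto
        have "a \<otimes> b \<otimes> y = a \<otimes> (b \<otimes> y)" using e(1-3) by (simp add: m_assoc)
        also have "\<dots> = (a \<otimes> y) \<otimes> b" unfolding e(5) using e(1-3) by (simp add: m_assoc)
        also have "\<dots> = y \<otimes> (a \<otimes> b)" unfolding e(4) using e(1-3) by (simp add: m_assoc)
        finally show ?thesis .
      qed
      then show ?thesis using ab unfolding C_def by simp
    qed
  qed
  moreover have "derived_set G (carrier G) \<subseteq> C"
  proof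
    fix c assume "c \<in> derived_set G (carrier G)"
    then obtain g h where g: "g \<in> carrier G" and h: "h \<in> carrier G" and c: "c = g \<otimes> h \<otimes> inv g \<otimes> inv h"
      by blast
    obtain a :: int where a: "\<And>y. y \<in> A \<Longrightarrow> g \<otimes> y \<otimes> inv g = y [^] a" using conj[OF g] by blast
    obtain b :: int where b: "\<And>y. y \<in> A \<Longrightarrow> h \<otimes> y \<otimes> inv h = y [^] b" using conj[OF h] by blast
    have cc: "c \<in> carrier G" unfolding c using g h by simp
    have "c \<otimes> y = y \<otimes> c" if y: "y \<in> A" for y
    proof -
      have yc: "y \<in> carrier G" by (rule Ac[OF y])
      \<comment> \<open>The conjugates of \<open>y'\<close> by \<open>h \<otimes> g\<close> and by \<open>g \<otimes> h\<close> coincide, and the former is \<open>y\<close>.\<close>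
      define y' where "y' = inv (h \<otimes> g) \<otimes> y \<otimes> (h \<otimes> g)"
      have y': "y' \<in> A" unfolding y'_def using A.inv_op_closed1[of "h \<otimes> g" y] g h y by simp
      have y'c: "y' \<in> carrier G" by (rule Ac[OF y'])
      have pA: "y' [^] k \<in> A" for k :: int by (rule subgroup_int_pow_closed[OF A.subgroup_axioms y'])
      have 1: "g \<otimes> (h \<otimes> y' \<otimes> inv h) \<otimes> inv g = y' [^] (b * a)"
        unfolding b[OF y'] a[OF pA] using y'c by (simp add: int_pow_pow)
      have 2: "h \<otimes> (g \<otimes> y' \<otimes> inv g) \<otimes> inv h = y' [^] (b * a)"
        unfolding a[OF y'] b[OF pA] using y'c by (simp add: int_pow_pow mult.commute)
      have 3: "h \<otimes> (g \<otimes> y' \<otimes> inv g) \<otimes> inv h = y"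
        unfolding y'_def using g h yc by (simp add: m_assoc inv_mult_group inv_mult_cancel)
      have "c \<otimes> y \<otimes> inv c = g \<otimes> (h \<otimes> y' \<otimes> inv h) \<otimes> inv g"
        unfolding y'_def c using g h yc by (simp add: m_assoc inv_mult_group inv_mult_cancel)
      also have "\<dots> = y" using 1 2 3 by simp
      finally have "c \<otimes> y \<otimes> inv c \<otimes> c = y \<otimes> c" by simp
      then show ?thesis using cc yc by (simp add: m_assoc)
    qed
    then show "c \<in> C" unfolding C_def using cc by blast
  qed
  ultimately have "derived G (carrier G) \<subseteq> C" unfolding derived_def by (intro generate_subgroup_incl)
  then show ?thesis using c y unfolding C_def by blast
qed

text \<open>A normal series with cyclic factors becomes a central series when it is intersected with the
  derived subgroup, which centralises each factor.\<close>

lemma (in group) supersolvable_imp_derived_nilpotent: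
  assumes "supersolvable_group G"
  shows "nilpotent_group (G\<lparr>carrier := derived G (carrier G)\<rparr>)"
proof -
  define D where "D = derived G (carrier G)"
  have D: "subgroup D G" unfolding D_def by (rule normal_imp_subgroup[OF derived_self_is_normal])
  note Dc = subgroup.mem_carrier[OF D]
  interpret GD: group "G\<lparr>carrier := D\<rparr>" by (rule subgroup_imp_group[OF D])
  obtain n S where NS: "normal_series G n S" and cyc: "\<And>i. i < n \<Longrightarrow> cyclic_group (G\<lparr>carrier := S (Suc i)\<rparr> Mod S i)"
    using assms unfolding supersolvable_group_def by blast
  then have N: "S 0 = {\<one>}" "S n = carrier G" "\<And>i. i \<le> n \<Longrightarrow> S i \<lhd> G" "\<And>i. i < n \<Longrightarrow> S i \<subseteq> S (Suc i)"
    unfolding normal_series_def by blast+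
  have "central_series (G\<lparr>carrier := D\<rparr>) n (\<lambda>i. S i \<inter> D)"
    unfolding central_series_def normal_series_def
  proof (intro conjI allI impI ballI)
    show "S 0 \<inter> D = {\<one>\<^bsub>G\<lparr>carrier := D\<rparr>\<^esub>}" using N(1) subgroup.one_closed[OF D] by auto
    show "S n \<inter> D = carrier (G\<lparr>carrier := D\<rparr>)" using N(2) subgroup.subset[OF D] by auto
    show "S i \<inter> D \<lhd> G\<lparr>carrier := D\<rparr>" if "i \<le> n" for i by (rule normal_Int_subgroup[OF D N(3)[OF that]])
    show "S i \<inter> D \<subseteq> S (Suc i) \<inter> D" if "i < n" for i using N(4)[OF that] by blast
    fix i x g assume i: "i < n" and x: "x \<in> S (Suc i) \<inter> D" and g: "g \<in> carrier (G\<lparr>carrier := D\<rparr>)"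
    have xS: "x \<in> S (Suc i)" and gx: "g \<in> D" "x \<in> D" using g x by auto
    note gc = Dc[OF gx(1)] and xc = Dc[OF gx(2)]
    interpret S: normal "S i" G using N(3) i by simp
    interpret S': normal "S (Suc i)" G using N(3) i by simp
    interpret q: group_hom G "G Mod S i" "\<lambda>x. S i #> x" by (rule S.quotient_hom)
    let ?f = "\<lambda>x. S i #> x"
    let ?A = "?f ` S (Suc i)"
    have surj: "?f ` carrier G = carrier (G Mod S i)" by (simp add: carrier_FactGroup)
    have A: "?A \<lhd> G Mod S i" by (rule S'.surj_hom_normal_subgroup[OF S.quotient_hom surj])
    have As: "subgroup ?A (G Mod S i)" by (rule normal_imp_subgroup[OF A])
    have eq: "G\<lparr>carrier := S (Suc i)\<rparr> Mod S i = (G Mod S i)\<lparr>carrier := ?A\<rparr>"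
    proof -
      have "set_mult (G\<lparr>carrier := S (Suc i)\<rparr>) = set_mult G" by (intro ext) simp
      then show ?thesis unfolding FactGroup_def RCOSETS_def by auto
    qed
    interpret QA: group "(G Mod S i)\<lparr>carrier := ?A\<rparr>" by (rule q.H.subgroup_imp_group[OF As])
    have cA: "carrier ((G Mod S i)\<lparr>carrier := ?A\<rparr>) = ?A" by simp
    obtain s where s: "s \<in> ?A" "?A = range (\<lambda>k::int. s [^]\<^bsub>(G Mod S i)\<lparr>carrier := ?A\<rparr>\<^esub> k)"
      using cyc[OF i, unfolded eq QA.cyclic_group cA] by (elim bexE)
    have gen: "?A \<subseteq> range (\<lambda>k::int. s [^]\<^bsub>G Mod S i\<^esub> k)"
    proof
      fix u assume "u \<in> ?A"
      then have "u \<in> range (\<lambda>k::int. s [^]\<^bsub>(G Mod S i)\<lparr>carrier := ?A\<rparr>\<^esub> k)" by (rule equalityD1[OF s(2), THEN subsetD])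
      then show "u \<in> range (\<lambda>k::int. s [^]\<^bsub>G Mod S i\<^esub> k)"
        using q.H.int_pow_consistent[OF As s(1)] by auto
    qed
    have "?f g \<in> ?f ` derived G (carrier G)" using gx(1) unfolding D_def by blast
    then have fg: "?f g \<in> derived (G Mod S i) (carrier (G Mod S i))"
      using q.derived_img[OF subset_refl] surj by simp
    have "?f g \<otimes>\<^bsub>G Mod S i\<^esub> ?f x = ?f x \<otimes>\<^bsub>G Mod S i\<^esub> ?f g"
      by (rule q.H.derived_centralizes_cyclic_normal[OF A s(1) gen fg imageI[OF xS]])
    then have "?f (x \<otimes> g) = ?f (g \<otimes> x)" using q.hom_mult[OF xc gc] q.hom_mult[OF gc xc] by (simp only:)
    then have "x \<otimes> g \<otimes> inv (g \<otimes> x) \<in> S i"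
      using S.quotient_eq_iff_right[OF m_closed[OF xc gc] m_closed[OF gc xc]] by simp
    moreover have "x \<otimes> g \<otimes> inv (g \<otimes> x) \<in> D"
      by (intro subgroup.m_closed[OF D] subgroup.m_inv_closed[OF D] gx)
    moreover have "inv\<^bsub>G\<lparr>carrier := D\<rparr>\<^esub> (g \<otimes> x) = inv (g \<otimes> x)"
      by (rule m_inv_consistent[OF D subgroup.m_closed[OF D gx]])
    ultimately show "x \<otimes>\<^bsub>G\<lparr>carrier := D\<rparr>\<^esub> g \<otimes>\<^bsub>G\<lparr>carrier := D\<rparr>\<^esub> inv\<^bsub>G\<lparr>carrier := D\<rparr>\<^esub> (g \<otimes>\<^bsub>G\<lparr>carrier := D\<rparr>\<^esub> x) \<in> S i \<inter> D"
      by simp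
  qed
  then show ?thesis
    unfolding D_def[symmetric] by (intro iffD2[OF GD.nilpotent_iff_central_series] exI)
qed

section \<open>Profinite groups\<close>

lemma compact_directed_Inter_nonempty:
  assumes comp: "compact_space X" and ne: "I \<noteq> {}"
    and cl: "\<And>i. i \<in> I \<Longrightarrow> closedin X (A i)" and An: "\<And>i. i \<in> I \<Longrightarrow> A i \<noteq> {}"
    and dir: "\<And>i j. i \<in> I \<Longrightarrow> j \<in> I \<Longrightarrow> \<exists>k\<in>I. A k \<subseteq> A i \<inter> A j"
  shows "(\<Inter>i\<in>I. A i) \<noteq> {}"
proof -
  have fin: "\<exists>k\<in>I. A k \<subseteq> \<Inter> (A ` F)" if "finite F" "F \<subseteq> I" for F
    using that
  proof (induction F rule: finite_induct)
    case empty
    then show ?case using ne by auto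
  next
    case (insert i F)
    then obtain k where k: "k \<in> I" "A k \<subseteq> \<Inter> (A ` F)" by auto
    obtain l where "l \<in> I" "A l \<subseteq> A i \<inter> A k" using dir[of i k] insert k(1) by auto
    then show ?case using k(2) by (intro bexI[of _ l]) auto
  qed
  have "(\<forall>C\<in>A ` I. closedin X C) \<and> (\<forall>\<F>. finite \<F> \<and> \<F> \<subseteq> A ` I \<longrightarrow> \<Inter> \<F> \<noteq> {})"
  proof (intro conjI allI impI ballI)
    show "closedin X C" if "C \<in> A ` I" for C using that cl by blast
    fix \<F> assume "finite \<F> \<and> \<F> \<subseteq> A ` I"
    then obtain F where F: "finite F" "F \<subseteq> I" "\<F> = A ` F" using finite_subset_image by metis
    obtain k where "k \<in> I" "A k \<subseteq> \<Inter> (A ` F)" using fin[OF F(1,2)] by blast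
    then show "\<Inter> \<F> \<noteq> {}" using An[of k] F(3) by blast
  qed
  then show ?thesis using comp unfolding compact_space_fip by blast
qed

lemma continuous_map_discreteI:
  assumes "f \<in> topspace X \<rightarrow> D" "\<And>d. d \<in> D \<Longrightarrow> openin X {x \<in> topspace X. f x = d}"
  shows "continuous_map X (discrete_topology D) f"
proof -
  have "openin X {x \<in> topspace X. f x \<in> U}" if "U \<subseteq> D" for U
  proof -
    have "{x \<in> topspace X. f x \<in> U} = \<Union> ((\<lambda>d. {x \<in> topspace X. f x = d}) ` U)" by auto
    then show ?thesis using assms(2) that by (auto intro!: openin_Union)
  qed
  then show ?thesis using assms(1) by (simp add: continuous_map_def)
qed

text \<open>Profiniteness without a chosen inverse system: a compact Hausdorff group in which the open normal
  subgroups form a neighbourhood base of the identity.\<close>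

locale profinite_group = group G for G (structure) +
  fixes T :: "'a topology"
  assumes topspace_eq: "topspace T = carrier G"
    and continuous_mult: "continuous_map (prod_topology T T) T (\<lambda>(x, y). x \<otimes> y)"
    and continuous_inv: "continuous_map T T (\<lambda>x. inv x)"
    and compact: "compact_space T"
    and Hausdorff: "Hausdorff_space T"
    and open_normal_base: "openin T V \<Longrightarrow> \<one> \<in> V \<Longrightarrow> \<exists>U. U \<lhd> G \<and> openin T U \<and> U \<subseteq> V"
begin

lemma continuous_map_mult:
  assumes "continuous_map X T f" "continuous_map X T g"
  shows "continuous_map X T (\<lambda>x. f x \<otimes> g x)"
proof -
  have "continuous_map X T ((\<lambda>(x, y). x \<otimes> y) \<circ> (\<lambda>x. (f x, g x)))"
    by (rule continuous_map_compose[OF continuous_map_pairedI[OF assms] continuous_mult])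
  then show ?thesis by (simp add: o_def)
qed

lemma continuous_map_invert: "continuous_map X T f \<Longrightarrow> continuous_map X T (\<lambda>x. inv (f x))"
  using continuous_map_compose[of X T f T "\<lambda>x. inv x"] continuous_inv by (simp add: o_def)

lemma continuous_map_constant: "c \<in> carrier G \<Longrightarrow> continuous_map X T (\<lambda>x. c)"
  by (simp add: topspace_eq)

lemma rcoset_eq_preimage:
  assumes "A \<subseteq> carrier G" "g \<in> carrier G"
  shows "A #> g = {x \<in> topspace T. x \<otimes> inv g \<in> A}"
proof
  show "A #> g \<subseteq> {x \<in> topspace T. x \<otimes> inv g \<in> A}"
    using assms by (auto simp: r_coset_def topspace_eq m_assoc subset_iff)
  show "{x \<in> topspace T. x \<otimes> inv g \<in> A} \<subseteq> A #> g"
  proof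
    fix x assume x: "x \<in> {x \<in> topspace T. x \<otimes> inv g \<in> A}"
    then have "x = (x \<otimes> inv g) \<otimes> g" using assms by (simp add: topspace_eq m_assoc)
    then show "x \<in> A #> g" using x unfolding r_coset_def by blast
  qed
qed

lemma open_rcoset:
  assumes "openin T A" "g \<in> carrier G"
  shows "openin T (A #> g)"
proof -
  have sub: "A \<subseteq> carrier G" using openin_subset[OF assms(1)] by (simp add: topspace_eq)
  show ?thesis
    unfolding rcoset_eq_preimage[OF sub assms(2)]
    by (intro openin_continuous_map_preimage[OF _ assms(1)] continuous_map_mult continuous_map_id[unfolded id_def]
        continuous_map_constant inv_closed assms(2))
qed

lemma closed_rcoset:
  assumes "closedin T A" "g \<in> carrier G"
  shows "closedin T (A #> g)"
proof -
  have sub: "A \<subseteq> carrier G" using closedin_subset[OF assms(1)] by (simp add: topspace_eq)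
  show ?thesis
    unfolding rcoset_eq_preimage[OF sub assms(2)]
    by (intro closedin_continuous_map_preimage[OF _ assms(1)] continuous_map_mult continuous_map_id[unfolded id_def]
        continuous_map_constant inv_closed assms(2))
qed

lemma open_subgroup_finite_index:
  assumes U: "subgroup U G" "openin T U"
  shows "finite (rcosets U)"
proof -
  have cov: "carrier G \<subseteq> \<Union> (rcosets U)" using rcosets_part_G[OF U(1)] by simp
  have op: "openin T C" if "C \<in> rcosets U" for C
  proof -
    from that obtain x where "x \<in> carrier G" "C = U #> x" unfolding RCOSETS_def by blast
    then show ?thesis using open_rcoset[OF U(2)] by simp
  qed
  have "compactin T (carrier G)" using compact unfolding compact_space_def topspace_eq .
  then obtain \<F> where F: "finite \<F>" "\<F> \<subseteq> rcosets U" "carrier G \<subseteq> \<Union> \<F>"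
    using compactinD[OF _ op cov] by blast
  have "rcosets U \<subseteq> \<F>"
  proof
    fix C assume C: "C \<in> rcosets U"
    then obtain x where x: "x \<in> carrier G" "C = U #> x" unfolding RCOSETS_def by blast
    have xC: "x \<in> C" using rcos_self[OF x(1) U(1)] x(2) by simp
    obtain D where D: "D \<in> \<F>" "x \<in> D" using F(3) x(1) by blast
    then have "\<not> disjnt C D" unfolding disjnt_def using xC by blast
    then have "C = D" using pairwiseD[OF rcos_disjoint[OF U(1)] C subsetD[OF F(2)]] D(1) by blast
    then show "C \<in> \<F>" using D by simp
  qed
  then show ?thesis using F(1) finite_subset by blast
qed

lemma complement_subgroup_eq:
  assumes "subgroup U G"
  shows "carrier G - U = \<Union> (rcosets U - {U})"
proof
  show "carrier G - U \<subseteq> \<Union> (rcosets U - {U})"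
  proof
    fix x assume x: "x \<in> carrier G - U"
    have "x \<in> U #> x" using rcos_self[OF _ assms] x by simp
    moreover have "U #> x \<noteq> U" using x calculation by auto
    moreover have "U #> x \<in> rcosets U" using x rcosetsI[OF subgroup.subset[OF assms]] by simp
    ultimately show "x \<in> \<Union> (rcosets U - {U})" by blast
  qed
  show "\<Union> (rcosets U - {U}) \<subseteq> carrier G - U"
  proof
    fix x assume "x \<in> \<Union> (rcosets U - {U})"
    then obtain C where C: "C \<in> rcosets U" "C \<noteq> U" "x \<in> C" by blast
    have "disjnt C U"
      using pairwiseD[OF rcos_disjoint[OF assms] C(1) subgroup.subgroup_in_rcosets[OF assms is_group] C(2)] .
    moreover have "x \<in> carrier G" using rcosets_part_G[OF assms] C(1,3) by blast
    ultimately show "x \<in> carrier G - U" using C(3) unfolding disjnt_def by blast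
  qed
qed

lemma open_subgroup_closed:
  assumes "subgroup U G" "openin T U"
  shows "closedin T U"
proof -
  have "openin T C" if "C \<in> rcosets U - {U}" for C
  proof -
    from that obtain x where "x \<in> carrier G" "C = U #> x" unfolding RCOSETS_def by blast
    then show ?thesis using open_rcoset[OF assms(2)] by simp
  qed
  then have "openin T (carrier G - U)"
    unfolding complement_subgroup_eq[OF assms(1)] by (rule openin_Union)
  then show ?thesis
    unfolding closedin_def topspace_eq using subgroup.subset[OF assms(1)] by simp
qed

text \<open>The complement of \<open>U\<close> is a finite union of closed cosets.\<close>

lemma closed_finite_index_open:
  assumes "subgroup U G" "closedin T U" "finite (rcosets U)"
  shows "openin T U"
proof -
  have "closedin T C" if "C \<in> rcosets U - {U}" for C
  proof -
    from that obtain x where "x \<in> carrier G" "C = U #> x" unfolding RCOSETS_def by blast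
    then show ?thesis using closed_rcoset[OF assms(2)] by simp
  qed
  then have "closedin T (carrier G - U)"
    unfolding complement_subgroup_eq[OF assms(1)] using assms(3) by (intro closedin_Union) auto
  then have "openin T (carrier G - (carrier G - U))" unfolding closedin_def topspace_eq by blast
  moreover have "carrier G - (carrier G - U) = U" using subgroup.subset[OF assms(1)] by blast
  ultimately show ?thesis by simp
qed

lemma open_set_mult:
  assumes "openin T U" "B \<subseteq> carrier G"
  shows "openin T (U <#> B)"
proof -
  have "U <#> B = (\<Union>b\<in>B. U #> b)" unfolding set_mult_def r_coset_def by blast
  moreover have "openin T (U #> b)" if "b \<in> B" for b using open_rcoset[OF assms(1)] assms(2) that by blast
  ultimately show ?thesis by auto
qed

lemma closed_set_mult:
  assumes "closedin T A" "closedin T B"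
  shows "closedin T (A <#> B)"
proof -
  have "compactin (prod_topology T T) (A \<times> B)"
    unfolding compactin_Times using closedin_compact_space[OF compact] assms by blast
  then have "compactin T ((\<lambda>(x, y). x \<otimes> y) ` (A \<times> B))"
    by (rule image_compactin[OF _ continuous_mult])
  moreover have "(\<lambda>(x, y). x \<otimes> y) ` (A \<times> B) = A <#> B" by (auto simp: set_mult_def)
  ultimately show ?thesis using compactin_imp_closedin[OF Hausdorff] by simp
qed

text \<open>If \<open>x \<notin> H\<close>, continuity of \<open>u \<mapsto> x \<otimes> u\<close> at \<open>\<one>\<close> yields an open normal subgroup \<open>U\<close> with \<open>x U\<close> disjoint
  from \<open>H\<close>.\<close>

lemma mem_closed_of_open_normal:
  assumes H: "closedin T H" and x: "x \<in> carrier G"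
    and mem: "\<And>U. U \<lhd> G \<Longrightarrow> openin T U \<Longrightarrow> x \<in> H <#> U"
  shows "x \<in> H"
proof (rule ccontr)
  assume xH: "x \<notin> H"
  define V where "V = {u \<in> topspace T. x \<otimes> u \<in> topspace T - H}"
  have "openin T V"
    unfolding V_def by (intro openin_continuous_map_preimage[of T T] continuous_map_mult continuous_map_constant x
        continuous_map_id[unfolded id_def] openin_diff openin_topspace H)
  moreover have "\<one> \<in> V" unfolding V_def using x xH by (simp add: topspace_eq)
  ultimately obtain U where U: "U \<lhd> G" "openin T U" "U \<subseteq> V" using open_normal_base by blast
  note Us = normal_imp_subgroup[OF U(1)]
  from mem[OF U(1,2)] obtain h u where hu: "h \<in> H" "u \<in> U" "x = h \<otimes> u" by (rule set_multE)
  have uc: "u \<in> carrier G" by (rule subgroup.mem_carrier[OF Us hu(2)])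
  have hc: "h \<in> carrier G" using closedin_subset[OF H] hu(1) by (auto simp: topspace_eq)
  have "inv u \<in> V" using subgroup.m_inv_closed[OF Us hu(2)] U(3) by blast
  then have "x \<otimes> inv u \<notin> H" unfolding V_def by blast
  moreover have "x \<otimes> inv u = h" unfolding hu(3) using hc uc by (simp add: m_assoc)
  ultimately show False using hu(1) by simp
qed

lemma open_normal_separate:
  assumes "x \<in> carrier G" "\<And>U. U \<lhd> G \<Longrightarrow> openin T U \<Longrightarrow> x \<in> U"
  shows "x = \<one>"
proof -
  have "closedin T {\<one>}" by (rule closedin_Hausdorff_singleton[OF Hausdorff]) (simp add: topspace_eq)
  then have "x \<in> {\<one>}"
  proof (rule mem_closed_of_open_normal[OF _ assms(1)])
    fix U assume "U \<lhd> G" "openin T U"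
    then have "\<one> \<otimes> x \<in> {\<one>} <#> U" using assms(2) by (intro set_multI) auto
    then show "x \<in> {\<one>} <#> U" using assms(1) by simp
  qed
  then show ?thesis by simp
qed

lemma finite_open_quotient: "U \<lhd> G \<Longrightarrow> openin T U \<Longrightarrow> finite (carrier (G Mod U))"
  unfolding FactGroup_def using open_subgroup_finite_index[OF normal_imp_subgroup, of U] by simp

lemma open_normal_Int:
  assumes "U \<lhd> G" "openin T U" "V \<lhd> G" "openin T V"
  shows "U \<inter> V \<lhd> G" "openin T (U \<inter> V)"
proof -
  show "openin T (U \<inter> V)" by (rule openin_Int[OF assms(2,4)])
  show "U \<inter> V \<lhd> G"
  proof (rule normal_invI[OF subgroups_Inter_pair[OF normal_imp_subgroup[OF assms(1)] normal_imp_subgroup[OF assms(3)]]])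
    fix g x assume g: "g \<in> carrier G" and x: "x \<in> U \<inter> V"
    show "g \<otimes> x \<otimes> inv g \<in> U \<inter> V"
      using normal.inv_op_closed2[OF assms(1) g, of x] normal.inv_op_closed2[OF assms(3) g, of x] x by blast
  qed
qed

lemma profinite_subgroup:
  assumes "closed_subgroup G T J"
  shows "profinite_group (G\<lparr>carrier := J\<rparr>) (subtopology T J)"
proof -
  have J: "subgroup J G" "closedin T J" using assms by (auto simp: closed_subgroup_def)
  note Jsub = subgroup.subset[OF J(1)]
  show ?thesis
  proof (intro profinite_group.intro profinite_group_axioms.intro)
    show "group (G\<lparr>carrier := J\<rparr>)" by (rule subgroup_imp_group[OF J(1)])
    show ts: "topspace (subtopology T J) = carrier (G\<lparr>carrier := J\<rparr>)"
      using Jsub by (auto simp: topspace_eq)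
    have "continuous_map (subtopology (prod_topology T T) (J \<times> J)) (subtopology T J) (\<lambda>(x, y). x \<otimes> y)"
      by (intro continuous_map_into_subtopology continuous_map_from_subtopology continuous_mult)
        (auto intro: subgroup.m_closed[OF J(1)])
    then show "continuous_map (prod_topology (subtopology T J) (subtopology T J)) (subtopology T J)
        (\<lambda>(x, y). x \<otimes>\<^bsub>G\<lparr>carrier := J\<rparr>\<^esub> y)"
      by (simp add: subtopology_Times)
    have "continuous_map (subtopology T J) (subtopology T J) (\<lambda>x. inv x)"
      by (intro continuous_map_into_subtopology continuous_map_from_subtopology continuous_inv)
        (auto intro: subgroup.m_inv_closed[OF J(1)])
    then show "continuous_map (subtopology T J) (subtopology T J) (\<lambda>x. inv\<^bsub>G\<lparr>carrier := J\<rparr>\<^esub> x)"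
      by (rule continuous_map_eq) (use m_inv_consistent[OF J(1)] in auto)
    show "compact_space (subtopology T J)"
      by (rule compact_space_subtopology[OF closedin_compact_space[OF compact J(2)]])
    show "Hausdorff_space (subtopology T J)" by (rule Hausdorff_space_subtopology[OF Hausdorff])
    fix V assume V: "openin (subtopology T J) V" "\<one>\<^bsub>G\<lparr>carrier := J\<rparr>\<^esub> \<in> V"
    then obtain V' where V': "openin T V'" "V = V' \<inter> J" by (auto simp: openin_subtopology)
    then obtain U where U: "U \<lhd> G" "openin T U" "U \<subseteq> V'" using open_normal_base[of V'] V(2) by auto
    have "U \<inter> J \<lhd> G\<lparr>carrier := J\<rparr>" by (rule normal_Int_subgroup[OF J(1) U(1)])
    moreover have "openin (subtopology T J) (U \<inter> J)" using U(2) by (auto simp: openin_subtopology)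
    ultimately show "\<exists>U. U \<lhd> G\<lparr>carrier := J\<rparr> \<and> openin (subtopology T J) U \<and> U \<subseteq> V"
      using U(3) V'(2) by blast
  qed
qed

lemma continuous_map_quotient:
  assumes U: "U \<lhd> G" "openin T U"
  shows "continuous_map T (discrete_topology (carrier (G Mod U))) (\<lambda>x. U #> x)"
proof (rule continuous_map_discreteI)
  note Us = normal_imp_subgroup[OF U(1)]
  show "(\<lambda>x. U #> x) \<in> topspace T \<rightarrow> carrier (G Mod U)" unfolding carrier_FactGroup topspace_eq by blast
  fix d assume "d \<in> carrier (G Mod U)"
  then obtain g where g: "g \<in> carrier G" "d = U #> g" unfolding carrier_FactGroup by blast
  have "{x \<in> topspace T. U #> x = d} = U #> g"
  proof
    show "{x \<in> topspace T. U #> x = d} \<subseteq> U #> g"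
      using rcos_self[OF _ Us] g(2) by (auto simp: topspace_eq)
    show "U #> g \<subseteq> {x \<in> topspace T. U #> x = d}"
      using repr_independence[OF _ g(1) Us] r_coset_subset_G[OF subgroup.subset[OF Us] g(1)] g(2)
      by (auto simp: topspace_eq)
  qed
  then show "openin T {x \<in> topspace T. U #> x = d}" using open_rcoset[OF U(2) g(1)] by simp
qed

lemma closed_quotient_preimage:
  assumes "U \<lhd> G" "openin T U" "R \<subseteq> carrier (G Mod U)"
  shows "closedin T {x \<in> topspace T. U #> x \<in> R}"
  by (rule closedin_continuous_map_preimage[OF continuous_map_quotient[OF assms(1,2)]]) (simp add: assms(3))

end

section \<open>Inverse limits\<close>

text \<open>A neighbourhood of the identity in an inverse limit restricts finitely many coordinates. Since the
  index set is directed, all of these are determined by a single coordinate, and the kernel of the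
  projection to it lies in the neighbourhood.\<close>

lemma pro_cases:
  assumes "pro C G T"
  shows "profinite_group G T"
    and "\<And>U. openin T U \<Longrightarrow> \<one>\<^bsub>G\<^esub> \<in> U \<Longrightarrow>
      \<exists>\<Gamma> h. group_hom G \<Gamma> h \<and> finite (carrier \<Gamma>) \<and> C \<Gamma> \<and> kernel G \<Gamma> h \<subseteq> U \<and> openin T (kernel G \<Gamma> h)"
proof -
  obtain I r and \<Gamma> :: "'a set \<Rightarrow> 'a set monoid" and \<phi> f where top: "topological_group G T"
    and inv: "inverse_system I r \<Gamma> \<phi>" and fin: "\<forall>i\<in>I. finite (carrier (\<Gamma> i)) \<and> C (\<Gamma> i)"
    and iso: "f \<in> iso G (inverse_limit I r \<Gamma> \<phi>)"
    and homeo: "homeomorphic_map T (inverse_limit_topology I r \<Gamma> \<phi>) f"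
    using assms unfolding pro_def by blast
  have grp: "group G" and ts: "topspace T = carrier G" using top by (auto simp: topological_group_def)
  interpret G: group G by (rule grp)
  define L where "L = inverse_limit I r \<Gamma> \<phi>"
  define P where "P = product_topology (\<lambda>i. discrete_topology (carrier (\<Gamma> i))) I"
  define TL where "TL = inverse_limit_topology I r \<Gamma> \<phi>"
  have TL: "TL = subtopology P (carrier L)" unfolding TL_def P_def L_def inverse_limit_topology_def by simp
  note inv' = inv[unfolded inverse_system_def]
  note Ine = inv'[THEN conjunct1] and po = inv'[THEN conjunct2, THEN conjunct1]
    and dir' = inv'[THEN conjunct2, THEN conjunct2, THEN conjunct1]
    and \<Gamma>grp' = inv'[THEN conjunct2, THEN conjunct2, THEN conjunct2, THEN conjunct1]
    and \<phi>hom' = inv'[THEN conjunct2, THEN conjunct2, THEN conjunct2, THEN conjunct2, THEN conjunct1]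
  have dir: "\<exists>k\<in>I. (i, k) \<in> r \<and> (j, k) \<in> r" if "i \<in> I" "j \<in> I" for i j using dir' that by simp
  have \<Gamma>grp: "group (\<Gamma> i)" if "i \<in> I" for i using \<Gamma>grp' that by simp
  have \<phi>hom: "\<phi> i j \<in> hom (\<Gamma> j) (\<Gamma> i)" if "(i, j) \<in> r" for i j using \<phi>hom' that by simp
  have rI: "i \<in> I" "j \<in> I" if "(i, j) \<in> r" for i j
    using po that unfolding partial_order_on_def preorder_on_def by blast+
  have rrefl: "(i, i) \<in> r" if "i \<in> I" for i
    using po that unfolding partial_order_on_def preorder_on_def refl_on_def by blast
  have rtrans: "(i, k) \<in> r" if "(i, j) \<in> r" "(j, k) \<in> r" for i j k
    using po that unfolding partial_order_on_def preorder_on_def trans_def by blast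
  have cL: "carrier L = {x \<in> (\<Pi>\<^sub>E i\<in>I. carrier (\<Gamma> i)). \<forall>i j. (i, j) \<in> r \<longrightarrow> \<phi> i j (x j) = x i}"
    unfolding L_def inverse_limit_def by simp
  have tsP: "topspace P = (\<Pi>\<^sub>E i\<in>I. carrier (\<Gamma> i))" unfolding P_def by simp
  have proj: "continuous_map P (discrete_topology (carrier (\<Gamma> i))) (\<lambda>x. x i)" if "i \<in> I" for i
    unfolding P_def by (rule continuous_map_product_projection[OF that])
  have clL: "closedin P (carrier L)"
  proof -
    have "closedin P {x \<in> topspace P. \<phi> i j (x j) = x i}" if ij: "(i, j) \<in> r" for i j
    proof (rule closedin_continuous_maps_eq[OF Hausdorff_space_discrete_topology _ proj[OF rI(1)[OF ij]]])
      have "continuous_map (discrete_topology (carrier (\<Gamma> j))) (discrete_topology (carrier (\<Gamma> i))) (\<phi> i j)"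
        using \<phi>hom[OF ij] by (auto simp: continuous_map_from_discrete_topology hom_def)
      from continuous_map_compose[OF proj[OF rI(2)[OF ij]] this]
      show "continuous_map P (discrete_topology (carrier (\<Gamma> i))) (\<lambda>x. \<phi> i j (x j))" by (simp add: o_def)
    qed
    moreover have "r \<noteq> {}" using Ine rrefl by blast
    ultimately have "closedin P (\<Inter>(i, j)\<in>r. {x \<in> topspace P. \<phi> i j (x j) = x i})"
      by (intro closedin_INT) auto
    moreover have "(\<Inter>(i, j)\<in>r. {x \<in> topspace P. \<phi> i j (x j) = x i}) = carrier L"
      unfolding cL tsP using \<open>r \<noteq> {}\<close> by auto
    ultimately show ?thesis by simp
  qed
  have "compact_space P" unfolding P_def using fin by (simp add: compact_space_product_topology compact_space_discrete_topology)
  then have "compact_space TL" unfolding TL by (intro compact_space_subtopology closedin_compact_space clL)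
  then have comp: "compact_space T"
    using homeomorphic_compact_space[OF homeomorphic_map_imp_homeomorphic_space[OF homeo]] TL_def by simp
  have "Hausdorff_space TL" unfolding TL P_def
    by (intro Hausdorff_space_subtopology) (simp add: Hausdorff_space_product_topology)
  then have Hau: "Hausdorff_space T"
    using homeomorphic_Hausdorff_space[OF homeomorphic_map_imp_homeomorphic_space[OF homeo]] TL_def by simp
  have fhom: "f \<in> hom G L" and fbij: "bij_betw f (carrier G) (carrier L)"
    using iso unfolding L_def iso_def by auto
  have fL: "f x \<in> carrier L" if "x \<in> carrier G" for x using fhom that by (auto simp: hom_def)
  have fmult: "f (x \<otimes>\<^bsub>G\<^esub> y) i = f x i \<otimes>\<^bsub>\<Gamma> i\<^esub> f y i" if "x \<in> carrier G" "y \<in> carrier G" "i \<in> I" for x y i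
    using hom_mult[OF fhom that(1,2)] that(3) unfolding L_def inverse_limit_def by (simp add: product_group_def)
  have fcomp: "f x i \<in> carrier (\<Gamma> i)" if "x \<in> carrier G" "i \<in> I" for x i
    using fL[OF that(1)] that(2) unfolding cL by auto
  have hi: "group_hom G (\<Gamma> i) (\<lambda>x. f x i)" if "i \<in> I" for i
    by (intro group_hom.intro group_hom_axioms.intro grp \<Gamma>grp that homI) (use fmult fcomp that in auto)
  have ker_open: "openin T (kernel G (\<Gamma> i) (\<lambda>x. f x i))" if i: "i \<in> I" for i
  proof -
    have "continuous_map T P f"
      using homeomorphic_imp_continuous_map[OF homeo] unfolding TL_def[symmetric] TL continuous_map_in_subtopology by blast
    from continuous_map_compose[OF this proj[OF i]]
    have "continuous_map T (discrete_topology (carrier (\<Gamma> i))) (\<lambda>x. f x i)" by (simp add: o_def)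
    from openin_continuous_map_preimage[OF this, of "{\<one>\<^bsub>\<Gamma> i\<^esub>}"]
    have "openin T {x \<in> topspace T. f x i \<in> {\<one>\<^bsub>\<Gamma> i\<^esub>}}" using group.is_monoid[OF \<Gamma>grp[OF i]] by (simp add: monoid.one_closed)
    then show ?thesis unfolding kernel_def ts by simp
  qed
  have small: "\<exists>i\<in>I. kernel G (\<Gamma> i) (\<lambda>x. f x i) \<subseteq> U" if U: "openin T U" "\<one>\<^bsub>G\<^esub> \<in> U" for U
  proof -
    have Usub: "U \<subseteq> carrier G" using openin_subset[OF U(1)] ts by simp
    have "openin TL (f ` U)" using homeomorphic_map_openness_eq[OF homeo] U(1) TL_def by blast
    then obtain V where V: "openin P V" "f ` U = V \<inter> carrier L" unfolding TL openin_subtopology by blast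
    have "f \<one>\<^bsub>G\<^esub> \<in> V" using V(2) U(2) by blast
    then obtain W where W: "finite {i \<in> I. W i \<noteq> carrier (\<Gamma> i)}" "f \<one>\<^bsub>G\<^esub> \<in> Pi\<^sub>E I W" "Pi\<^sub>E I W \<subseteq> V"
      using V(1) unfolding P_def openin_product_topology_alt by auto
    have bound: "\<exists>k\<in>I. \<forall>i\<in>F. (i, k) \<in> r" if "finite F" "F \<subseteq> I" for F
      using that
    proof (induction F rule: finite_induct)
      case empty
      then show ?case using Ine by auto
    next
      case (insert i F)
      then obtain k where k: "k \<in> I" "\<forall>i\<in>F. (i, k) \<in> r" by auto
      obtain l where l: "l \<in> I" "(i, l) \<in> r" "(k, l) \<in> r" using dir[of i k] insert k by auto
      then show ?case using k rtrans by (intro bexI[of _ l]) auto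
    qed
    obtain k where k: "k \<in> I" "\<forall>i\<in>{i \<in> I. W i \<noteq> carrier (\<Gamma> i)}. (i, k) \<in> r"
      using bound[OF W(1)] by auto
    have "kernel G (\<Gamma> k) (\<lambda>x. f x k) \<subseteq> U"
    proof
      fix x assume "x \<in> kernel G (\<Gamma> k) (\<lambda>x. f x k)"
      then have x: "x \<in> carrier G" "f x k = \<one>\<^bsub>\<Gamma> k\<^esub>" by (auto simp: kernel_def)
      have xL: "f x \<in> carrier L" by (rule fL[OF x(1)])
      have "f x i \<in> W i" if i: "i \<in> I" for i
      proof (cases "W i = carrier (\<Gamma> i)")
        case True
        then show ?thesis using fcomp[OF x(1) i] by simp
      next
        case False
        then have ik: "(i, k) \<in> r" using k(2) i by blast
        have "f x i = \<phi> i k (f x k)" using xL ik unfolding cL by auto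
        also have "\<dots> = \<one>\<^bsub>\<Gamma> i\<^esub>" unfolding x(2) by (rule hom_one[OF \<phi>hom[OF ik] \<Gamma>grp[OF k(1)] \<Gamma>grp[OF i]])
        also have "\<dots> = f \<one>\<^bsub>G\<^esub> i" using group_hom.hom_one[OF hi[OF i]] by simp
        finally show ?thesis using W(2) i by auto
      qed
      moreover have "f x \<in> extensional I" using xL unfolding cL by (simp add: PiE_def)
      ultimately have "f x \<in> Pi\<^sub>E I W" unfolding PiE_iff by blast
      then have "f x \<in> V" by (rule subsetD[OF W(3)])
      then have "f x \<in> f ` U" using V(2) xL by blast
      then obtain y where y: "y \<in> U" "f x = f y" by blast
      have "x = y" using fbij y x(1) Usub unfolding bij_betw_def inj_on_def by blast
      then show "x \<in> U" using y(1) by simp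
    qed
    then show ?thesis using k(1) by blast
  qed
  show "profinite_group G T"
  proof (intro profinite_group.intro profinite_group_axioms.intro grp ts comp Hau)
    show "continuous_map (prod_topology T T) T (\<lambda>(x, y). x \<otimes>\<^bsub>G\<^esub> y)" "continuous_map T T (\<lambda>x. inv\<^bsub>G\<^esub> x)"
      using top unfolding topological_group_def by auto
    show "\<exists>U. U \<lhd> G \<and> openin T U \<and> U \<subseteq> V" if V: "openin T V" "\<one>\<^bsub>G\<^esub> \<in> V" for V
    proof -
      obtain i where i: "i \<in> I" "kernel G (\<Gamma> i) (\<lambda>x. f x i) \<subseteq> V" using small[OF V] by blast
      show ?thesis
        by (intro exI[of _ "kernel G (\<Gamma> i) (\<lambda>x. f x i)"] conjI group_hom.normal_kernel[OF hi[OF i(1)]] ker_open[OF i(1)] i(2))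
    qed
  qed
  show "\<exists>\<Gamma> h. group_hom G \<Gamma> h \<and> finite (carrier \<Gamma>) \<and> C \<Gamma> \<and> kernel G \<Gamma> h \<subseteq> U \<and> openin T (kernel G \<Gamma> h)"
    if U: "openin T U" "\<one>\<^bsub>G\<^esub> \<in> U" for U
  proof -
    obtain i where i: "i \<in> I" "kernel G (\<Gamma> i) (\<lambda>x. f x i) \<subseteq> U" using small[OF U] by blast
    show ?thesis
      by (intro exI[of _ "\<Gamma> i"] exI[of _ "\<lambda>x. f x i"] conjI hi[OF i(1)] ker_open[OF i(1)] i(2)) (use fin i(1) in auto)
  qed
qed

context profinite_group
begin

lemma topological: "topological_group G T"
  unfolding topological_group_def using is_group topspace_eq continuous_mult continuous_inv by simp

text \<open>The inverse system consists of the quotients by the members of \<open>\<U>\<close>, ordered by reverse inclusion. The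
  natural map to its limit is onto because a compatible family of cosets is a directed family of
  nonempty closed sets, and it is a homeomorphism because it goes from a compact to a Hausdorff space.\<close>

lemma pro_of_open_normal_subgroups:
  assumes ne: "\<U> \<noteq> {}"
    and nrm: "\<And>U. U \<in> \<U> \<Longrightarrow> U \<lhd> G" and opn: "\<And>U. U \<in> \<U> \<Longrightarrow> openin T U"
    and C: "\<And>U. U \<in> \<U> \<Longrightarrow> C (G Mod U)"
    and dir: "\<And>U V. U \<in> \<U> \<Longrightarrow> V \<in> \<U> \<Longrightarrow> \<exists>W\<in>\<U>. W \<subseteq> U \<inter> V"
    and sep: "\<Inter>\<U> \<subseteq> {\<one>}"
  shows "pro C G T"
proof -
  define r where "r = {(U, V). U \<in> \<U> \<and> V \<in> \<U> \<and> V \<subseteq> U}"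
  define \<Gamma> where "\<Gamma> U = G Mod U" for U
  define \<phi> where "\<phi> U V X = U <#> X" for U V X :: "'a set"
  define f where "f x = (\<lambda>U\<in>\<U>. U #> x)" for x
  have sub: "subgroup U G" "U \<subseteq> carrier G" if "U \<in> \<U>" for U
    using normal_imp_subgroup[OF nrm[OF that]] subgroup.subset by blast+
  have c\<Gamma>: "carrier (\<Gamma> U) = (\<lambda>x. U #> x) ` carrier G" for U unfolding \<Gamma>_def by (rule carrier_FactGroup)
  have \<phi>: "\<phi> U V (V #> x) = U #> x" if "(U, V) \<in> r" "x \<in> carrier G" for U V x
  proof -
    have UV: "U \<in> \<U>" "V \<in> \<U>" "V \<subseteq> U" using that(1) unfolding r_def by auto
    have "U <#> (V #> x) = (U <#> V) #> x"
      by (rule setmult_rcos_assoc[OF sub(2)[OF UV(1)] sub(2)[OF UV(2)] that(2)])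
    then show ?thesis unfolding \<phi>_def using set_mult_absorb[OF sub(1)[OF UV(1)] sub(1)[OF UV(2)] UV(3)] by simp
  qed
  have rU: "U \<in> \<U>" "V \<in> \<U>" if "(U, V) \<in> r" for U V using that unfolding r_def by auto
  have qm: "(U #> x) <#> (U #> y) = U #> (x \<otimes> y)" if "U \<in> \<U>" "x \<in> carrier G" "y \<in> carrier G" for U x y
    by (rule normal.rcos_sum[OF nrm[OF that(1)] that(2,3)])
  have inv: "inverse_system \<U> r \<Gamma> \<phi>"
    unfolding inverse_system_def
  proof (intro conjI ballI allI impI)
    show "\<U> \<noteq> {}" by (rule ne)
    show "partial_order_on \<U> r"
      unfolding partial_order_on_def preorder_on_def refl_on_def trans_def antisym_def r_def by auto
    show "\<exists>W\<in>\<U>. (U, W) \<in> r \<and> (V, W) \<in> r" if UV: "U \<in> \<U>" "V \<in> \<U>" for U V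
    proof -
      obtain W where "W \<in> \<U>" "W \<subseteq> U \<inter> V" using dir[OF UV] by blast
      then show ?thesis using UV unfolding r_def by (intro bexI[of _ W]) auto
    qed
    show "group (\<Gamma> U)" if "U \<in> \<U>" for U unfolding \<Gamma>_def by (rule normal.factorgroup_is_group[OF nrm[OF that]])
    show "\<phi> U V \<in> hom (\<Gamma> V) (\<Gamma> U)" if UV: "(U, V) \<in> r" for U V
    proof (rule homI)
      show "\<phi> U V X \<in> carrier (\<Gamma> U)" if "X \<in> carrier (\<Gamma> V)" for X
        using that \<phi>[OF UV] unfolding c\<Gamma> by auto
      fix X Y assume "X \<in> carrier (\<Gamma> V)" "Y \<in> carrier (\<Gamma> V)"
      then obtain x y where x: "x \<in> carrier G" "X = V #> x" and y: "y \<in> carrier G" "Y = V #> y"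
        unfolding c\<Gamma> by blast
      have "\<phi> U V (X <#> Y) = U #> (x \<otimes> y)"
        unfolding x(2) y(2) qm[OF rU(2)[OF UV] x(1) y(1)] by (rule \<phi>[OF UV m_closed[OF x(1) y(1)]])
      also have "\<dots> = \<phi> U V X <#> \<phi> U V Y"
        unfolding x(2) y(2) \<phi>[OF UV x(1)] \<phi>[OF UV y(1)] by (rule qm[OF rU(1)[OF UV] x(1) y(1), symmetric])
      finally show "\<phi> U V (X \<otimes>\<^bsub>\<Gamma> V\<^esub> Y) = \<phi> U V X \<otimes>\<^bsub>\<Gamma> U\<^esub> \<phi> U V Y" unfolding \<Gamma>_def by simp
    qed
    show "\<phi> U U X = X" if U: "U \<in> \<U>" and X: "X \<in> carrier (\<Gamma> U)" for U X
    proof -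
      obtain x where "x \<in> carrier G" "X = U #> x" using X unfolding c\<Gamma> by blast
      moreover have "(U, U) \<in> r" using U unfolding r_def by simp
      ultimately show ?thesis using \<phi> by simp
    qed
    show "\<phi> U V (\<phi> V W X) = \<phi> U W X" if UV: "(U, V) \<in> r" and VW: "(V, W) \<in> r" and X: "X \<in> carrier (\<Gamma> W)" for U V W X
    proof -
      obtain x where x: "x \<in> carrier G" "X = W #> x" using X unfolding c\<Gamma> by blast
      have UW: "(U, W) \<in> r" using UV VW unfolding r_def by auto
      show ?thesis unfolding x(2) \<phi>[OF VW x(1)] \<phi>[OF UV x(1)] \<phi>[OF UW x(1)] ..
    qed
  qed
  define L where "L = inverse_limit \<U> r \<Gamma> \<phi>"
  have cL: "carrier L = {z \<in> (\<Pi>\<^sub>E U\<in>\<U>. carrier (\<Gamma> U)). \<forall>U V. (U, V) \<in> r \<longrightarrow> \<phi> U V (z V) = z U}"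
    unfolding L_def inverse_limit_def by simp
  have fU: "f x U = U #> x" if "U \<in> \<U>" for x U using that unfolding f_def by simp
  have fext: "f x \<in> extensional \<U>" for x unfolding f_def by simp
  have fL: "f x \<in> carrier L" if x: "x \<in> carrier G" for x
    unfolding cL
  proof (intro CollectI conjI allI impI)
    show "f x \<in> (\<Pi>\<^sub>E U\<in>\<U>. carrier (\<Gamma> U))" using x fU fext unfolding c\<Gamma> by (auto simp: PiE_iff)
    show "\<phi> U V (f x V) = f x U" if UV: "(U, V) \<in> r" for U V
      unfolding fU[OF rU(1)[OF UV]] fU[OF rU(2)[OF UV]] by (rule \<phi>[OF UV x])
  qed
  have fhom: "f \<in> hom G L"
  proof (rule homI[OF fL])
    fix x y assume xy: "x \<in> carrier G" "y \<in> carrier G"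
    have "f (x \<otimes> y) = (\<lambda>U\<in>\<U>. f x U \<otimes>\<^bsub>\<Gamma> U\<^esub> f y U)"
    proof (rule extensionalityI[OF fext restrict_extensional])
      fix U assume U: "U \<in> \<U>"
      show "f (x \<otimes> y) U = (\<lambda>U\<in>\<U>. f x U \<otimes>\<^bsub>\<Gamma> U\<^esub> f y U) U"
        using U qm[OF U xy] fU[OF U] by (simp add: \<Gamma>_def)
    qed
    then show "f (x \<otimes> y) = f x \<otimes>\<^bsub>L\<^esub> f y" unfolding L_def inverse_limit_def by (simp add: product_group_def)
  qed
  have inj: "inj_on f (carrier G)"
  proof (rule inj_onI)
    fix x y assume x: "x \<in> carrier G" and y: "y \<in> carrier G" and eq: "f x = f y"
    have "inv x \<otimes> y \<in> U" if U: "U \<in> \<U>" for U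
    proof -
      have "U #> x = U #> y" using fun_cong[OF eq, of U] fU[OF U] by simp
      then show ?thesis using normal.quotient_eq_iff[OF nrm[OF U] x y] by simp
    qed
    then have "inv x \<otimes> y = \<one>" using sep by blast
    then have "x \<otimes> (inv x \<otimes> y) = x" using x by simp
    then show "x = y" using x y by (simp add: inv_mult_cancel)
  qed
  have surj: "f ` carrier G = carrier L"
  proof
    show "f ` carrier G \<subseteq> carrier L" using fL by blast
    show "carrier L \<subseteq> f ` carrier G"
    proof
      fix z assume z: "z \<in> carrier L"
      have zc: "z U \<in> carrier (\<Gamma> U)" if "U \<in> \<U>" for U using z that unfolding cL by auto
      have zext: "z \<in> extensional \<U>" using z unfolding cL by (simp add: PiE_def)
      have z\<phi>: "\<phi> U V (z V) = z U" if "(U, V) \<in> r" for U V using z that unfolding cL by blast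
      have "(\<Inter>U\<in>\<U>. z U) \<noteq> {}"
      proof (rule compact_directed_Inter_nonempty[OF compact ne])
        fix U assume U: "U \<in> \<U>"
        obtain x where x: "x \<in> carrier G" "z U = U #> x" using zc[OF U] unfolding c\<Gamma> by blast
        show "closedin T (z U)" unfolding x(2)
          by (rule closed_rcoset[OF open_subgroup_closed[OF sub(1)[OF U] opn[OF U]] x(1)])
        show "z U \<noteq> {}" using rcos_self[OF x(1) sub(1)[OF U]] x(2) by auto
      next
        fix U V assume UV: "U \<in> \<U>" "V \<in> \<U>"
        obtain W where W: "W \<in> \<U>" "W \<subseteq> U \<inter> V" using dir[OF UV] by blast
        obtain x where x: "x \<in> carrier G" "z W = W #> x" using zc[OF W(1)] unfolding c\<Gamma> by blast
        have r1: "(U, W) \<in> r" "(V, W) \<in> r" using UV W unfolding r_def by auto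
        have "z U = U #> x" "z V = V #> x"
          using z\<phi>[OF r1(1)] z\<phi>[OF r1(2)] \<phi>[OF r1(1) x(1)] \<phi>[OF r1(2) x(1)] unfolding x(2) by simp_all
        then show "\<exists>k\<in>\<U>. z k \<subseteq> z U \<inter> z V" using W x(2) by (intro bexI[of _ W]) (auto simp: r_coset_def)
      qed
      then obtain g where g: "\<And>U. U \<in> \<U> \<Longrightarrow> g \<in> z U" by blast
      have gU: "z U = U #> g \<and> g \<in> carrier G" if U: "U \<in> \<U>" for U
      proof -
        obtain x where x: "x \<in> carrier G" "z U = U #> x" using zc[OF U] unfolding c\<Gamma> by blast
        have gx: "g \<in> U #> x" using g[OF U] x(2) by simp
        have "U #> x = U #> g" by (rule repr_independence[OF gx x(1) sub(1)[OF U]])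
        then show ?thesis using x(2) gx r_coset_subset_G[OF sub(2)[OF U] x(1)] by auto
      qed
      then have gc: "g \<in> carrier G" using ne by blast
      have "z = f g" by (rule extensionalityI[OF zext fext]) (use gU fU in simp)
      then show "z \<in> f ` carrier G" using gc by blast
    qed
  qed
  have iso: "f \<in> iso G L" unfolding iso_def using fhom inj surj by (simp add: bij_betw_def)
  define P where "P = product_topology (\<lambda>U. discrete_topology (carrier (\<Gamma> U))) \<U>"
  have TL: "inverse_limit_topology \<U> r \<Gamma> \<phi> = subtopology P (carrier L)"
    unfolding inverse_limit_topology_def P_def L_def by simp
  have tsL: "topspace (subtopology P (carrier L)) = carrier L"
    unfolding P_def cL by auto
  have cont: "continuous_map T (subtopology P (carrier L)) f"
  proof (rule continuous_map_into_subtopology)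
    show "f \<in> topspace T \<rightarrow> carrier L" using fL topspace_eq by simp
    show "continuous_map T P f"
      unfolding P_def continuous_map_componentwise
    proof (intro conjI ballI)
      show "f ` topspace T \<subseteq> extensional \<U>" using fext by blast
      fix U assume U: "U \<in> \<U>"
      show "continuous_map T (discrete_topology (carrier (\<Gamma> U))) (\<lambda>x. f x U)"
        unfolding fU[OF U] \<Gamma>_def by (rule continuous_map_quotient[OF nrm[OF U] opn[OF U]])
    qed
  qed
  have homeo: "homeomorphic_map T (inverse_limit_topology \<U> r \<Gamma> \<phi>) f"
    unfolding TL
  proof (rule continuous_imp_homeomorphic_map[OF cont compact])
    show "Hausdorff_space (subtopology P (carrier L))"
      unfolding P_def by (intro Hausdorff_space_subtopology) (simp add: Hausdorff_space_product_topology)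
    show "f ` topspace T = topspace (subtopology P (carrier L))" unfolding tsL topspace_eq by (rule surj)
    show "inj_on f (topspace T)" unfolding topspace_eq by (rule inj)
  qed
  have fin: "\<forall>U\<in>\<U>. finite (carrier (\<Gamma> U)) \<and> C (\<Gamma> U)"
    unfolding \<Gamma>_def using finite_open_quotient[OF nrm opn] C by blast
  show ?thesis
    unfolding pro_def using topological inv fin iso[unfolded L_def] homeo by (intro conjI exI)
qed

end

text \<open>The kernel of \<open>h\<close> is open, so \<open>h\<close> factors through the image of \<open>G\<close> in a finite nilpotent group.\<close>

lemma pronilpotent_image:
  assumes pro: "pro nilpotent_group G T" and h: "group_hom G F h" and op: "openin T (kernel G F h)"
  shows "nilpotent_group (F\<lparr>carrier := h ` carrier G\<rparr>)"
proof -
  interpret h: group_hom G F h by (rule h)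
  have "\<one>\<^bsub>G\<^esub> \<in> kernel G F h" by (simp add: kernel_def)
  from pro_cases(2)[OF pro op this] obtain \<Gamma> :: "'a set monoid" and k
    where k: "group_hom G \<Gamma> k" "nilpotent_group \<Gamma>" "kernel G \<Gamma> k \<subseteq> kernel G F h" by blast
  interpret k: group_hom G \<Gamma> k by (rule k(1))
  obtain \<psi> where \<psi>: "group_hom (\<Gamma>\<lparr>carrier := k ` carrier G\<rparr>) F \<psi>" "\<And>x. x \<in> carrier G \<Longrightarrow> \<psi> (k x) = h x"
    using k.factor_through[OF h k(3)] by blast
  interpret \<psi>: group_hom "\<Gamma>\<lparr>carrier := k ` carrier G\<rparr>" F \<psi> by (rule \<psi>(1))
  have "nilpotent_group (\<Gamma>\<lparr>carrier := k ` carrier G\<rparr>)" by (rule k.H.nilpotent_subgroup[OF k(2) k.img_is_subgroup])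
  then have "nilpotent_group (F\<lparr>carrier := \<psi> ` (k ` carrier G)\<rparr>)"
    using \<psi>.nilpotent_subgroup_image[OF \<psi>.G.subgroup_self] by simp
  moreover have "\<psi> ` (k ` carrier G) = h ` carrier G" unfolding image_image by (intro image_cong refl \<psi>(2))
  ultimately show ?thesis by simp
qed

text \<open>As for pronilpotent groups; here the derived subgroup of a finite supersolvable group is nilpotent,
  and with it the derived subgroups of its subgroups and of their images.\<close>

lemma prosupersolvable_image:
  assumes pro: "pro supersolvable_group G T" and h: "group_hom G F h" and op: "openin T (kernel G F h)"
  shows "nilpotent_group (F\<lparr>carrier := derived F (h ` carrier G)\<rparr>)"
proof -
  interpret h: group_hom G F h by (rule h)
  have "\<one>\<^bsub>G\<^esub> \<in> kernel G F h" by (simp add: kernel_def)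
  from pro_cases(2)[OF pro op this] obtain \<Gamma> :: "'a set monoid" and k
    where k: "group_hom G \<Gamma> k" "supersolvable_group \<Gamma>" "kernel G \<Gamma> k \<subseteq> kernel G F h" by blast
  interpret k: group_hom G \<Gamma> k by (rule k(1))
  define A where "A = k ` carrier G"
  have A: "subgroup A \<Gamma>" unfolding A_def by (rule k.img_is_subgroup)
  obtain \<psi> where \<psi>: "group_hom (\<Gamma>\<lparr>carrier := A\<rparr>) F \<psi>" "\<And>x. x \<in> carrier G \<Longrightarrow> \<psi> (k x) = h x"
    unfolding A_def using k.factor_through[OF h k(3)] by blast
  define \<Gamma>A where "\<Gamma>A = \<Gamma>\<lparr>carrier := A\<rparr>"
  interpret \<psi>: group_hom \<Gamma>A F \<psi> unfolding \<Gamma>A_def by (rule \<psi>(1))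
  have cA: "carrier \<Gamma>A = A" by (simp add: \<Gamma>A_def)
  define D where "D = derived \<Gamma> A"
  have DA: "derived \<Gamma>A A = D" unfolding \<Gamma>A_def D_def by (rule k.H.derived_consistent[OF subset_refl A])
  have Ds: "subgroup D \<Gamma>" unfolding D_def by (rule k.H.derived_is_subgroup[OF subgroup.subset[OF A]])
  have DsA: "subgroup D \<Gamma>A" unfolding DA[symmetric] by (rule \<psi>.G.derived_is_subgroup) (simp add: cA)
  define E where "E = derived \<Gamma> (carrier \<Gamma>)"
  have E: "subgroup E \<Gamma>" unfolding E_def by (rule k.H.derived_is_subgroup[OF subset_refl])
  have DE: "D \<subseteq> E" unfolding D_def E_def by (rule k.H.mono_derived[OF subgroup.subset[OF A]])
  have "nilpotent_group (\<Gamma>\<lparr>carrier := E\<rparr>)" unfolding E_def by (rule k.H.supersolvable_imp_derived_nilpotent[OF k(2)])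
  then have "nilpotent_group (\<Gamma>\<lparr>carrier := E\<rparr>\<lparr>carrier := D\<rparr>)"
    by (rule group.nilpotent_subgroup[OF k.H.subgroup_imp_group[OF E] _ k.H.subgroup_incl[OF Ds E DE]])
  then have "nilpotent_group (\<Gamma>A\<lparr>carrier := D\<rparr>)" by (simp add: \<Gamma>A_def)
  then have "nilpotent_group (F\<lparr>carrier := \<psi> ` D\<rparr>)" by (rule \<psi>.nilpotent_subgroup_image[OF DsA])
  moreover have "\<psi> ` D = derived F (h ` carrier G)"
  proof -
    have "derived F (\<psi> ` A) = \<psi> ` D" using \<psi>.derived_img[of A] DA cA by simp
    moreover have "\<psi> ` A = h ` carrier G" unfolding A_def image_image by (intro image_cong refl \<psi>(2))
    ultimately show ?thesis by simp
  qed
  ultimately show ?thesis by simp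
qed

section \<open>Sylow subgroups of profinite groups\<close>

text \<open>\<open>h\<close> induces a homomorphism \<open>\<psi>\<close> from \<open>k ` carrier G\<close> onto \<open>h ` carrier G\<close>. Here \<open>b\<close> is the order of the part
  of the kernel of \<open>\<psi>\<close> in \<open>k ` R\<close>, and \<open>c\<close> is the index of that part in the kernel.\<close>

lemma (in group) card_images_of_kernel_subset:
  assumes k: "group_hom G K k" and h: "group_hom G F h" and ker: "kernel G K k \<subseteq> kernel G F h"
    and fin: "finite (k ` carrier G)" and R: "subgroup R G"
  obtains a b c where "card (k ` carrier G) = card (h ` carrier G) * (b * c)" "card (k ` R) = card (h ` R) * b"
    "b > 0" "kernel G F h \<subseteq> R \<Longrightarrow> c = 1"
proof -
  interpret k: group_hom G K k by (rule k)
  interpret h: group_hom G F h by (rule h)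
  obtain \<psi> where \<psi>: "group_hom (K\<lparr>carrier := k ` carrier G\<rparr>) F \<psi>" and \<psi>k: "\<And>x. x \<in> carrier G \<Longrightarrow> \<psi> (k x) = h x"
    using k.factor_through[OF h ker] by blast
  define KK where "KK = K\<lparr>carrier := k ` carrier G\<rparr>"
  interpret \<psi>: group_hom KK F \<psi> unfolding KK_def by (rule \<psi>)
  note Rsub = subgroup.subset[OF R]
  have cKK: "carrier KK = k ` carrier G" by (simp add: KK_def)
  have kR: "subgroup (k ` R) KK"
    unfolding KK_def by (rule k.H.subgroup_incl[OF k.subgroup_img_is_subgroup[OF R] k.img_is_subgroup image_mono[OF Rsub]])
  have finK: "finite (carrier KK)" using fin cKK by simp
  have im: "\<psi> ` (k ` A) = h ` A" if "A \<subseteq> carrier G" for A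
    unfolding image_image using \<psi>k that by (intro image_cong) auto
  define N where "N = kernel KK F \<psi>"
  have N: "subgroup N KK" unfolding N_def by (rule \<psi>.subgroup_kernel)
  have Nk: "subgroup (k ` R \<inter> N) KK" by (rule \<psi>.G.subgroups_Inter_pair[OF kR N])
  have e1: "card (k ` carrier G) = card (h ` carrier G) * card N"
    using \<psi>.card_subgroup_image[OF \<psi>.G.subgroup_self finK] subgroup.subset[OF N]
    unfolding cKK im[OF subset_refl] N_def[symmetric] by (simp add: Int_absorb1)
  have e2: "card (k ` R) = card (h ` R) * card (k ` R \<inter> N)"
    using \<psi>.card_subgroup_image[OF kR \<psi>.G.finite_subgroup[OF finK kR]] unfolding im[OF Rsub] N_def .
  obtain c where c: "card N = card (k ` R \<inter> N) * c"
    using \<psi>.G.card_subgroup_dvd[OF Nk N Int_lower2] by (auto simp: dvd_def)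
  have pos: "card (k ` R \<inter> N) > 0" by (rule \<psi>.G.card_subgroup_pos[OF finK Nk])
  show ?thesis
  proof (rule that[OF _ e2 pos])
    show "card (k ` carrier G) = card (h ` carrier G) * (card (k ` R \<inter> N) * c)" using e1 c by simp
    assume sub: "kernel G F h \<subseteq> R"
    have "N \<subseteq> k ` R"
    proof
      fix y assume "y \<in> N"
      then have y: "y \<in> k ` carrier G" "\<psi> y = \<one>\<^bsub>F\<^esub>" unfolding N_def kernel_def cKK by auto
      from y(1) obtain x where x: "x \<in> carrier G" "y = k x" by blast
      have "x \<in> kernel G F h" using x \<psi>k y(2) by (simp add: kernel_def)
      then show "y \<in> k ` R" using sub x(2) by blast
    qed
    then have "k ` R \<inter> N = N" by blast
    then show "c = 1" using c pos by simp
  qed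
qed

lemma (in group) card_image_dvd_of_kernel_subset:
  assumes "group_hom G K k" "group_hom G F h" "kernel G K k \<subseteq> kernel G F h" "finite (k ` carrier G)"
  shows "card (h ` carrier G) dvd card (k ` carrier G)"
  by (rule card_images_of_kernel_subset[OF assms subgroup_self]) (metis dvd_triv_left)

lemma (in group) coprime_index_image:
  assumes k: "group_hom G K k" and h: "group_hom G F h" and ker: "kernel G K k \<subseteq> kernel G F h"
    and fin: "finite (k ` carrier G)" and R: "subgroup R G"
    and m: "card (k ` carrier G) = card (k ` R) * m" "\<not> p dvd m"
  shows "\<exists>m'. card (h ` carrier G) = card (h ` R) * m' \<and> \<not> p dvd m'"
proof -
  obtain b c where b: "card (k ` carrier G) = card (h ` carrier G) * (b * c)" "card (k ` R) = card (h ` R) * b" "b > 0"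
    by (rule card_images_of_kernel_subset[OF k h ker fin R])
  interpret h: group_hom G F h by (rule h)
  interpret k: group_hom G K k by (rule k)
  have "card (k ` carrier G) > 0" using fin by (auto simp: card_gt_0_iff)
  then have "card (h ` carrier G) > 0" using b(1) by (cases "card (h ` carrier G)") auto
  then have finh: "finite (h ` carrier G)" by (rule card_ge_0_finite)
  define HH where "HH = F\<lparr>carrier := h ` carrier G\<rparr>"
  interpret HH: group HH unfolding HH_def by (rule h.H.subgroup_imp_group[OF h.img_is_subgroup])
  have hR: "subgroup (h ` R) F" by (rule h.subgroup_img_is_subgroup[OF R])
  obtain m' where m': "card (h ` carrier G) = card (h ` R) * m'"
    using h.H.card_subgroup_dvd[OF hR h.img_is_subgroup image_mono[OF subgroup.subset[OF R]]] by (auto simp: dvd_def)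
  have "card (h ` R) * b * (m' * c) = card (h ` R) * b * m"
    using m(1) unfolding b m' by (simp add: mult_ac)
  moreover have "card (h ` R) > 0" using m' \<open>card (h ` carrier G) > 0\<close> by (cases "card (h ` R)") auto
  ultimately have "m' * c = m" using b(3) by simp
  then show ?thesis using m' m(2) by auto
qed

context profinite_group
begin

lemma pro_p_image:
  assumes P: "pro_p_subgroup p G T P" and p: "prime p" and h: "group_hom G F h" and ker: "openin T (kernel G F h)"
  obtains c where "card (h ` P) = p ^ c"
proof -
  interpret h: group_hom G F h by (rule h)
  have Ps: "subgroup P G" and pro: "pro (p_power_order_group p) (G\<lparr>carrier := P\<rparr>) (subtopology T P)"
    using P unfolding pro_p_subgroup_def closed_subgroup_def pro_p_def by auto
  define GP where "GP = G\<lparr>carrier := P\<rparr>"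
  interpret GP: group GP unfolding GP_def by (rule subgroup_imp_group[OF Ps])
  have op: "openin (subtopology T P) (kernel G F h \<inter> P)" using ker by (auto simp: openin_subtopology)
  have one: "\<one>\<^bsub>G\<lparr>carrier := P\<rparr>\<^esub> \<in> kernel G F h \<inter> P"
    using subgroup.one_closed[OF Ps] by (simp add: kernel_def)
  obtain \<Gamma> :: "'a set monoid" and k where k: "group_hom GP \<Gamma> k" "finite (carrier \<Gamma>)" "p_power_order_group p \<Gamma>"
    "kernel GP \<Gamma> k \<subseteq> kernel G F h \<inter> P"
    using pro_cases(2)[OF pro op one] unfolding GP_def by blast
  interpret k: group_hom GP \<Gamma> k by (rule k(1))
  have hP: "group_hom GP F h" unfolding GP_def by (rule group_hom_subgroup[OF h Ps])
  have cGP: "carrier GP = P" by (simp add: GP_def)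
  have "kernel GP \<Gamma> k \<subseteq> kernel GP F h" using k(4) by (auto simp: kernel_def cGP)
  moreover have "finite (k ` carrier GP)"
    by (rule finite_subset[OF subgroup.subset[OF k.img_is_subgroup] k(2)])
  ultimately have "card (h ` P) dvd card (k ` P)"
    using GP.card_image_dvd_of_kernel_subset[OF k(1) hP] unfolding cGP by blast
  also have "card (k ` P) dvd card (carrier \<Gamma>)"
    using k.H.card_subgroup_dvd[OF k.img_is_subgroup k.H.subgroup_self subgroup.subset[OF k.img_is_subgroup]]
    unfolding cGP .
  also obtain n where "card (carrier \<Gamma>) = p ^ n" using k(3) unfolding p_power_order_group_def order_def by blast
  finally have "card (h ` P) dvd p ^ n" .
  then show ?thesis using divides_primepow_nat[OF p] that by blast
qed

text \<open>This expresses that the index of \<open>Q\<close>, as a supernatural number, is prime to \<open>p\<close>.\<close>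

definition coprime_index :: "nat \<Rightarrow> 'a set \<Rightarrow> bool" where
  "coprime_index p Q \<longleftrightarrow> (\<forall>U. U \<lhd> G \<longrightarrow> openin T U \<longrightarrow>
     (\<exists>m. card ((\<lambda>x. U #> x) ` carrier G) = card ((\<lambda>x. U #> x) ` Q) * m \<and> \<not> p dvd m))"

text \<open>Zorn's lemma, applied to the complements. The members of a chain have eventually the same image in
  the finite group \<open>G Mod U\<close>, and by compactness their intersection has this image as well: each of its
  cosets meets all members of the chain in a directed family of nonempty closed sets.\<close>

lemma minimal_coprime_index:
  assumes p: "prime p" and P: "P \<subseteq> carrier G"
  obtains Q where "closed_subgroup G T Q" "P \<subseteq> Q" "coprime_index p Q"
    "\<forall>R. closed_subgroup G T R \<longrightarrow> P \<subseteq> R \<longrightarrow> coprime_index p R \<longrightarrow> R \<subseteq> Q \<longrightarrow> R = Q"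
proof -
  define \<Q> where "\<Q> = {Q. closed_subgroup G T Q \<and> P \<subseteq> Q \<and> coprime_index p Q}"
  define A where "A = (\<lambda>Q. carrier G - Q) ` \<Q>"
  have \<Q>sub: "Q \<subseteq> carrier G" if "Q \<in> \<Q>" for Q
    using that subgroup.subset[of Q G] unfolding \<Q>_def closed_subgroup_def by blast
  have "\<not> p dvd 1" using p prime_gt_1_nat[OF p] by simp
  then have top: "carrier G \<in> \<Q>"
    unfolding \<Q>_def closed_subgroup_def coprime_index_def
    using P subgroup_self closedin_topspace[of T] unfolding topspace_eq by (auto intro: exI[of _ 1])
  have "\<exists>M\<in>A. \<forall>X\<in>A. M \<subseteq> X \<longrightarrow> X = M"
  proof (rule subset_Zorn')
    fix \<C> assume chain: "subset.chain A \<C>"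
    show "\<Union> \<C> \<in> A"
    proof (cases "\<C> = {}")
      case True
      then show ?thesis unfolding A_def using top by (intro image_eqI[of _ _ "carrier G"]) auto
    next
      case False
      define D where "D = {Q \<in> \<Q>. carrier G - Q \<in> \<C>}"
      have CA: "\<C> \<subseteq> A" using chain by (simp add: subset_chain_def)
      have Dne: "D \<noteq> {}" using False CA unfolding A_def D_def by blast
      have Dch: "Q \<subseteq> Q' \<or> Q' \<subseteq> Q" if "Q \<in> D" "Q' \<in> D" for Q Q'
      proof -
        have m: "carrier G - Q \<in> \<C>" "carrier G - Q' \<in> \<C>" and q: "Q \<in> \<Q>" "Q' \<in> \<Q>"
          using that unfolding D_def by simp_all
        have "\<forall>X\<in>\<C>. \<forall>Y\<in>\<C>. X \<subseteq> Y \<or> Y \<subseteq> X" using chain by (simp add: subset_chain_def)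
        from this[rule_format, OF m] show ?thesis using \<Q>sub[OF q(1)] \<Q>sub[OF q(2)] by (elim disjE) auto
      qed
      have DQ: "closed_subgroup G T Q" "P \<subseteq> Q" "coprime_index p Q" if "Q \<in> D" for Q
        using that unfolding D_def \<Q>_def by auto
      have DS: "subgroup Q G" "closedin T Q" if "Q \<in> D" for Q
        using DQ(1)[OF that] unfolding closed_subgroup_def by auto
      have eq: "\<Union> \<C> = carrier G - \<Inter> D"
      proof
        show "\<Union> \<C> \<subseteq> carrier G - \<Inter> D"
        proof
          fix x assume "x \<in> \<Union> \<C>"
          then obtain X where X: "X \<in> \<C>" "x \<in> X" by blast
          then obtain Q where Q: "Q \<in> \<Q>" "X = carrier G - Q" using CA unfolding A_def by blast
          then have "Q \<in> D" using X(1) unfolding D_def by simp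
          then show "x \<in> carrier G - \<Inter> D" using X(2) Q(2) by blast
        qed
        show "carrier G - \<Inter> D \<subseteq> \<Union> \<C>" unfolding D_def by blast
      qed
      have Ds: "subgroup (\<Inter> D) G" by (rule subgroups_Inter[OF DS(1) Dne])
      have "coprime_index p (\<Inter> D)"
        unfolding coprime_index_def
      proof (intro allI impI)
        fix U assume U: "U \<lhd> G" "openin T U"
        let ?f = "\<lambda>x. U #> x"
        note Us = normal_imp_subgroup[OF U(1)]
        have fin: "finite (?f ` carrier G)" using finite_open_quotient[OF U] by (simp add: carrier_FactGroup)
        \<comment> \<open>From a member \<open>Q\<close> with smallest image onwards the images in \<open>G Mod U\<close> are constant.\<close>
        obtain Q where Q: "Q \<in> D" and min: "\<And>Q'. Q' \<in> D \<Longrightarrow> card (?f ` Q) \<le> card (?f ` Q')"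
          using ex_has_least_nat[of "\<lambda>Q. Q \<in> D" _ "\<lambda>Q. card (?f ` Q)"] Dne by blast
        have all: "?f ` Q \<subseteq> ?f ` Q'" if Q': "Q' \<in> D" for Q'
        proof (cases "Q \<subseteq> Q'")
          case False
          then have sub: "?f ` Q' \<subseteq> ?f ` Q" using Dch[OF Q Q'] by blast
          have "finite (?f ` Q)" using finite_subset[OF image_mono[OF subgroup.subset[OF DS(1)[OF Q]]] fin] .
          then show ?thesis using card_seteq[OF _ sub min[OF Q']] by simp
        qed blast
        have "?f ` Q \<subseteq> ?f ` \<Inter> D"
        proof
          fix y assume y: "y \<in> ?f ` Q"
          then obtain g where g: "g \<in> Q" "y = U #> g" by blast
          have gc: "g \<in> carrier G" by (rule subgroup.mem_carrier[OF DS(1)[OF Q] g(1)])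
          have "(\<Inter>Q'\<in>D. y \<inter> Q') \<noteq> {}"
          proof (rule compact_directed_Inter_nonempty[OF compact Dne])
            show "closedin T (y \<inter> Q')" if "Q' \<in> D" for Q'
              unfolding g(2) by (intro closedin_Int closed_rcoset open_subgroup_closed Us U(2) gc DS(2) that)
            show "y \<inter> Q' \<noteq> {}" if Q': "Q' \<in> D" for Q'
            proof -
              obtain x where x: "x \<in> Q'" "y = U #> x" using all[OF Q'] y by blast
              have "x \<in> y" unfolding x(2) by (rule rcos_self[OF subgroup.mem_carrier[OF DS(1)[OF Q'] x(1)] Us])
              then show ?thesis using x(1) by blast
            qed
            show "\<exists>k\<in>D. y \<inter> k \<subseteq> y \<inter> i \<inter> (y \<inter> j)" if ij: "i \<in> D" "j \<in> D" for i j
              using Dch[OF ij] ij by blast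
          qed
          then obtain z where z: "z \<in> y" "z \<in> \<Inter> D" using Dne by blast
          have "U #> g = U #> z" by (rule repr_independence[OF _ gc Us]) (use z(1) g(2) in simp)
          then show "y \<in> ?f ` \<Inter> D" using z(2) g(2) by blast
        qed
        moreover have "?f ` \<Inter> D \<subseteq> ?f ` Q" using Q by blast
        ultimately have "?f ` \<Inter> D = ?f ` Q" by blast
        then show "\<exists>m. card (?f ` carrier G) = card (?f ` \<Inter> D) * m \<and> \<not> p dvd m"
          using DQ(3)[OF Q] U unfolding coprime_index_def by simp
      qed
      moreover have "closedin T (\<Inter> D)" by (rule closedin_Inter[OF Dne DS(2)])
      moreover have "P \<subseteq> \<Inter> D" using DQ(2) by blast
      ultimately have "\<Inter> D \<in> \<Q>" using Ds unfolding \<Q>_def closed_subgroup_def by blast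
      then show ?thesis unfolding A_def eq by blast
    qed
  qed
  then obtain Q where Q: "Q \<in> \<Q>" and max: "\<And>R. R \<in> \<Q> \<Longrightarrow> carrier G - Q \<subseteq> carrier G - R \<Longrightarrow> carrier G - R = carrier G - Q"
    unfolding A_def by blast
  show ?thesis
  proof (rule that[of Q])
    show "closed_subgroup G T Q" "P \<subseteq> Q" "coprime_index p Q" using Q unfolding \<Q>_def by auto
    show "\<forall>R. closed_subgroup G T R \<longrightarrow> P \<subseteq> R \<longrightarrow> coprime_index p R \<longrightarrow> R \<subseteq> Q \<longrightarrow> R = Q"
    proof (intro allI impI)
      fix R assume R: "closed_subgroup G T R" "P \<subseteq> R" "coprime_index p R" "R \<subseteq> Q"
      then have RQ: "R \<in> \<Q>" unfolding \<Q>_def by simp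
      have "carrier G - R = carrier G - Q" using max[OF RQ] R(4) by blast
      then show "R = Q" using \<Q>sub[OF RQ] \<Q>sub[OF Q] by blast
    qed
  qed
qed

text \<open>The image of \<open>Q\<close> in \<open>G Mod U\<close> has a Sylow subgroup \<open>S\<close> containing the image of \<open>P\<close>. The preimage \<open>R\<close> of \<open>S\<close> in \<open>Q\<close>
  has index prime to \<open>p\<close> in \<open>Q\<close>, hence also in \<open>G\<close>, and minimality of \<open>Q\<close> forces \<open>R = Q\<close>.\<close>

lemma minimal_coprime_index_p_image:
  assumes p: "prime p" and Q: "closed_subgroup G T Q" and PQ: "P \<subseteq> Q" and cQ: "coprime_index p Q"
    and min: "\<forall>R. closed_subgroup G T R \<longrightarrow> P \<subseteq> R \<longrightarrow> coprime_index p R \<longrightarrow> R \<subseteq> Q \<longrightarrow> R = Q"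
    and P: "pro_p_subgroup p G T P" and U: "U \<lhd> G" "openin T U"
  obtains a where "card ((\<lambda>x. U #> x) ` Q) = p ^ a"
proof -
  let ?f = "\<lambda>x. U #> x"
  interpret U: normal U G by (rule U(1))
  interpret f: group_hom G "G Mod U" ?f by (rule U.quotient_hom)
  have Qs: "subgroup Q G" and Qcl: "closedin T Q" using Q unfolding closed_subgroup_def by auto
  have Ps: "subgroup P G" using P unfolding pro_p_subgroup_def closed_subgroup_def by simp
  note Qsub = subgroup.subset[OF Qs]
  define F where "F = (G Mod U)\<lparr>carrier := ?f ` Q\<rparr>"
  have fQ: "subgroup (?f ` Q) (G Mod U)" by (rule f.subgroup_img_is_subgroup[OF Qs])
  interpret F: group F unfolding F_def by (rule f.H.subgroup_imp_group[OF fQ])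
  have cF: "carrier F = ?f ` Q" by (simp add: F_def)
  have finF: "finite (carrier F)" unfolding cF
    by (rule finite_subset[OF subgroup.subset[OF fQ] finite_open_quotient[OF U]])
  have kerf: "kernel G (G Mod U) ?f = U" by (rule U.quotient_kernel)
  obtain c where c: "card (?f ` P) = p ^ c"
    by (rule pro_p_image[OF P p U.quotient_hom]) (use U(2) kerf in simp)
  have fP: "subgroup (?f ` P) F"
    unfolding F_def by (rule f.H.subgroup_incl[OF f.subgroup_img_is_subgroup[OF Ps] fQ image_mono[OF PQ]])
  obtain S a m where S: "subgroup S F" "?f ` P \<subseteq> S" "card S = p ^ a" "order F = p ^ a * m" "\<not> p dvd m"
    by (rule F.sylow_containing[OF finF fP p c])
  have SG: "subgroup S (G Mod U)"
    by (rule f.H.incl_subgroup[OF fQ S(1)[unfolded F_def]])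
  have Ssub: "S \<subseteq> ?f ` Q" using subgroup.subset[OF S(1)] unfolding cF .
  define R where "R = Q \<inter> {x \<in> carrier G. ?f x \<in> S}"
  have pre: "subgroup {x \<in> carrier G. ?f x \<in> S} G"
  proof (rule subgroupI)
    have "\<one> \<in> {x \<in> carrier G. ?f x \<in> S}" using f.hom_one subgroup.one_closed[OF SG] by simp
    then show "{x \<in> carrier G. ?f x \<in> S} \<noteq> {}" by blast
    show "inv x \<in> {x \<in> carrier G. ?f x \<in> S}" if x: "x \<in> {x \<in> carrier G. ?f x \<in> S}" for x
    proof -
      have "?f (inv x) = inv\<^bsub>G Mod U\<^esub> ?f x" using x by (intro f.hom_inv) simp
      then show ?thesis using x subgroup.m_inv_closed[OF SG, of "?f x"] by simp
    qed
    show "x \<otimes> y \<in> {x \<in> carrier G. ?f x \<in> S}"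
      if x: "x \<in> {x \<in> carrier G. ?f x \<in> S}" and y: "y \<in> {x \<in> carrier G. ?f x \<in> S}" for x y
    proof -
      have "?f (x \<otimes> y) = ?f x \<otimes>\<^bsub>G Mod U\<^esub> ?f y" using x y by (intro f.hom_mult) simp_all
      then show ?thesis using x y subgroup.m_closed[OF SG, of "?f x" "?f y"] by simp
    qed
  qed auto
  have Rs: "subgroup R G" unfolding R_def by (rule subgroups_Inter_pair[OF Qs pre])
  have "closedin T {x \<in> carrier G. ?f x \<in> S}"
    using closed_quotient_preimage[OF U subgroup.subset[OF SG]] topspace_eq by simp
  then have "closedin T R" unfolding R_def by (rule closedin_Int[OF Qcl])
  then have Rcl: "closed_subgroup G T R" unfolding closed_subgroup_def using Rs by simp
  have PR: "P \<subseteq> R" unfolding R_def using PQ S(2) subgroup.subset[OF Ps] by blast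
  have RQ: "R \<subseteq> Q" unfolding R_def by blast
  have fR: "?f ` R = S"
  proof
    show "?f ` R \<subseteq> S" unfolding R_def by blast
    show "S \<subseteq> ?f ` R" unfolding R_def using Ssub Qsub by blast
  qed
  have cQm: "card (?f ` Q) = p ^ a * m" using S(4) cF by (simp add: order_def)
  have "coprime_index p R"
    unfolding coprime_index_def
  proof (intro allI impI)
    fix V assume V: "V \<lhd> G" "openin T V"
    \<comment> \<open>The index of \<open>R\<close> in \<open>Q\<close> is visible modulo \<open>W\<close>, since \<open>W \<subseteq> U\<close>; then the index passes from \<open>W\<close> to \<open>V\<close>.\<close>
    define W where "W = U \<inter> V"
    have W: "W \<lhd> G" "openin T W" unfolding W_def by (rule open_normal_Int[OF U V])+
    let ?k = "\<lambda>x. W #> x" and ?h = "\<lambda>x. V #> x"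
    interpret W: normal W G by (rule W(1))
    interpret V: normal V G by (rule V(1))
    have finW: "finite (?k ` carrier G)" using finite_open_quotient[OF W] by (simp add: carrier_FactGroup)
    define GQ where "GQ = G\<lparr>carrier := Q\<rparr>"
    interpret GQ: group GQ unfolding GQ_def by (rule subgroup_imp_group[OF Qs])
    have cGQ: "carrier GQ = Q" by (simp add: GQ_def)
    have kQ: "group_hom GQ (G Mod W) ?k" and fQ: "group_hom GQ (G Mod U) ?f"
      unfolding GQ_def by (intro group_hom_subgroup W.quotient_hom U.quotient_hom Qs)+
    have kerQ: "kernel GQ (G Mod W) ?k \<subseteq> kernel GQ (G Mod U) ?f"
    proof
      fix x assume "x \<in> kernel GQ (G Mod W) ?k"
      then have x: "x \<in> Q" "?k x = W" by (auto simp: kernel_def cGQ)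
      have "x \<in> W" using rcos_self[OF subgroup.mem_carrier[OF Qs x(1)] W.subgroup_axioms] x(2) by simp
      then have "?f x = U" unfolding W_def by (intro U.rcos_const[OF is_group]) simp
      then show "x \<in> kernel GQ (G Mod U) ?f" using x(1) by (simp add: kernel_def cGQ)
    qed
    have RGQ: "subgroup R GQ" unfolding GQ_def by (rule subgroup_incl[OF Rs Qs RQ])
    have finQ: "finite (?k ` carrier GQ)" unfolding cGQ by (rule finite_subset[OF image_mono[OF Qsub] finW])
    obtain b d where bd: "card (?k ` Q) = card (?f ` Q) * (b * d)" "card (?k ` R) = card (?f ` R) * b"
      and d: "kernel GQ (G Mod U) ?f \<subseteq> R \<Longrightarrow> d = 1"
      using GQ.card_images_of_kernel_subset[OF kQ fQ kerQ finQ RGQ] unfolding cGQ by metis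
    have "kernel GQ (G Mod U) ?f \<subseteq> R"
    proof
      fix x assume "x \<in> kernel GQ (G Mod U) ?f"
      then have x: "x \<in> Q" "?f x = \<one>\<^bsub>G Mod U\<^esub>" by (auto simp: kernel_def cGQ)
      have "?f x \<in> S" unfolding x(2) by (rule subgroup.one_closed[OF SG])
      then show "x \<in> R" unfolding R_def using x(1) Qsub by blast
    qed
    then have "d = 1" by (rule d)
    then have kk: "card (?k ` Q) = card (?k ` R) * m"
      unfolding bd fR S(3) cQm by (simp add: mult_ac)
    obtain m1 where m1: "card (?k ` carrier G) = card (?k ` Q) * m1" "\<not> p dvd m1"
      using cQ W unfolding coprime_index_def by blast
    have kG: "card (?k ` carrier G) = card (?k ` R) * (m * m1)" unfolding m1(1) kk by simp
    have nd: "\<not> p dvd m * m1" using S(5) m1(2) p prime_dvd_mult_iff by blast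
    have ker: "kernel G (G Mod W) ?k \<subseteq> kernel G (G Mod V) ?h"
      unfolding W.quotient_kernel V.quotient_kernel by (simp add: W_def)
    show "\<exists>m. card (?h ` carrier G) = card (?h ` R) * m \<and> \<not> p dvd m"
      by (rule coprime_index_image[OF W.quotient_hom V.quotient_hom ker finW Rs kG nd])
  qed
  then have "R = Q" using min Rcl PR RQ by simp
  then show ?thesis using fR S(3) that by simp
qed

text \<open>A minimal closed subgroup \<open>Q\<close> of index prime to \<open>p\<close> that contains \<open>P\<close> is itself pro-\<open>p\<close>, so it equals the
  maximal pro-\<open>p\<close> subgroup \<open>P\<close>.\<close>

lemma sylow_coprime_index:
  assumes p: "prime p" and P: "sylow_subgroup p G T P"
  shows "coprime_index p P"
proof -
  have pP: "pro_p_subgroup p G T P" and maxP: "\<forall>Q. pro_p_subgroup p G T Q \<longrightarrow> P \<subseteq> Q \<longrightarrow> Q = P"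
    using P unfolding sylow_subgroup_def by simp_all
  have Ps: "subgroup P G" using pP unfolding pro_p_subgroup_def closed_subgroup_def by simp
  obtain Q where Q: "closed_subgroup G T Q" "P \<subseteq> Q" "coprime_index p Q"
    and min: "\<forall>R. closed_subgroup G T R \<longrightarrow> P \<subseteq> R \<longrightarrow> coprime_index p R \<longrightarrow> R \<subseteq> Q \<longrightarrow> R = Q"
    by (rule minimal_coprime_index[OF p subgroup.subset[OF Ps]])
  have Qs: "subgroup Q G" using Q(1) unfolding closed_subgroup_def by simp
  define GQ where "GQ = G\<lparr>carrier := Q\<rparr>"
  interpret Q: profinite_group GQ "subtopology T Q" unfolding GQ_def by (rule profinite_subgroup[OF Q(1)])
  have cGQ: "carrier GQ = Q" by (simp add: GQ_def)
  have one: "\<one>\<^bsub>GQ\<^esub> = \<one>" by (simp add: GQ_def)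
  define \<U> where "\<U> = {U \<inter> Q | U. U \<lhd> G \<and> openin T U}"
  have "pro (p_power_order_group p) GQ (subtopology T Q)"
  proof (rule Q.pro_of_open_normal_subgroups)
    have "carrier G \<inter> Q \<in> \<U>" unfolding \<U>_def using normal_self openin_topspace[of T] topspace_eq by auto
    then show "\<U> \<noteq> {}" by blast
    show nU: "V \<lhd> GQ" if "V \<in> \<U>" for V
      using that normal_Int_subgroup[OF Qs] unfolding \<U>_def GQ_def by blast
    show "openin (subtopology T Q) V" if "V \<in> \<U>" for V
      using that unfolding \<U>_def openin_subtopology by blast
    show "\<exists>W\<in>\<U>. W \<subseteq> V \<inter> V'" if V: "V \<in> \<U>" "V' \<in> \<U>" for V V'
    proof -
      obtain U U' where U: "U \<lhd> G" "openin T U" "V = U \<inter> Q" "U' \<lhd> G" "openin T U'" "V' = U' \<inter> Q"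
        using V unfolding \<U>_def by blast
      have "U \<inter> U' \<inter> Q \<in> \<U>" unfolding \<U>_def using open_normal_Int[OF U(1,2,4,5)] by blast
      moreover have "U \<inter> U' \<inter> Q \<subseteq> V \<inter> V'" unfolding U(3,6) by auto
      ultimately show ?thesis by (rule bexI[rotated])
    qed
    show "\<Inter> \<U> \<subseteq> {\<one>\<^bsub>GQ\<^esub>}"
    proof
      fix x assume x: "x \<in> \<Inter> \<U>"
      have mem: "x \<in> U \<inter> Q" if "U \<lhd> G" "openin T U" for U using x that unfolding \<U>_def by blast
      have "x \<in> carrier G"
        using mem[OF normal_self] openin_topspace[of T] topspace_eq by simp
      then have "x = \<one>" by (rule open_normal_separate) (use mem in blast)
      then show "x \<in> {\<one>\<^bsub>GQ\<^esub>}" using one by simp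
    qed
    fix V assume V: "V \<in> \<U>"
    then obtain U where U: "U \<lhd> G" "openin T U" "V = U \<inter> Q" unfolding \<U>_def by blast
    interpret U: normal U G by (rule U(1))
    interpret V: normal V GQ by (rule nU[OF V])
    obtain a where a: "card ((\<lambda>x. U #> x) ` Q) = p ^ a"
      by (rule minimal_coprime_index_p_image[OF p Q min pP U(1,2)])
    have hU: "group_hom GQ (G Mod U) (\<lambda>x. U #> x)"
      unfolding GQ_def by (rule group_hom_subgroup[OF U.quotient_hom Qs])
    have ker: "kernel GQ (G Mod U) (\<lambda>x. U #> x) \<subseteq> kernel GQ (GQ Mod V) (\<lambda>x. V #>\<^bsub>GQ\<^esub> x)"
    proof
      fix x assume "x \<in> kernel GQ (G Mod U) (\<lambda>x. U #> x)"
      then have x: "x \<in> Q" "U #> x = U" by (auto simp: kernel_def cGQ)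
      have "x \<in> U" using rcos_self[OF subgroup.mem_carrier[OF Qs x(1)] U.subgroup_axioms] x(2) by simp
      then show "x \<in> kernel GQ (GQ Mod V) (\<lambda>x. V #>\<^bsub>GQ\<^esub> x)"
        unfolding V.quotient_kernel using x(1) U(3) by simp
    qed
    have fin: "finite ((\<lambda>x. U #> x) ` carrier GQ)"
      by (rule finite_subset[OF _ finite_open_quotient[OF U(1,2)]])
        (use subgroup.subset[OF Qs] in \<open>auto simp: cGQ carrier_FactGroup\<close>)
    have "card (carrier (GQ Mod V)) dvd p ^ a"
      using Q.card_image_dvd_of_kernel_subset[OF hU V.quotient_hom ker fin] a
      unfolding carrier_FactGroup cGQ by simp
    then obtain n where "card (carrier (GQ Mod V)) = p ^ n" using divides_primepow_nat[OF p] by blast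
    then show "p_power_order_group p (GQ Mod V)"
      unfolding p_power_order_group_def order_def using V.factorgroup_is_group by (intro conjI exI)
  qed
  then have "pro_p_subgroup p G T Q" unfolding pro_p_subgroup_def pro_p_def GQ_def using Q(1) by simp
  then have "Q = P" using maxP Q(2) by blast
  then show ?thesis using Q(3) by simp
qed

lemma sylow_image:
  assumes p: "prime p" and P: "sylow_subgroup p G T P" and h: "group_hom G F h" and op: "openin T (kernel G F h)"
  shows "subgroup P G" "\<exists>c. card (h ` P) = p ^ c"
    "\<exists>m. card (h ` carrier G) = card (h ` P) * m \<and> \<not> p dvd m"
proof -
  interpret h: group_hom G F h by (rule h)
  have pP: "pro_p_subgroup p G T P" using P unfolding sylow_subgroup_def by blast
  show Ps: "subgroup P G" using pP unfolding pro_p_subgroup_def closed_subgroup_def by simp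
  show "\<exists>c. card (h ` P) = p ^ c" by (rule pro_p_image[OF pP p h op]) blast
  define U where "U = kernel G F h"
  have U: "U \<lhd> G" "openin T U" unfolding U_def by (rule h.normal_kernel, rule op)
  interpret U: normal U G by (rule U(1))
  obtain m where m: "card ((\<lambda>x. U #> x) ` carrier G) = card ((\<lambda>x. U #> x) ` P) * m" "\<not> p dvd m"
    using sylow_coprime_index[OF p P] U unfolding coprime_index_def by blast
  have fin: "finite ((\<lambda>x. U #> x) ` carrier G)" using finite_open_quotient[OF U] by (simp add: carrier_FactGroup)
  have ker: "kernel G (G Mod U) (\<lambda>x. U #> x) \<subseteq> kernel G F h" unfolding U.quotient_kernel by (simp add: U_def)
  show "\<exists>m. card (h ` carrier G) = card (h ` P) * m \<and> \<not> p dvd m"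
    by (rule coprime_index_image[OF U.quotient_hom h ker fin Ps m])
qed

end

section \<open>Conjugacy in profinite groups\<close>

lemma finite_image_of_factor:
  assumes "finite (f ` A)" "\<And>x y. x \<in> A \<Longrightarrow> y \<in> A \<Longrightarrow> f x = f y \<Longrightarrow> g x = g y"
  shows "finite (g ` A)"
proof -
  have "g ` A \<subseteq> (\<lambda>z. g (inv_into A f z)) ` f ` A"
  proof
    fix z assume "z \<in> g ` A"
    then obtain x where x: "x \<in> A" "z = g x" by blast
    have "inv_into A f (f x) \<in> A" "f (inv_into A f (f x)) = f x"
      using x(1) by (auto intro: inv_into_into f_inv_into_f)
    then have "g (inv_into A f (f x)) = g x" using assms(2) x(1) by blast
    then show "z \<in> (\<lambda>z. g (inv_into A f z)) ` f ` A" using x by (intro image_eqI[of _ _ "f x"]) auto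
  qed
  then show ?thesis using assms(1) finite_subset by blast
qed

context profinite_group
begin

lemma finite_coset_image_of_open:
  assumes U: "U \<lhd> G" "openin T U" and X: "subgroup X G" and A: "subgroup A G" and UA: "U \<inter> A \<subseteq> X"
  shows "finite ((\<lambda>x. X #> x) ` A)"
proof (rule finite_image_of_factor)
  interpret U: normal U G by (rule U(1))
  note Ac = subgroup.mem_carrier[OF A]
  show "finite ((\<lambda>x. U #> x) ` A)"
    by (rule finite_subset[OF _ finite_open_quotient[OF U]]) (use Ac in \<open>auto simp: carrier_FactGroup\<close>)
  fix x y assume xy: "x \<in> A" "y \<in> A" and eq: "U #> x = U #> y"
  have "x \<otimes> inv y \<in> U" using U.quotient_eq_iff_right[OF Ac[OF xy(1)] Ac[OF xy(2)]] eq by simp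
  moreover have "x \<otimes> inv y \<in> A" by (intro subgroup.m_closed[OF A] subgroup.m_inv_closed[OF A] xy)
  ultimately have "x \<otimes> inv y \<in> X" using UA by blast
  then have "X #> (x \<otimes> inv y) #> y = X #> y" using subgroup.rcos_const[OF X is_group] by simp
  then show "X #> x = X #> y"
    using Ac[OF xy(1)] Ac[OF xy(2)] subgroup.subset[OF X] by (simp add: coset_mult_assoc m_assoc)
qed

text \<open>For an open normal subgroup \<open>U\<close>, the finite group \<open>G Mod (U N)\<close> is an image of \<open>J\<close>. The image of \<open>H\<close>
  contains, up to conjugacy, the image of a Sylow \<open>p\<close>-subgroup of \<open>J\<close>, which has index prime to \<open>p\<close>, for
  every \<open>p\<close>. So it is everything, and the closed set \<open>N H\<close> is dense.\<close>

lemma locally_conjugate_covers: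
  assumes N: "N \<lhd> G" "closedin T N" and J: "closed_subgroup G T J" and NJ: "N <#> J = carrier G"
    and H: "closed_subgroup G T H"
    and syl: "\<And>p::nat. prime p \<Longrightarrow> \<exists>P. sylow_subgroup p (G\<lparr>carrier := J\<rparr>) (subtopology T J) P \<and>
               (\<exists>g \<in> carrier G. conjugate G g P \<subseteq> H)"
  shows "N <#> H = carrier G"
proof -
  have Js: "subgroup J G" and Hs: "subgroup H G" "closedin T H"
    using J H unfolding closed_subgroup_def by auto
  interpret N: normal N G by (rule N(1))
  interpret J: profinite_group "G\<lparr>carrier := J\<rparr>" "subtopology T J" by (rule profinite_subgroup[OF J])
  have NH: "subgroup (N <#> H) G" by (rule mult_norm_subgroup[OF N(1) Hs(1)])
  have "x \<in> N <#> H" if x: "x \<in> carrier G" for x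
  proof (rule mem_closed_of_open_normal[OF closed_set_mult[OF N(2) Hs(2)] x])
    fix U assume U: "U \<lhd> G" "openin T U"
    define M where "M = U <#> N"
    have M: "M \<lhd> G" unfolding M_def by (rule normal_subgroup_set_mult_closed[OF U(1) N(1)])
    have Mop: "openin T M" unfolding M_def by (rule open_set_mult[OF U(2) N.subset])
    interpret M: normal M G by (rule M)
    let ?q = "\<lambda>x. M #> x"
    interpret q: group_hom G "G Mod M" ?q by (rule M.quotient_hom)
    have NM: "N \<subseteq> M" unfolding M_def
      by (rule subgroup_subset_set_mult(2)[OF normal_imp_subgroup[OF U(1)] N.subgroup_axioms])
    have fin: "finite (carrier (G Mod M))" by (rule finite_open_quotient[OF M Mop])
    have qJ: "?q ` J = carrier (G Mod M)"
    proof
      show "?q ` J \<subseteq> carrier (G Mod M)" using subgroup.subset[OF Js] by (auto simp: carrier_FactGroup)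
      show "carrier (G Mod M) \<subseteq> ?q ` J"
      proof
        fix z assume "z \<in> carrier (G Mod M)"
        then obtain g where g: "g \<in> carrier G" "z = ?q g" unfolding carrier_FactGroup by blast
        from g(1) have "g \<in> N <#> J" unfolding NJ .
        then obtain n j where nj: "n \<in> N" "j \<in> J" "g = n \<otimes> j" by (rule set_multE)
        have nc: "n \<in> carrier G" and jc: "j \<in> carrier G"
          by (rule N.mem_carrier[OF nj(1)], rule subgroup.mem_carrier[OF Js nj(2)])
        have "g \<otimes> inv j = n" unfolding nj(3) using nc jc by (simp add: m_assoc)
        then have "g \<otimes> inv j \<in> M" using nj(1) NM by auto
        then have "?q g = ?q j" using M.quotient_eq_iff_right[OF g(1) jc] by simp
        then show "z \<in> ?q ` J" using g(2) nj(2) by blast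
      qed
    qed
    have hJ: "group_hom (G\<lparr>carrier := J\<rparr>) (G Mod M) ?q" by (rule group_hom_subgroup[OF M.quotient_hom Js])
    have kerJ: "openin (subtopology T J) (kernel (G\<lparr>carrier := J\<rparr>) (G Mod M) ?q)"
    proof -
      have "kernel (G\<lparr>carrier := J\<rparr>) (G Mod M) ?q = kernel G (G Mod M) ?q \<inter> J"
        using subgroup.subset[OF Js] by (auto simp: kernel_def)
      then show ?thesis unfolding M.quotient_kernel using Mop by (auto simp: openin_subtopology)
    qed
    have qHs: "subgroup (?q ` H) (G Mod M)" by (rule q.subgroup_img_is_subgroup[OF Hs(1)])
    have "?q ` H = carrier (G Mod M)"
    proof (rule q.H.subgroup_eq_carrier_of_sylow[OF fin qHs])
      fix p :: nat assume p: "prime p"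
      obtain P g where P: "sylow_subgroup p (G\<lparr>carrier := J\<rparr>) (subtopology T J) P"
        and g: "g \<in> carrier G" "conjugate G g P \<subseteq> H" using syl[OF p] by blast
      note sy = J.sylow_image[OF p P hJ kerJ]
      have Ps: "subgroup P G" by (rule incl_subgroup[OF Js sy(1)])
      obtain m where m: "card (?q ` J) = card (?q ` P) * m" "\<not> p dvd m" using sy(3) by auto
      have qP: "subgroup (?q ` P) (G Mod M)" by (rule q.subgroup_img_is_subgroup[OF Ps])
      have qg: "?q g \<in> carrier (G Mod M)" by (rule q.hom_closed[OF g(1)])
      define R where "R = conjugate (G Mod M) (?q g) (?q ` P)"
      have R: "subgroup R (G Mod M)" unfolding R_def by (rule q.H.conjugate_subgroup[OF qP qg])
      have "R = ?q ` conjugate G g P"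
        unfolding R_def by (rule q.image_conjugate[OF subgroup.subset[OF Ps] g(1), symmetric])
      then have RH: "R \<subseteq> ?q ` H" using g(2) by blast
      have "card R = card (?q ` P)" unfolding R_def by (rule q.H.conjugate_card[OF subgroup.subset[OF qP] qg])
      then have "card (carrier (G Mod M)) = card R * m" using m(1) unfolding qJ by simp
      then show "\<exists>P m. subgroup P (G Mod M) \<and> P \<subseteq> ?q ` H \<and> card (carrier (G Mod M)) = card P * m \<and> \<not> p dvd m"
        using R RH m(2) by (intro exI[of _ R] exI[of _ m] conjI)
    qed
    moreover have "?q x \<in> carrier (G Mod M)" by (rule q.hom_closed[OF x])
    ultimately have "?q x \<in> ?q ` H" by simp
    then obtain h where h: "h \<in> H" "?q h = ?q x" by (metis imageE)
    have hc: "h \<in> carrier G" by (rule subgroup.mem_carrier[OF Hs(1) h(1)])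
    have "inv h \<otimes> x \<in> M" using M.quotient_eq_iff[OF hc x] h(2) by simp
    also have "M = N <#> U" unfolding M_def by (rule commut_normal[OF N.subgroup_axioms U(1), symmetric])
    finally obtain n u where nu: "n \<in> N" "u \<in> U" "inv h \<otimes> x = n \<otimes> u" by (rule set_multE)
    have nc: "n \<in> carrier G" and uc: "u \<in> carrier G"
      by (rule N.mem_carrier[OF nu(1)], rule subgroup.mem_carrier[OF normal_imp_subgroup[OF U(1)] nu(2)])
    have "x = h \<otimes> (inv h \<otimes> x)" using hc x by (simp add: inv_mult_cancel)
    also have "\<dots> = ((h \<otimes> n \<otimes> inv h) \<otimes> h) \<otimes> u" unfolding nu(3) using hc nc uc by (simp add: m_assoc)
    finally have xe: "x = ((h \<otimes> n \<otimes> inv h) \<otimes> h) \<otimes> u" .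
    have "(h \<otimes> n \<otimes> inv h) \<otimes> h \<in> N <#> H" by (rule set_multI[OF N.inv_op_closed2[OF hc nu(1)] h(1)])
    then show "x \<in> (N <#> H) <#> U" unfolding xe by (rule set_multI[OF _ nu(2)])
  qed
  then show ?thesis using subgroup.subset[OF NH] by blast
qed

text \<open>The subgroup \<open>(U \<inter> N) H\<close> is closed. Since \<open>G = H N\<close>, its cosets are represented by \<open>N\<close>, and modulo \<open>U \<inter> N\<close>
  finitely many representatives suffice; so it has finite index.\<close>

lemma open_enlargement:
  assumes N: "N \<lhd> G" "closedin T N" and H: "closed_subgroup G T H" and NH: "N <#> H = carrier G"
    and U: "U \<lhd> G" "openin T U"
  shows "openin T ((U \<inter> N) <#> H)"
proof -
  have Hs: "subgroup H G" "closedin T H" using H unfolding closed_subgroup_def by auto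
  interpret N: normal N G by (rule N(1))
  interpret U: normal U G by (rule U(1))
  define V where "V = U \<inter> N"
  have V: "V \<lhd> G" unfolding V_def by (rule normal_subgroup_intersect[OF U(1) N(1)])
  define H1 where "H1 = V <#> H"
  have H1: "subgroup H1 G" unfolding H1_def by (rule mult_norm_subgroup[OF V Hs(1)])
  have VH1: "V \<subseteq> H1" and HH1: "H \<subseteq> H1"
    unfolding H1_def by (rule subgroup_subset_set_mult[OF normal_imp_subgroup[OF V] Hs(1)])+
  have H1cl: "closedin T H1" unfolding H1_def V_def
    by (intro closed_set_mult closedin_Int open_subgroup_closed[OF U.subgroup_axioms U(2)] N(2) Hs(2))
  have HN: "H <#> N = carrier G" using commut_normal[OF Hs(1) N(1)] NH by simp
  have "rcosets H1 \<subseteq> (\<lambda>x. H1 #> x) ` N"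
  proof
    fix C assume "C \<in> rcosets H1"
    then obtain g where g: "g \<in> carrier G" "C = H1 #> g" unfolding RCOSETS_def by blast
    from g(1) have "g \<in> H <#> N" unfolding HN .
    then obtain h n where hn: "h \<in> H" "n \<in> N" "g = h \<otimes> n" by (rule set_multE)
    have "H1 #> g = H1 #> h #> n"
      unfolding hn(3)
      by (rule coset_mult_assoc[OF subgroup.subset[OF H1] subgroup.mem_carrier[OF Hs(1) hn(1)] N.mem_carrier[OF hn(2)], symmetric])
    also have "H1 #> h = H1" by (rule subgroup.rcos_const[OF H1 is_group subsetD[OF HH1 hn(1)]])
    finally show "C \<in> (\<lambda>x. H1 #> x) ` N" using g(2) hn(2) by blast
  qed
  moreover have "finite ((\<lambda>x. H1 #> x) ` N)"
    by (rule finite_coset_image_of_open[OF U H1 N.subgroup_axioms VH1[unfolded V_def]])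
  ultimately have "finite (rcosets H1)" by (rule finite_subset)
  then show ?thesis using closed_finite_index_open[OF H1 H1cl] unfolding H1_def V_def by simp
qed

text \<open>With \<open>V = U \<inter> N\<close>, the open subgroup \<open>H1 = V H\<close> meets \<open>N\<close> in
  \<open>K1 = V (N \<inter> H)\<close>. Let \<open>U2 \<subseteq> H1\<close> be open and normal, and put \<open>W = K1 (U2 \<inter> J)\<close>. In the finite group
  \<open>G Mod W\<close> the images of \<open>J\<close> and \<open>H1\<close> are complements of the image of \<open>N\<close>, and the theorem for finite
  groups applies. Finally \<open>H1 \<subseteq> H U\<close>.\<close>

lemma conjugate_into_mod_open:
  assumes N: "N \<lhd> G" "closedin T N" and proN: "pro nilpotent_group (G\<lparr>carrier := N\<rparr>) (subtopology T N)"
    and J: "closed_subgroup G T J" and NJ: "N <#> J = carrier G" "N \<inter> J = {\<one>}"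
    and pro: "pro supersolvable_group G T \<or> pro nilpotent_group (G\<lparr>carrier := J\<rparr>) (subtopology T J)"
    and H: "closed_subgroup G T H" and NH: "N <#> H = carrier G" and K: "N \<inter> H \<lhd> G"
    and syl: "\<And>p::nat. prime p \<Longrightarrow> \<exists>P. sylow_subgroup p (G\<lparr>carrier := J\<rparr>) (subtopology T J) P \<and>
               (\<exists>g \<in> carrier G. conjugate G g P \<subseteq> H)"
    and U: "U \<lhd> G" "openin T U"
  shows "\<exists>n\<in>N. conjugate G n J \<subseteq> H <#> U"
proof -
  have Js: "subgroup J G" "closedin T J" and Hs: "subgroup H G" "closedin T H"
    using J H unfolding closed_subgroup_def by auto
  interpret N: normal N G by (rule N(1))
  interpret U: normal U G by (rule U(1))
  interpret J: profinite_group "G\<lparr>carrier := J\<rparr>" "subtopology T J" by (rule profinite_subgroup[OF J])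
  note Jc = subgroup.mem_carrier[OF Js(1)] and Hc = subgroup.mem_carrier[OF Hs(1)]
  define V where "V = U \<inter> N"
  have V: "V \<lhd> G" unfolding V_def by (rule normal_subgroup_intersect[OF U(1) N(1)])
  interpret V: normal V G by (rule V)
  have Vcl: "closedin T V" unfolding V_def
    by (rule closedin_Int[OF open_subgroup_closed[OF U.subgroup_axioms U(2)] N(2)])
  define H1 where "H1 = V <#> H"
  have H1: "subgroup H1 G" unfolding H1_def by (rule mult_norm_subgroup[OF V Hs(1)])
  have HH1: "H \<subseteq> H1" unfolding H1_def
    by (rule subgroup_subset_set_mult(2)[OF V.subgroup_axioms Hs(1)])
  have H1op: "openin T H1" unfolding H1_def V_def by (rule open_enlargement[OF N H NH U])
  obtain U2 where U2: "U2 \<lhd> G" "openin T U2" "U2 \<subseteq> H1"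
    using open_normal_base[OF H1op subgroup.one_closed[OF H1]] by blast
  interpret U2: normal U2 G by (rule U2(1))
  define K1 where "K1 = V <#> (N \<inter> H)"
  have K1: "K1 \<lhd> G" unfolding K1_def by (rule normal_subgroup_set_mult_closed[OF V K])
  interpret K1: normal K1 G by (rule K1)
  have K1cl: "closedin T K1" unfolding K1_def by (intro closed_set_mult Vcl closedin_Int N(2) Hs(2))
  have K1H1: "K1 \<subseteq> H1" unfolding K1_def H1_def by (rule mono_set_mult[OF subset_refl Int_lower2])
  have K1N: "K1 \<subseteq> N"
  proof
    fix x assume "x \<in> K1"
    then obtain u k where uk: "u \<in> V" "k \<in> N \<inter> H" "x = u \<otimes> k" unfolding K1_def by (rule set_multE)
    show "x \<in> N" unfolding uk(3) by (rule subgroup.m_closed[OF N.subgroup_axioms]) (use uk V_def in auto)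
  qed
  have NH1: "x \<in> K1" if x: "x \<in> N" "x \<in> H1" for x
  proof -
    from x(2) obtain u h where uh: "u \<in> V" "h \<in> H" "x = u \<otimes> h" unfolding H1_def by (rule set_multE)
    have c: "u \<in> carrier G" "h \<in> carrier G" by (rule V.mem_carrier[OF uh(1)], rule Hc[OF uh(2)])
    have uN: "u \<in> N" using uh(1) unfolding V_def by blast
    have "h = inv u \<otimes> x" unfolding uh(3) using c by (simp add: inv_mult_cancel)
    also have "\<dots> \<in> N" by (intro subgroup.m_closed[OF N.subgroup_axioms] subgroup.m_inv_closed[OF N.subgroup_axioms] x(1) uN)
    finally have "h \<in> N \<inter> H" using uh(2) by blast
    then show ?thesis unfolding K1_def uh(3) by (rule set_multI[OF uh(1)])
  qed
  define X where "X = U2 \<inter> J"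
  have Xn: "X \<lhd> G\<lparr>carrier := J\<rparr>" unfolding X_def by (rule normal_Int_subgroup[OF Js(1) U2(1)])
  have Xs: "subgroup X G" unfolding X_def by (rule subgroups_Inter_pair[OF U2.subgroup_axioms Js(1)])
  have Xcl: "closedin T X" unfolding X_def
    by (rule closedin_Int[OF open_subgroup_closed[OF U2.subgroup_axioms U2(2)] Js(2)])
  define W where "W = K1 <#> X"
  have Ws: "subgroup W G" unfolding W_def by (rule mult_norm_subgroup[OF K1 Xs])
  have K1W: "K1 \<subseteq> W" unfolding W_def by (rule subgroup_subset_set_mult(1)[OF K1.subgroup_axioms Xs])
  have XW: "X \<subseteq> W" unfolding W_def
    by (rule subgroup_subset_set_mult(2)[OF K1.subgroup_axioms Xs])
  have Wcl: "closedin T W" unfolding W_def by (rule closed_set_mult[OF K1cl Xcl])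
  have WH1: "W \<subseteq> H1"
  proof
    fix x assume "x \<in> W"
    then obtain k y where ky: "k \<in> K1" "y \<in> X" "x = k \<otimes> y" unfolding W_def by (rule set_multE)
    show "x \<in> H1" unfolding ky(3) by (rule subgroup.m_closed[OF H1]) (use ky K1H1 U2(3) X_def in auto)
  qed
  have W: "W \<lhd> G"
    unfolding W_def
  proof (rule normal_set_mult_of_complement[OF K1 N(1) Js(1) NJ(1) Xn])
    fix n y assume n: "n \<in> N" and y: "y \<in> X"
    note c = N.mem_carrier[OF n] subgroup.mem_carrier[OF Xs y]
    have yU: "y \<in> U2" using y unfolding X_def by blast
    have "n \<otimes> (y \<otimes> inv n \<otimes> inv y) \<in> N"
      by (intro subgroup.m_closed[OF N.subgroup_axioms n] N.inv_op_closed2[OF c(2)] subgroup.m_inv_closed[OF N.subgroup_axioms n])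
    then have "n \<otimes> y \<otimes> inv n \<otimes> inv y \<in> N" using c by (simp add: m_assoc)
    moreover have "n \<otimes> y \<otimes> inv n \<otimes> inv y \<in> U2"
      by (rule subgroup.m_closed[OF U2.subgroup_axioms U2.inv_op_closed2[OF c(1) yU] subgroup.m_inv_closed[OF U2.subgroup_axioms yU]])
    ultimately show "n \<otimes> y \<otimes> inv n \<otimes> inv y \<in> K1" using NH1 U2(3) by blast
  qed
  interpret W: normal W G by (rule W)
  let ?q = "\<lambda>x. W #> x"
  let ?F = "G Mod W"
  interpret q: group_hom G ?F ?q by (rule W.quotient_hom)
  have finF: "finite (carrier ?F)"
  proof -
    have "U2 \<inter> N \<subseteq> W" using NH1 U2(3) K1W by blast
    then have fN: "finite (?q ` N)" by (rule finite_coset_image_of_open[OF U2(1,2) Ws N.subgroup_axioms])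
    have fJ: "finite (?q ` J)"
      by (rule finite_coset_image_of_open[OF U2(1,2) Ws Js(1)]) (use XW X_def in simp)
    have "?q ` N <#>\<^bsub>?F\<^esub> ?q ` J = (\<lambda>(a, b). a \<otimes>\<^bsub>?F\<^esub> b) ` (?q ` N \<times> ?q ` J)"
      unfolding set_mult_def by auto
    moreover have "?q ` N <#>\<^bsub>?F\<^esub> ?q ` J = carrier ?F"
      by (rule W.quotient_image_product[OF N.subset subgroup.subset[OF Js(1)]]) (simp add: NJ(1))
    ultimately show ?thesis using fN fJ by (metis finite_cartesian_product finite_imageI)
  qed
  have "finite (rcosets W)" using finF by (simp add: FactGroup_def)
  then have Wop: "openin T W" by (rule closed_finite_index_open[OF Ws Wcl])
  have hA: "group_hom (G\<lparr>carrier := A\<rparr>) ?F ?q" if "subgroup A G" for A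
    by (rule group_hom_subgroup[OF W.quotient_hom that])
  have kerA: "openin (subtopology T A) (kernel (G\<lparr>carrier := A\<rparr>) ?F ?q)" if A: "subgroup A G" for A
  proof -
    have "kernel (G\<lparr>carrier := A\<rparr>) ?F ?q = kernel G ?F ?q \<inter> A"
      using subgroup.subset[OF A] by (auto simp: kernel_def)
    then show ?thesis unfolding W.quotient_kernel using Wop by (auto simp: openin_subtopology)
  qed
  have surj: "?q ` carrier G = carrier ?F" by (simp add: carrier_FactGroup)
  have "\<exists>g\<in>carrier ?F. conjugate ?F g (?q ` J) \<subseteq> ?q ` H1"
  proof (rule q.H.locally_conjugate_complements[OF finF])
    show "?q ` N \<lhd> ?F" by (rule N.surj_hom_normal_subgroup[OF W.quotient_hom surj])
    show "nilpotent_group (?F\<lparr>carrier := ?q ` N\<rparr>)"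
      using pronilpotent_image[OF proN hA[OF N.subgroup_axioms] kerA[OF N.subgroup_axioms]] by simp
    show "subgroup (?q ` J) ?F" "subgroup (?q ` H1) ?F" by (intro q.subgroup_img_is_subgroup Js(1) H1)+
    show "?q ` N <#>\<^bsub>?F\<^esub> ?q ` J = carrier ?F"
      by (rule W.quotient_image_product[OF N.subset subgroup.subset[OF Js(1)]]) (simp add: NJ(1))
    show "?q ` N <#>\<^bsub>?F\<^esub> ?q ` H1 = carrier ?F"
      by (rule W.quotient_image_product[OF N.subset subgroup.subset[OF H1]]) (unfold NH[symmetric], rule mono_set_mult[OF subset_refl HH1])
    have one: "\<one>\<^bsub>?F\<^esub> \<in> ?q ` A" if "subgroup A G" for A
      using imageI[OF subgroup.one_closed[OF that], of ?q] unfolding q.hom_one .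
    \<comment> \<open>A congruence \<open>j \<equiv> n\<close> modulo \<open>W = K1 X\<close> reads \<open>j \<otimes> inv y = n \<otimes> k\<close> with \<open>y \<in> X \<subseteq> J\<close> and \<open>k \<in> K1 \<subseteq> N\<close>.\<close>
    show "?q ` N \<inter> ?q ` J = {\<one>\<^bsub>?F\<^esub>}"
    proof
      show "?q ` N \<inter> ?q ` J \<subseteq> {\<one>\<^bsub>?F\<^esub>}"
      proof
        fix z assume "z \<in> ?q ` N \<inter> ?q ` J"
        then obtain n j where nj: "n \<in> N" "z = ?q n" "j \<in> J" "z = ?q j" by blast
        note c = N.mem_carrier[OF nj(1)] Jc[OF nj(3)]
        have "inv n \<otimes> j \<in> W" using W.quotient_eq_iff[OF c] nj(2,4) by simp
        then obtain k y where ky: "k \<in> K1" "y \<in> X" "inv n \<otimes> j = k \<otimes> y" unfolding W_def by (rule set_multE)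
        have kc: "k \<in> carrier G" and yc: "y \<in> carrier G"
          by (rule K1.mem_carrier[OF ky(1)], rule subgroup.mem_carrier[OF Xs ky(2)])
        have "n \<otimes> (inv n \<otimes> j) \<otimes> inv y = n \<otimes> (k \<otimes> y) \<otimes> inv y" unfolding ky(3) ..
        then have e: "j \<otimes> inv y = n \<otimes> k" using c kc yc by (simp add: m_assoc inv_mult_cancel)
        have yJ: "y \<in> J" using ky(2) unfolding X_def by blast
        have "j \<otimes> inv y \<in> J" by (intro subgroup.m_closed[OF Js(1)] subgroup.m_inv_closed[OF Js(1)] nj(3) yJ)
        moreover have "n \<otimes> k \<in> N" by (intro subgroup.m_closed[OF N.subgroup_axioms] nj(1) subsetD[OF K1N ky(1)])
        ultimately have "j \<otimes> inv y \<in> N \<inter> J" using e by simp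
        then have "j \<otimes> inv y = \<one>" unfolding NJ(2) by simp
        then have "j \<otimes> inv y \<otimes> y = y" using yc by simp
        then have "j = y" using c(2) yc by (simp add: m_assoc)
        then have "j \<in> W" using ky(2) XW by blast
        then have "?q j = W" by (rule W.rcos_const[OF is_group])
        then show "z \<in> {\<one>\<^bsub>?F\<^esub>}" using nj(4) by simp
      qed
      show "{\<one>\<^bsub>?F\<^esub>} \<subseteq> ?q ` N \<inter> ?q ` J" using one[OF N.subgroup_axioms] one[OF Js(1)] by blast
    qed
    show "?q ` N \<inter> ?q ` H1 = {\<one>\<^bsub>?F\<^esub>}"
    proof
      show "?q ` N \<inter> ?q ` H1 \<subseteq> {\<one>\<^bsub>?F\<^esub>}"
      proof
        fix z assume "z \<in> ?q ` N \<inter> ?q ` H1"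
        then obtain n where n: "n \<in> N" "z = ?q n" "?q n \<in> ?q ` H1" by blast
        have "n \<in> H1" using W.quotient_image_mem_iff[OF H1 WH1 N.mem_carrier[OF n(1)]] n(3) by simp
        then have "n \<in> W" using NH1[OF n(1)] K1W by blast
        then have "?q n = W" by (rule W.rcos_const[OF is_group])
        then show "z \<in> {\<one>\<^bsub>?F\<^esub>}" using n(2) by simp
      qed
      show "{\<one>\<^bsub>?F\<^esub>} \<subseteq> ?q ` N \<inter> ?q ` H1" using one[OF N.subgroup_axioms] one[OF H1] by blast
    qed
    show "nilpotent_group (?F\<lparr>carrier := ?q ` J\<rparr>) \<or> nilpotent_group (?F\<lparr>carrier := derived ?F (carrier ?F)\<rparr>)"
      using pro
    proof
      assume p: "pro supersolvable_group G T"
      have "openin T (kernel G ?F ?q)" unfolding W.quotient_kernel by (rule Wop)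
      from prosupersolvable_image[OF p W.quotient_hom this] show ?thesis unfolding surj by simp
    next
      assume p: "pro nilpotent_group (G\<lparr>carrier := J\<rparr>) (subtopology T J)"
      show ?thesis using pronilpotent_image[OF p hA[OF Js(1)] kerA[OF Js(1)]] by simp
    qed
    fix p :: nat assume p: "prime p"
    obtain P g where P: "sylow_subgroup p (G\<lparr>carrier := J\<rparr>) (subtopology T J) P"
      and g: "g \<in> carrier G" "conjugate G g P \<subseteq> H" using syl[OF p] by blast
    note sy = J.sylow_image[OF p P hA[OF Js(1)] kerA[OF Js(1)]]
    have Ps: "subgroup P G" by (rule incl_subgroup[OF Js(1) sy(1)])
    have PJ: "P \<subseteq> J" using subgroup.subset[OF sy(1)] by simp
    obtain c where c: "card (?q ` P) = p ^ c" using sy(2) by blast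
    obtain m where m: "card (?q ` J) = card (?q ` P) * m" "\<not> p dvd m" using sy(3) by auto
    have "conjugate ?F (?q g) (?q ` P) = ?q ` conjugate G g P"
      by (rule q.image_conjugate[OF subgroup.subset[OF Ps] g(1), symmetric])
    also have "\<dots> \<subseteq> ?q ` H1" using g(2) HH1 by blast
    finally have cj: "conjugate ?F (?q g) (?q ` P) \<subseteq> ?q ` H1" .
    show "\<exists>Q c m g. subgroup Q ?F \<and> Q \<subseteq> ?q ` J \<and> card Q = p ^ c \<and> card (?q ` J) = card Q * m \<and>
      \<not> p dvd m \<and> g \<in> carrier ?F \<and> conjugate ?F g Q \<subseteq> ?q ` H1"
      by (intro exI[of _ "?q ` P"] exI[of _ c] exI[of _ m] exI[of _ "?q g"] conjI q.subgroup_img_is_subgroup[OF Ps]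
          image_mono[OF PJ] c m q.hom_closed[OF g(1)] cj)
  qed
  then obtain g where g: "g \<in> carrier G" "conjugate ?F (?q g) (?q ` J) \<subseteq> ?q ` H1"
    unfolding carrier_FactGroup by blast
  have gJ: "conjugate G g J \<subseteq> H1"
    by (rule W.conjugate_subset_of_quotient[OF g(1) subgroup.subset[OF Js(1)] H1 WH1 g(2)])
  from g(1) have "g \<in> N <#> J" unfolding NJ(1) .
  then obtain n j where nj: "n \<in> N" "j \<in> J" "g = n \<otimes> j" by (rule set_multE)
  have "conjugate G g J = conjugate G n J"
    using conjugate_conjugate[OF subgroup.subset[OF Js(1)] N.mem_carrier[OF nj(1)] Jc[OF nj(2)]]
      conjugate_self[OF Js(1) nj(2)] nj(3) by simp
  moreover have "H1 \<subseteq> H <#> U"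
  proof -
    have "H1 \<subseteq> U <#> H" unfolding H1_def V_def by (rule mono_set_mult[OF Int_lower1 subset_refl])
    then show ?thesis using commut_normal[OF Hs(1) U(1)] by simp
  qed
  ultimately show ?thesis using gJ nj(1) by blast
qed

end

theorem corollary1p3:
  fixes G :: "('a, 'm) monoid_scheme" and T :: "'a topology" and N J H :: "'a set"
  assumes "profinite_semidirect_product G T N J"
    and "pronilpotent (G\<lparr>carrier := N\<rparr>) (subtopology T N)"
    and "prosupersolvable G T \<or> pronilpotent (G\<lparr>carrier := J\<rparr>) (subtopology T J)"
    and "closed_subgroup G T H"
    and "N \<inter> H \<lhd> G\<lparr>carrier := N\<rparr>"
    and "\<And>p::nat. prime p \<Longrightarrow>
           \<exists>P. sylow_subgroup p (G\<lparr>carrier := J\<rparr>) (subtopology T J) P \<and>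
               (\<exists>g \<in> carrier G. conjugate G g P \<subseteq> H)"
  shows "\<exists>g \<in> carrier G. conjugate G g J \<subseteq> H"
proof -
  have pG: "pro group G T" and N: "N \<lhd> G" "closedin T N" and J: "closed_subgroup G T J"
    and NJ: "N <#>\<^bsub>G\<^esub> J = carrier G" "N \<inter> J = {\<one>\<^bsub>G\<^esub>}"
    using assms(1) unfolding profinite_semidirect_product_def profinite_def by auto
  interpret profinite_group G T by (rule pro_cases(1)[OF pG])
  interpret N: normal N G by (rule N(1))
  have Js: "subgroup J G" and Hs: "subgroup H G" "closedin T H"
    using J assms(4) unfolding closed_subgroup_def by auto
  have NH: "N <#>\<^bsub>G\<^esub> H = carrier G"
    by (rule locally_conjugate_covers[OF N J NJ(1) assms(4) assms(6)])
  have K: "N \<inter> H \<lhd> G"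
  proof (rule normal_invI[OF subgroups_Inter_pair[OF N.subgroup_axioms Hs(1)]])
    fix g x assume g: "g \<in> carrier G" and x: "x \<in> N \<inter> H"
    from g have "g \<in> N <#>\<^bsub>G\<^esub> H" unfolding NH .
    then obtain n h where nh: "n \<in> N" "h \<in> H" "g = n \<otimes>\<^bsub>G\<^esub> h" by (rule set_multE)
    have xN: "x \<in> N" and xH: "x \<in> H" using x by auto
    have hc: "h \<in> carrier G" by (rule subgroup.mem_carrier[OF Hs(1) nh(2)])
    define y where "y = h \<otimes>\<^bsub>G\<^esub> x \<otimes>\<^bsub>G\<^esub> inv\<^bsub>G\<^esub> h"
    have yN: "y \<in> N" unfolding y_def by (rule N.inv_op_closed2[OF hc xN])
    moreover have "y \<in> H" unfolding y_def
      by (intro subgroup.m_closed[OF Hs(1)] subgroup.m_inv_closed[OF Hs(1)] nh(2) xH)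
    ultimately have "n \<otimes>\<^bsub>G\<^esub> y \<otimes>\<^bsub>G\<^esub> inv\<^bsub>G\<^esub> n \<in> N \<inter> H"
      using normal.inv_op_closed2[OF assms(5), of n y] nh(1) m_inv_consistent[OF N.subgroup_axioms nh(1)] by simp
    then show "g \<otimes>\<^bsub>G\<^esub> x \<otimes>\<^bsub>G\<^esub> inv\<^bsub>G\<^esub> g \<in> N \<inter> H"
      unfolding y_def nh(3) using N.mem_carrier[OF nh(1)] N.mem_carrier[OF xN] hc
      by (simp add: m_assoc inv_mult_group)
  qed
  define \<U> where "\<U> = {U. U \<lhd> G \<and> openin T U}"
  define S where "S U = N \<inter> (\<Inter>j\<in>J. {n \<in> topspace T. n \<otimes>\<^bsub>G\<^esub> j \<otimes>\<^bsub>G\<^esub> inv\<^bsub>G\<^esub> n \<in> H <#>\<^bsub>G\<^esub> U})" for U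
  have "(\<Inter>U\<in>\<U>. S U) \<noteq> {}"
  proof (rule compact_directed_Inter_nonempty[OF compact])
    show "\<U> \<noteq> {}" unfolding \<U>_def using normal_self openin_topspace[of T] topspace_eq by auto
    fix U assume "U \<in> \<U>"
    then have U: "U \<lhd> G" "openin T U" unfolding \<U>_def by auto
    have HU: "closedin T (H <#>\<^bsub>G\<^esub> U)"
      by (rule closed_set_mult[OF Hs(2) open_subgroup_closed[OF normal_imp_subgroup[OF U(1)] U(2)]])
    have "closedin T {n \<in> topspace T. n \<otimes>\<^bsub>G\<^esub> j \<otimes>\<^bsub>G\<^esub> inv\<^bsub>G\<^esub> n \<in> H <#>\<^bsub>G\<^esub> U}" if "j \<in> J" for j
      by (intro closedin_continuous_map_preimage[OF _ HU] continuous_map_mult continuous_map_invert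
          continuous_map_id[unfolded id_def] continuous_map_constant subgroup.mem_carrier[OF Js that])
    then show "closedin T (S U)"
      unfolding S_def using subgroup.one_closed[OF Js] by (intro closedin_Int N(2) closedin_INT) auto
    obtain n where "n \<in> N" "conjugate G n J \<subseteq> H <#>\<^bsub>G\<^esub> U"
      using conjugate_into_mod_open[OF N assms(2)[unfolded pronilpotent_def] J NJ
        assms(3)[unfolded pronilpotent_def prosupersolvable_def] assms(4) NH K assms(6) U] by blast
    then have "n \<in> S U" unfolding S_def conjugate_def using N.mem_carrier topspace_eq by auto
    then show "S U \<noteq> {}" by blast
  next
    fix U V assume "U \<in> \<U>" "V \<in> \<U>"
    then have "U \<inter> V \<in> \<U>" unfolding \<U>_def using open_normal_Int by blast
    moreover have "H <#>\<^bsub>G\<^esub> (U \<inter> V) \<subseteq> H <#>\<^bsub>G\<^esub> U" "H <#>\<^bsub>G\<^esub> (U \<inter> V) \<subseteq> H <#>\<^bsub>G\<^esub> V"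
      by (intro mono_set_mult; simp)+
    then have "S (U \<inter> V) \<subseteq> S U \<inter> S V" unfolding S_def by blast
    ultimately show "\<exists>k\<in>\<U>. S k \<subseteq> S U \<inter> S V" by (rule bexI[rotated])
  qed
  then obtain n where n: "\<And>U. U \<in> \<U> \<Longrightarrow> n \<in> S U" by blast
  have "carrier G \<in> \<U>" unfolding \<U>_def using normal_self openin_topspace[of T] topspace_eq by auto
  then have nc: "n \<in> carrier G" using n N.mem_carrier unfolding S_def by blast
  have "n \<otimes>\<^bsub>G\<^esub> j \<otimes>\<^bsub>G\<^esub> inv\<^bsub>G\<^esub> n \<in> H" if j: "j \<in> J" for j
  proof (rule mem_closed_of_open_normal[OF Hs(2)])
    show "n \<otimes>\<^bsub>G\<^esub> j \<otimes>\<^bsub>G\<^esub> inv\<^bsub>G\<^esub> n \<in> carrier G" using nc subgroup.mem_carrier[OF Js j] by simp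
    fix U assume "U \<lhd> G" "openin T U"
    then have "n \<in> S U" using n unfolding \<U>_def by simp
    then show "n \<otimes>\<^bsub>G\<^esub> j \<otimes>\<^bsub>G\<^esub> inv\<^bsub>G\<^esub> n \<in> H <#>\<^bsub>G\<^esub> U" unfolding S_def using j by blast
  qed
  then have "conjugate G n J \<subseteq> H" unfolding conjugate_def by blast
  then show ?thesis using nc by blast
qed

end
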